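(* Let $n\ge 2$ and $2\le k\le n+2$. Each of the maps $R_{n+k},I_{n+k}:\mathbb{B}^n\to D^{IV}_{n+k}$ defined below (for every admissible choice of the parameters) is a minimum holomorphic isometry.
   Context: $\mathbb{B}^n=\{z\in\mathbb{C}^n:|z|^2<1\}$; $D^{IV}_m=\{Z\in\mathbb{C}^m: Z\overline{Z}^t<2,\ 1-Z\overline{Z}^t+\tfrac14|ZZ^t|^2>0\}$ (row vectors). Bergman metric $\omega_\Omega=\sqrt{-1}\partial\bar\partial\log K_\Omega$, where $K_{\mathbb{B}^n}=c(1-|z|^2)^{-(n+1)}$, $K_{D^{IV}_m}=c'(1-Z\overline{Z}^t+\tfrac14|ZZ^t|^2)^{-m}$. A holomorphic map $F:D\to\Omega$ is a holomorphic isometry if $F^*\omega_\Omega=\lambda\omega_D$ for a constant $\lambda>0$. Maps $F_1,F_2:\mathbb{B}^n\to D^{IV}_m$ are equivalent if $F_1=\phi\circ F_2\circ\psi$ with $\psi\in\mathrm{Aut}(\mathbb{B}^n)$, $\phi\in\mathrm{Aut}(D^{IV}_m)$ (biholomorphic automorphisms). A holomorphic map $F:\mathbb{B}^n\to D^{IV}_m$ is minimum if there is no holomorphic map $G:\mathbb{B}^n\to D^{IV}_{m-1}$ with $F$ equivalent to $(G,0)$. Write $i=\sqrt{-1}$, and $\sqrt{\cdot}$ denotes the branch with $\sqrt1=1$ (the radicands below are $1-w$ with $|w|<1$ on $\mathbb{B}^n$). (a) For $2\le k\le n$, parameters $\theta_1,\dots,\theta_{k-1}\in(0,\pi/4]$;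 put $A=\sum_{j=1}^{k-1}\cos(2\theta_j)z_j^2+\sum_{j=k}^{n-1}z_j^2$ and $R_{n+k}(z)=\big(\cos\theta_1z_1, i\sin\theta_1z_1,\dots,\cos\theta_{k-1}z_{k-1}, i\sin\theta_{k-1}z_{k-1}, z_k,\dots,z_{n-1}, \frac{A-2z_n^2+2z_n}{2\sqrt2(1-z_n)}, \frac{A+2z_n^2-2z_n}{2\sqrt{2}\,i\,(1-z_n)}\big)$ (when $k=n$ the block $z_k,\dots,z_{n-1}$ is empty), and $I_{n+k}(z)=\big(\cos\theta_1z_1, i\sin\theta_1z_1,\dots,\cos\theta_{k-1}z_{k-1}, i\sin\theta_{k-1}z_{k-1}, z_k,\dots,z_n, 1-\sqrt{1-\sum_{j=1}^{k-1}\cos(2\theta_j)z_j^2-\sum_{j=k}^nz_j^2}\big)$. (b) $k=n+1$: $R_{2n+1}(z)=\big(\cos\theta_1z_1,i\sin\theta_1z_1,\dots,\cos\theta_{n-1}z_{n-1},i\sin\theta_{n-1}z_{n-1},z_n,\frac{S}{2\sqrt2},\frac{-iS}{2\sqrt2}\big)$ with $S=\sum_{j=1}^{n-1}\cos(2\theta_j)z_j^2+z_n^2$, $\theta_1,\dots,\theta_{n-1}\in(0,\pi/4]$; and $I_{2n+1}(z)=\big(\cos\theta_1z_1,i\sin\theta_1z_1,\dots,\cos\theta_nz_n,i\sin\theta_nz_n,1-\sqrt{1-\sum_{j=1}^n\cos(2\theta_j)z_j^2}\big)$ with $\theta_1,\dots,\theta_n\in(0,\pi/4]$ not all equal to $\pi/4$.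 (c) $k=n+2$: with $\theta_1,\dots,\theta_n\in(0,\pi/4]$ not all equal to $\pi/4$, $\theta\in(0,\pi/4)$, and $T=\sum_{j=1}^n\cos(2\theta_j)z_j^2$: $R_{2n+2}(z)=\big(\cos\theta_1z_1,i\sin\theta_1z_1,\dots,\cos\theta_nz_n,i\sin\theta_nz_n,\frac{T}{2\sqrt2},\frac{-iT}{2\sqrt2}\big)$ and $I_{2n+2}(z)=\big(\cos\theta_1z_1,i\sin\theta_1z_1,\dots,\cos\theta_nz_n,i\sin\theta_nz_n,\frac{\cos\theta}{\cos2\theta}(1-\sqrt{1-\cos(2\theta)T}),\frac{i\sin\theta}{\cos2\theta}(1-\sqrt{1-\cos(2\theta)T})\big)$. *)

theory Defs
  imports "HOL-Analysis.Analysis"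
begin

(* Points of C^n are represented as functions nat => complex vanishing at indices >= n.
   Coordinates are 0-based: z 0, ..., z (n-1) stand for z_1, ..., z_n. *)

definition cvec :: "nat \<Rightarrow> (nat \<Rightarrow> complex) set" where
  "cvec n = {z. \<forall>j\<ge>n. z j = 0}"

definition cnorm :: "nat \<Rightarrow> (nat \<Rightarrow> complex) \<Rightarrow> real" where
  "cnorm n z = sqrt (\<Sum>j<n. (cmod (z j))^2)"

definition cball_n :: "nat \<Rightarrow> (nat \<Rightarrow> complex) set" where
  "cball_n n = {z \<in> cvec n. (\<Sum>j<n. (cmod (z j))^2) < 1}"

definition zzbar :: "nat \<Rightarrow> (nat \<Rightarrow> complex) \<Rightarrow> real" where
  "zzbar m Z = (\<Sum>a<m. (cmod (Z a))^2)"

definition zzt :: "nat \<Rightarrow> (nat \<Rightarrow> complex) \<Rightarrow> complex" where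
  "zzt m Z = (\<Sum>a<m. (Z a)^2)"

definition DIV :: "nat \<Rightarrow> (nat \<Rightarrow> complex) set" where
  "DIV m = {Z \<in> cvec m. zzbar m Z < 2 \<and> 1 - zzbar m Z + (cmod (zzt m Z))^2 / 4 > 0}"

definition holo_map :: "nat \<Rightarrow> nat \<Rightarrow> (nat \<Rightarrow> complex) set \<Rightarrow> (nat \<Rightarrow> complex) set
    \<Rightarrow> ((nat \<Rightarrow> complex) \<Rightarrow> (nat \<Rightarrow> complex)) \<Rightarrow> bool" where
  "holo_map n m U V F \<longleftrightarrow> F ` U \<subseteq> V \<and>
     (\<forall>z\<in>U. \<exists>A :: nat \<Rightarrow> nat \<Rightarrow> complex. \<forall>\<epsilon>>0. \<exists>\<delta>>0. \<forall>w\<in>U.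
        cnorm n (\<lambda>j. w j - z j) < \<delta> \<longrightarrow>
        cnorm m (\<lambda>a. F w a - F z a - (\<Sum>j<n. A a j * (w j - z j)))
          \<le> \<epsilon> * cnorm n (\<lambda>j. w j - z j))"

definition aut :: "nat \<Rightarrow> (nat \<Rightarrow> complex) set \<Rightarrow> ((nat \<Rightarrow> complex) \<Rightarrow> (nat \<Rightarrow> complex)) \<Rightarrow> bool" where
  "aut n U \<phi> \<longleftrightarrow> bij_betw \<phi> U U \<and> holo_map n n U U \<phi> \<and> holo_map n n U U (inv_into U \<phi>)"

definition evec :: "nat \<Rightarrow> nat \<Rightarrow> complex" where
  "evec j = (\<lambda>i. if i = j then 1 else 0)"

definition dd :: "((nat \<Rightarrow> complex) \<Rightarrow> real) \<Rightarrow> (nat \<Rightarrow> complex) \<Rightarrow> (nat \<Rightarrow> complex) \<Rightarrow> (nat \<Rightarrow> complex) \<Rightarrow> real" where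
  "dd \<phi> z u v = deriv (\<lambda>s::real. deriv (\<lambda>t::real. \<phi> (\<lambda>i. z i + of_real s * u i + of_real t * v i)) 0) 0"

(* mixed Wirtinger derivative d^2 phi / dz_j d(conj z_l) *)
definition wirt :: "((nat \<Rightarrow> complex) \<Rightarrow> real) \<Rightarrow> (nat \<Rightarrow> complex) \<Rightarrow> nat \<Rightarrow> nat \<Rightarrow> complex" where
  "wirt \<phi> z j l = (1/4) * (complex_of_real (dd \<phi> z (evec j) (evec l))
      + complex_of_real (dd \<phi> z (\<lambda>i. \<i> * evec j i) (\<lambda>i. \<i> * evec l i))
      + \<i> * complex_of_real (dd \<phi> z (evec j) (\<lambda>i. \<i> * evec l i)
                           - dd \<phi> z (\<lambda>i. \<i> * evec j i) (evec l)))"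

(* Bergman kernels (the positive normalising constants c, c' are dropped: they do not
   affect i dd-bar log K) *)
definition K_ball :: "nat \<Rightarrow> (nat \<Rightarrow> complex) \<Rightarrow> real" where
  "K_ball n z = (1 - (\<Sum>j<n. (cmod (z j))^2)) powr (- real (n + 1))"

definition K_DIV :: "nat \<Rightarrow> (nat \<Rightarrow> complex) \<Rightarrow> real" where
  "K_DIV m Z = (1 - zzbar m Z + (cmod (zzt m Z))^2 / 4) powr (- real m)"

definition g_ball :: "nat \<Rightarrow> (nat \<Rightarrow> complex) \<Rightarrow> nat \<Rightarrow> nat \<Rightarrow> complex" where
  "g_ball n z j l = wirt (\<lambda>w. ln (K_ball n w)) z j l"

definition g_DIV :: "nat \<Rightarrow> (nat \<Rightarrow> complex) \<Rightarrow> nat \<Rightarrow> nat \<Rightarrow> complex" where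
  "g_DIV m Z a b = wirt (\<lambda>W. ln (K_DIV m W)) Z a b"

definition cpartial :: "((nat \<Rightarrow> complex) \<Rightarrow> (nat \<Rightarrow> complex)) \<Rightarrow> nat \<Rightarrow> nat \<Rightarrow> (nat \<Rightarrow> complex) \<Rightarrow> complex" where
  "cpartial F a j z = deriv (\<lambda>w::complex. F (\<lambda>i. z i + w * evec j i) a) 0"

definition holo_isometry :: "nat \<Rightarrow> nat \<Rightarrow> ((nat \<Rightarrow> complex) \<Rightarrow> (nat \<Rightarrow> complex)) \<Rightarrow> bool" where
  "holo_isometry n m F \<longleftrightarrow> holo_map n m (cball_n n) (DIV m) F \<and>
     (\<exists>c::real. c > 0 \<and> (\<forall>z\<in>cball_n n. \<forall>j<n. \<forall>l<n.
        (\<Sum>a<m. \<Sum>b<m. cpartial F a j z * g_DIV m (F z) a b * cnj (cpartial F b l z))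
          = complex_of_real c * g_ball n z j l))"

definition equiv_maps :: "nat \<Rightarrow> nat \<Rightarrow> ((nat \<Rightarrow> complex) \<Rightarrow> (nat \<Rightarrow> complex))
    \<Rightarrow> ((nat \<Rightarrow> complex) \<Rightarrow> (nat \<Rightarrow> complex)) \<Rightarrow> bool" where
  "equiv_maps n m F1 F2 \<longleftrightarrow> (\<exists>\<phi> \<psi>. aut n (cball_n n) \<psi> \<and> aut m (DIV m) \<phi> \<and>
     (\<forall>z\<in>cball_n n. F1 z = \<phi> (F2 (\<psi> z))))"

definition minimum_map :: "nat \<Rightarrow> nat \<Rightarrow> ((nat \<Rightarrow> complex) \<Rightarrow> (nat \<Rightarrow> complex)) \<Rightarrow> bool" where
  "minimum_map n m F \<longleftrightarrow> \<not> (\<exists>G. holo_map n (m - 1) (cball_n n) (DIV (m - 1)) G \<and>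
     equiv_maps n m F (\<lambda>z. (G z)(m - 1 := 0)))"

(* block (cos th_1 z_1, i sin th_1 z_1, ..., cos th_p z_p, i sin th_p z_p) at indices < 2p;
   th j (0-based) is theta_{j+1} *)
definition pairblock :: "(nat \<Rightarrow> real) \<Rightarrow> (nat \<Rightarrow> complex) \<Rightarrow> nat \<Rightarrow> complex" where
  "pairblock th z q = (if even q then complex_of_real (cos (th (q div 2))) * z (q div 2)
                        else \<i> * complex_of_real (sin (th (q div 2))) * z (q div 2))"

definition R_low :: "nat \<Rightarrow> nat \<Rightarrow> (nat \<Rightarrow> real) \<Rightarrow> (nat \<Rightarrow> complex) \<Rightarrow> nat \<Rightarrow> complex" where
  "R_low n k th z q =
    (let p = k - 1; w = (z (n - 1) :: complex);
         A = (\<Sum>j<p. complex_of_real (cos (2 * th j)) * (z j)^2) + (\<Sum>j\<in>{p..<n-1}. (z j)^2)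
     in if q < 2 * p then pairblock th z q
        else if q < n + k - 2 then z (q - p)
        else if q = n + k - 2 then (A - 2 * w^2 + 2 * w) / (2 * complex_of_real (sqrt 2) * (1 - w))
        else if q = n + k - 1 then (A + 2 * w^2 - 2 * w) / (2 * complex_of_real (sqrt 2) * \<i> * (1 - w))
        else 0)"

definition I_map :: "nat \<Rightarrow> nat \<Rightarrow> (nat \<Rightarrow> real) \<Rightarrow> (nat \<Rightarrow> complex) \<Rightarrow> nat \<Rightarrow> complex" where
  "I_map n k th z q =
    (let p = k - 1;
         B = (\<Sum>j<p. complex_of_real (cos (2 * th j)) * (z j)^2) + (\<Sum>j\<in>{p..<n}. (z j)^2)
     in if q < 2 * p then pairblock th z q
        else if q < n + k - 1 then z (q - p)
        else if q = n + k - 1 then 1 - csqrt (1 - B)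
        else 0)"

definition R_b :: "nat \<Rightarrow> (nat \<Rightarrow> real) \<Rightarrow> (nat \<Rightarrow> complex) \<Rightarrow> nat \<Rightarrow> complex" where
  "R_b n th z q =
    (let S = (\<Sum>j<n-1. complex_of_real (cos (2 * th j)) * (z j)^2) + (z (n - 1))^2
     in if q < 2 * (n - 1) then pairblock th z q
        else if q = 2 * n - 2 then z (n - 1)
        else if q = 2 * n - 1 then S / (2 * complex_of_real (sqrt 2))
        else if q = 2 * n then - \<i> * S / (2 * complex_of_real (sqrt 2))
        else 0)"

definition R_c :: "nat \<Rightarrow> (nat \<Rightarrow> real) \<Rightarrow> (nat \<Rightarrow> complex) \<Rightarrow> nat \<Rightarrow> complex" where
  "R_c n th z q =
    (let T = (\<Sum>j<n. complex_of_real (cos (2 * th j)) * (z j)^2)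
     in if q < 2 * n then pairblock th z q
        else if q = 2 * n then T / (2 * complex_of_real (sqrt 2))
        else if q = 2 * n + 1 then - \<i> * T / (2 * complex_of_real (sqrt 2))
        else 0)"

definition I_c :: "nat \<Rightarrow> (nat \<Rightarrow> real) \<Rightarrow> real \<Rightarrow> (nat \<Rightarrow> complex) \<Rightarrow> nat \<Rightarrow> complex" where
  "I_c n th \<theta> z q =
    (let T = (\<Sum>j<n. complex_of_real (cos (2 * th j)) * (z j)^2);
         E = 1 - csqrt (1 - complex_of_real (cos (2 * \<theta>)) * T)
     in if q < 2 * n then pairblock th z q
        else if q = 2 * n then complex_of_real (cos \<theta> / cos (2 * \<theta>)) * E
        else if q = 2 * n + 1 then \<i> * complex_of_real (sin \<theta> / cos (2 * \<theta>)) * E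
        else 0)"

end

theory Submission
  imports Defs "HOL-Complex_Analysis.Complex_Analysis"
begin

text \<open>
  Each map satisfies the polarised identity
  \<open>F(z) \<cdot> cnj F(w) - F(z)F(z)\<^sup>t cnj (F(w)F(w)\<^sup>t) / 4 = z \<cdot> cnj w\<close> on the ball; differentiating
  it in \<open>z\<close> and in \<open>w\<close> gives the isometry property.  For minimality suppose \<open>F = \<phi> \<circ> (G, 0) \<circ> \<psi>\<close>.
  Conjugating the reflection in the last coordinate by \<open>\<phi>\<close> yields an involutive automorphism of the
  type IV domain that fixes the image of \<open>F\<close> pointwise, hence fixes \<open>0\<close>, hence is linear by Cartan's
  uniqueness theorem.  Linear automorphisms permute the complex extreme points of the closed domain,
  which are the unimodular multiples of real vectors of norm \<open>\<surd>2\<close>, and so are unimodular multiples of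
  real orthogonal matrices; the trace shows that here the multiple is \<open>\<plusminus>1\<close>.  The components of \<open>F\<close> thus
  satisfy a nontrivial linear relation with real coefficients, which is ruled out by inspection.
\<close>

section \<open>Holomorphic maps in coordinates\<close>

text \<open>The obstacle is that the components of these maps are dependent over the complex
  numbers: in each pair, cos(th) z and i sin(th) z are proportional. Only real relations can be
  excluded, so the matrix A of the linear involution has to be shown real, not merely unitary. From
  A^2 = 1 and A^t A = c (no conjugation) one gets A^t = c A, so a single nonzero diagonal entry
  forces c = 1; a column whose entries have both squared moduli and squares summing to 1 is then
  real. The diagonal entry comes from the trace: A is the reflection conjugated by the derivative of
  \<phi>, so its trace is m - 2, which is nonzero because m \<ge> 3. Each row of A - 1 is then a
  real relation between the components of F, so A = 1, contradicting that the reflection is not the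
  identity. Working with the involution instead of \<phi> means that nothing has to be known about
  \<phi> except that it is biholomorphic.\<close>

lemma cnorm_nonneg [simp]: "0 \<le> cnorm n z"
  by (simp add: cnorm_def sum_nonneg)

lemma cmod_le_cnorm: "j < n \<Longrightarrow> cmod (z j) \<le> cnorm n z"
  unfolding cnorm_def by (rule real_le_rsqrt) (rule member_le_sum, auto)

lemma cnorm_le_sum: "cnorm n z \<le> (\<Sum>j<n. cmod (z j))"
  using L2_set_le_sum_abs[of "\<lambda>j. cmod (z j)" "{..<n}"]
  by (simp add: cnorm_def L2_set_def)

lemma zzbar_complex: "complex_of_real (zzbar m Z) = (\<Sum>a<m. Z a * cnj (Z a))"
  by (simp add: zzbar_def complex_norm_square del: of_real_power)

lemma zzbar_line:
  "zzbar m (\<lambda>i. Z i + of_real t * v i) = zzbar m Z + 2 * t * Re (\<Sum>a<m. v a * cnj (Z a)) + t\<^sup>2 * zzbar m v"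
  unfolding zzbar_def Re_sum sum_distrib_left sum.distrib[symmetric] cmod_power2
  by (intro sum.cong refl) (simp add: power2_eq_square algebra_simps)

lemma zzt_line:
  "zzt m (\<lambda>i. Z i + t * v i) = zzt m Z + 2 * t * (\<Sum>a<m. Z a * v a) + t\<^sup>2 * zzt m v"
  unfolding zzt_def sum_distrib_left sum.distrib[symmetric]
  by (intro sum.cong refl) (simp add: power2_eq_square algebra_simps)

lemma sum_evec [simp]:
  "j < m \<Longrightarrow> (\<Sum>a<m. f a * evec j a) = f j"
  by (simp add: evec_def if_distrib[of "\<lambda>x. _ * x"] cong: if_cong)

text \<open>Holomorphy is handled through its effect on parametrised complex curves: in this form
  the chain rule is immediate, and slices of a map are holomorphic functions of one variable.\<close>

definition curve_deriv :: "nat \<Rightarrow> nat \<Rightarrow> (nat \<Rightarrow> complex) set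
    \<Rightarrow> ((nat \<Rightarrow> complex) \<Rightarrow> (nat \<Rightarrow> complex)) \<Rightarrow> (nat \<Rightarrow> complex)
    \<Rightarrow> (nat \<Rightarrow> nat \<Rightarrow> complex) \<Rightarrow> bool" where
  "curve_deriv n m U F z A \<longleftrightarrow> (\<forall>\<gamma> t0 d. \<gamma> t0 = z \<longrightarrow>
      (\<forall>j<n. ((\<lambda>t. \<gamma> t j) has_field_derivative d j) (at t0)) \<longrightarrow>
      (\<forall>\<^sub>F t in at t0. \<gamma> t \<in> U) \<longrightarrow>
      (\<forall>a<m. ((\<lambda>t. F (\<gamma> t) a) has_field_derivative (\<Sum>j<n. A a j * d j)) (at t0)))"

definition curve_holo :: "nat \<Rightarrow> nat \<Rightarrow> (nat \<Rightarrow> complex) set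
    \<Rightarrow> ((nat \<Rightarrow> complex) \<Rightarrow> (nat \<Rightarrow> complex)) \<Rightarrow> bool" where
  "curve_holo n m U F \<longleftrightarrow> (\<forall>z\<in>U. \<exists>A. curve_deriv n m U F z A)"

lemma curve_derivD:
  assumes "curve_deriv n m U F z A" "\<gamma> t0 = z"
    "\<And>j. j < n \<Longrightarrow> ((\<lambda>t. \<gamma> t j) has_field_derivative d j) (at t0)"
    "\<forall>\<^sub>F t in at t0. \<gamma> t \<in> U" "a < m"
  shows "((\<lambda>t. F (\<gamma> t) a) has_field_derivative (\<Sum>j<n. A a j * d j)) (at t0)"
  using assms unfolding curve_deriv_def by blast

lemma curve_deriv_compose:
  assumes F: "curve_deriv n m U F z A" and G: "curve_deriv m l V G (F z) B" and FU: "F ` U \<subseteq> V"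
  shows "curve_deriv n l U (\<lambda>z. G (F z)) z (\<lambda>a j. \<Sum>b<m. B a b * A b j)"
  unfolding curve_deriv_def
proof (intro allI impI)
  fix \<gamma> :: "complex \<Rightarrow> nat \<Rightarrow> complex" and t0 d a
  assume *: "\<gamma> t0 = z" "\<forall>j<n. ((\<lambda>t. \<gamma> t j) has_field_derivative d j) (at t0)"
    "\<forall>\<^sub>F t in at t0. \<gamma> t \<in> U" "a < l"
  have "((\<lambda>t. G (F (\<gamma> t)) a) has_field_derivative (\<Sum>b<m. B a b * (\<Sum>j<n. A b j * d j))) (at t0)"
  proof (rule curve_derivD[OF G])
    show "F (\<gamma> t0) = F z" using * by simp
    show "((\<lambda>t. F (\<gamma> t) b) has_field_derivative (\<Sum>j<n. A b j * d j)) (at t0)" if "b < m" for b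
      using curve_derivD[OF F] * that by blast
    show "\<forall>\<^sub>F t in at t0. F (\<gamma> t) \<in> V"
      using *(3) by eventually_elim (use FU in blast)
  qed (use * in simp)
  moreover have "(\<Sum>b<m. B a b * (\<Sum>j<n. A b j * d j)) = (\<Sum>j<n. (\<Sum>b<m. B a b * A b j) * d j)"
    by (simp add: sum_distrib_left sum_distrib_right mult.assoc) (rule sum.swap)
  ultimately show "((\<lambda>t. G (F (\<gamma> t)) a) has_field_derivative
      (\<Sum>j<n. (\<Sum>b<m. B a b * A b j) * d j)) (at t0)"
    by simp
qed

lemma curve_holo_compose:
  assumes "curve_holo n m U F" "curve_holo m l V G" "F ` U \<subseteq> V"
  shows "curve_holo n l U (\<lambda>z. G (F z))"
  unfolding curve_holo_def
proof
  fix z assume "z \<in> U"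
  with assms obtain A B where "curve_deriv n m U F z A" "curve_deriv m l V G (F z) B"
    unfolding curve_holo_def by blast
  from curve_deriv_compose[OF this assms(3)]
  show "\<exists>A. curve_deriv n l U (\<lambda>z. G (F z)) z A" by blast
qed

lemma curve_holo_slice:
  assumes "curve_holo n m U F" "open S" "\<And>t. t \<in> S \<Longrightarrow> \<gamma> t \<in> U"
    "\<And>j. j < n \<Longrightarrow> (\<lambda>t. \<gamma> t j) holomorphic_on S" "a < m"
  shows "(\<lambda>t. F (\<gamma> t) a) holomorphic_on S"
  unfolding holomorphic_on_open[OF assms(2)]
proof
  fix t assume t: "t \<in> S"
  obtain A where A: "curve_deriv n m U F (\<gamma> t) A"
    using assms(1,3) t unfolding curve_holo_def by blast
  have "((\<lambda>t. F (\<gamma> t) a) has_field_derivative (\<Sum>j<n. A a j * deriv (\<lambda>t. \<gamma> t j) t)) (at t)"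
  proof (rule curve_derivD[OF A])
    show "((\<lambda>t. \<gamma> t j) has_field_derivative deriv (\<lambda>t. \<gamma> t j) t) (at t)" if "j < n" for j
      using holomorphic_derivI[OF assms(4)[OF that] assms(2) t] .
    show "\<forall>\<^sub>F t in at t. \<gamma> t \<in> U"
      using eventually_at_in_open'[OF assms(2) t] by eventually_elim (use assms(3) in blast)
  qed (use assms in simp_all)
  then show "\<exists>f'. ((\<lambda>t. F (\<gamma> t) a) has_field_derivative f') (at t)"
    by blast
qed

section \<open>Difference quotients: derivatives along curves and closure rules\<close>

definition frechet_deriv :: "nat \<Rightarrow> nat \<Rightarrow> (nat \<Rightarrow> complex) set
    \<Rightarrow> ((nat \<Rightarrow> complex) \<Rightarrow> (nat \<Rightarrow> complex)) \<Rightarrow> (nat \<Rightarrow> complex)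
    \<Rightarrow> (nat \<Rightarrow> nat \<Rightarrow> complex) \<Rightarrow> bool" where
  "frechet_deriv n m U F z A \<longleftrightarrow> (\<forall>\<epsilon>>0. \<exists>\<delta>>0. \<forall>w\<in>U.
        cnorm n (\<lambda>j. w j - z j) < \<delta> \<longrightarrow>
        cnorm m (\<lambda>a. F w a - F z a - (\<Sum>j<n. A a j * (w j - z j)))
          \<le> \<epsilon> * cnorm n (\<lambda>j. w j - z j))"

lemma holo_map_frechet:
  "holo_map n m U V F \<longleftrightarrow> F ` U \<subseteq> V \<and> (\<forall>z\<in>U. \<exists>A. frechet_deriv n m U F z A)"
  unfolding holo_map_def frechet_deriv_def ..

text \<open>A differentiable curve moves by O(t - t0), so a remainder that is small against the
  displacement is small against t - t0; after division by t - t0 only the linear part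
  survives.\<close>

lemma curve_deriv_if_frechet_deriv:
  assumes F: "frechet_deriv n m U F z A"
  shows "curve_deriv n m U F z A"
  unfolding curve_deriv_def
proof (intro allI impI)
  fix \<gamma> :: "complex \<Rightarrow> nat \<Rightarrow> complex" and t0 d a
  assume g0: "\<gamma> t0 = z" and d: "\<forall>j<n. ((\<lambda>t. \<gamma> t j) has_field_derivative d j) (at t0)"
    and U: "\<forall>\<^sub>F t in at t0. \<gamma> t \<in> U" and a: "a < m"
  define N where "N t = cnorm n (\<lambda>j. \<gamma> t j - z j)" for t
  define E where "E t = F (\<gamma> t) a - F z a - (\<Sum>j<n. A a j * (\<gamma> t j - z j))" for t
  have quot: "((\<lambda>t. (\<gamma> t j - z j) / (t - t0)) \<longlongrightarrow> d j) (at t0)" if "j < n" for j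
    using d that g0 by (auto simp: has_field_derivative_iff)
  have g: "((\<lambda>t. \<gamma> t j) \<longlongrightarrow> z j) (at t0)" if "j < n" for j
    using d that g0 DERIV_isCont isCont_def by metis
  have "((\<lambda>t. \<Sum>j<n. cmod (\<gamma> t j - z j)) \<longlongrightarrow> (\<Sum>j<n. cmod (z j - z j))) (at t0)"
    by (intro tendsto_intros g) simp
  then have sum0: "((\<lambda>t. \<Sum>j<n. cmod (\<gamma> t j - z j)) \<longlongrightarrow> 0) (at t0)"
    by simp
  have N0: "(N \<longlongrightarrow> 0) (at t0)"
    by (rule tendsto_sandwich[OF _ _ tendsto_const sum0]) (auto simp: N_def cnorm_le_sum)
  \<comment> \<open>The limit of the summed difference quotients plus 1: eventually a strict upper
    bound for them, and positive even if every \<open>d j\<close> is 0.\<close>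
  define K where "K = (\<Sum>j<n. cmod (d j)) + 1"
  have "((\<lambda>t. \<Sum>j<n. cmod ((\<gamma> t j - z j) / (t - t0))) \<longlongrightarrow> (\<Sum>j<n. cmod (d j))) (at t0)"
    by (intro tendsto_intros quot) simp
  then have "\<forall>\<^sub>F t in at t0. (\<Sum>j<n. cmod ((\<gamma> t j - z j) / (t - t0))) < K"
    by (rule order_tendstoD) (simp add: K_def)
  moreover have "\<forall>\<^sub>F t in at t0. t \<noteq> t0"
    by (simp add: eventually_at_filter)
  ultimately have NK: "\<forall>\<^sub>F t in at t0. N t \<le> K * cmod (t - t0)"
  proof eventually_elim
    case (elim t)
    have "N t \<le> (\<Sum>j<n. cmod (\<gamma> t j - z j))"
      by (simp add: N_def cnorm_le_sum)
    also have "\<dots> = (\<Sum>j<n. cmod ((\<gamma> t j - z j) / (t - t0))) * cmod (t - t0)"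
      using elim(2) by (simp add: sum_distrib_right norm_divide)
    also have "\<dots> \<le> K * cmod (t - t0)"
      using elim(1) by (intro mult_right_mono) auto
    finally show ?case .
  qed
  have K: "K > 0"
    by (simp add: K_def add_nonneg_pos sum_nonneg)
  have E0: "((\<lambda>t. E t / (t - t0)) \<longlongrightarrow> 0) (at t0)"
  proof (rule tendstoI)
    fix e :: real assume e: "e > 0"
    \<comment> \<open>Half of \<open>e\<close> is given away so that the final estimate is
      strict.\<close>
    define \<epsilon> where "\<epsilon> = e / (2 * K)"
    have \<epsilon>: "\<epsilon> > 0" using e K by (simp add: \<epsilon>_def)
    obtain \<delta> where \<delta>: "\<delta> > 0" "\<And>w. w \<in> U \<Longrightarrow> cnorm n (\<lambda>j. w j - z j) < \<delta> \<Longrightarrow>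
        cnorm m (\<lambda>a. F w a - F z a - (\<Sum>j<n. A a j * (w j - z j))) \<le> \<epsilon> * cnorm n (\<lambda>j. w j - z j)"
      using F \<epsilon> unfolding frechet_deriv_def by blast
    have "\<forall>\<^sub>F t in at t0. N t < \<delta>"
      using order_tendstoD(2)[OF N0 \<delta>(1)] .
    then show "\<forall>\<^sub>F t in at t0. dist (E t / (t - t0)) 0 < e"
      using U NK \<open>\<forall>\<^sub>F t in at t0. t \<noteq> t0\<close>
    proof eventually_elim
      case (elim t)
      have "cmod (E t) \<le> cnorm m (\<lambda>a. F (\<gamma> t) a - F z a - (\<Sum>j<n. A a j * (\<gamma> t j - z j)))"
        unfolding E_def using cmod_le_cnorm[OF a] by fast
      also have "\<dots> \<le> \<epsilon> * N t"
        using \<delta>(2) elim by (simp add: N_def)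
      also have "\<dots> \<le> \<epsilon> * (K * cmod (t - t0))"
        using elim \<epsilon> by simp
      also have "\<dots> = e / 2 * cmod (t - t0)"
        using K by (simp add: \<epsilon>_def)
      also have "\<dots> < e * cmod (t - t0)"
        using e elim by simp
      finally show ?case
        using elim by (simp add: norm_divide field_simps)
    qed
  qed
  have "((\<lambda>t. E t / (t - t0) + (\<Sum>j<n. A a j * ((\<gamma> t j - z j) / (t - t0))))
      \<longlongrightarrow> 0 + (\<Sum>j<n. A a j * d j)) (at t0)"
    by (intro tendsto_intros E0 quot) simp
  moreover have "E t / (t - t0) + (\<Sum>j<n. A a j * ((\<gamma> t j - z j) / (t - t0)))
      = (F (\<gamma> t) a - F (\<gamma> t0) a) / (t - t0)" for t
    by (simp add: E_def g0 diff_divide_distrib sum_divide_distrib right_diff_distrib)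
  ultimately show "((\<lambda>t. F (\<gamma> t) a) has_field_derivative (\<Sum>j<n. A a j * d j)) (at t0)"
    by (simp add: has_field_derivative_iff)
qed

lemma curve_holo_if_holo_map: "holo_map n m U V F \<Longrightarrow> curve_holo n m U F"
  unfolding holo_map_frechet curve_holo_def using curve_deriv_if_frechet_deriv by blast

text \<open>The component version of \<open>frechet_deriv\<close>: closure rules are proved for
  scalar functions, and the components are assembled afterwards.\<close>

definition scalar_deriv :: "nat \<Rightarrow> (nat \<Rightarrow> complex) set \<Rightarrow> ((nat \<Rightarrow> complex) \<Rightarrow> complex)
    \<Rightarrow> (nat \<Rightarrow> complex) \<Rightarrow> (nat \<Rightarrow> complex) \<Rightarrow> bool" where
  "scalar_deriv n U f z A \<longleftrightarrow> (\<forall>\<epsilon>>0. \<exists>\<delta>>0. \<forall>w\<in>U. cnorm n (\<lambda>j. w j - z j) < \<delta> \<longrightarrow>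
      cmod (f w - f z - (\<Sum>j<n. A j * (w j - z j))) \<le> \<epsilon> * cnorm n (\<lambda>j. w j - z j))"

definition scalar_diff :: "nat \<Rightarrow> (nat \<Rightarrow> complex) set \<Rightarrow> ((nat \<Rightarrow> complex) \<Rightarrow> complex)
    \<Rightarrow> (nat \<Rightarrow> complex) \<Rightarrow> bool" where
  "scalar_diff n U f z \<longleftrightarrow> (\<exists>A. scalar_deriv n U f z A)"

lemma scalar_derivD:
  assumes "scalar_deriv n U f z A" "\<epsilon> > 0"
  obtains \<delta> where "\<delta> > 0" "\<And>w. w \<in> U \<Longrightarrow> cnorm n (\<lambda>j. w j - z j) < \<delta> \<Longrightarrow>
      cmod (f w - f z - (\<Sum>j<n. A j * (w j - z j))) \<le> \<epsilon> * cnorm n (\<lambda>j. w j - z j)"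
  using assms unfolding scalar_deriv_def by blast

lemma frechet_deriv_if_scalar_deriv:
  assumes "\<And>a. a < m \<Longrightarrow> scalar_deriv n U (\<lambda>z. F z a) z (A a)"
  shows "frechet_deriv n m U F z A"
  unfolding frechet_deriv_def
proof (intro allI impI)
  fix \<epsilon> :: real assume \<epsilon>: "\<epsilon> > 0"
  \<comment> \<open>Dividing by m + 1 rather than m covers m = 0; the 1 inserted into the minimum
    \<open>D\<close> serves the same case.\<close>
  define e where "e = \<epsilon> / (real m + 1)"
  have e: "e > 0" using \<epsilon> by (simp add: e_def)
  define P where "P a \<delta> \<longleftrightarrow> \<delta> > 0 \<and> (\<forall>w\<in>U. cnorm n (\<lambda>j. w j - z j) < \<delta> \<longrightarrow>
      cmod (F w a - F z a - (\<Sum>j<n. A a j * (w j - z j))) \<le> e * cnorm n (\<lambda>j. w j - z j))" for a \<delta>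
  have "\<forall>a\<in>{..<m}. \<exists>\<delta>. P a \<delta>"
    using assms e unfolding scalar_deriv_def P_def by simp
  then obtain \<delta> where "\<forall>a\<in>{..<m}. P a (\<delta> a)"
    using bchoice by blast
  then have \<delta>: "\<And>a. a < m \<Longrightarrow> \<delta> a > 0" "\<And>a w. a < m \<Longrightarrow> w \<in> U \<Longrightarrow> cnorm n (\<lambda>j. w j - z j) < \<delta> a \<Longrightarrow>
      cmod (F w a - F z a - (\<Sum>j<n. A a j * (w j - z j))) \<le> e * cnorm n (\<lambda>j. w j - z j)"
    unfolding P_def by blast+
  define D where "D = Min (insert 1 (\<delta> ` {..<m}))"
  have D: "D > 0" "\<And>a. a < m \<Longrightarrow> D \<le> \<delta> a"
    using \<delta>(1) by (auto simp: D_def)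
  show "\<exists>\<delta>>0. \<forall>w\<in>U. cnorm n (\<lambda>j. w j - z j) < \<delta> \<longrightarrow>
        cnorm m (\<lambda>a. F w a - F z a - (\<Sum>j<n. A a j * (w j - z j)))
          \<le> \<epsilon> * cnorm n (\<lambda>j. w j - z j)"
  proof (intro exI[of _ D] conjI D ballI impI)
    fix w assume w: "w \<in> U" "cnorm n (\<lambda>j. w j - z j) < D"
    have "cnorm m (\<lambda>a. F w a - F z a - (\<Sum>j<n. A a j * (w j - z j)))
        \<le> (\<Sum>a<m. cmod (F w a - F z a - (\<Sum>j<n. A a j * (w j - z j))))"
      by (rule cnorm_le_sum)
    also have "\<dots> \<le> (\<Sum>a<m. e * cnorm n (\<lambda>j. w j - z j))"
      using \<delta>(2) w D(2) by (intro sum_mono) fastforce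
    also have "\<dots> = real m * e * cnorm n (\<lambda>j. w j - z j)"
      by simp
    also have "\<dots> \<le> \<epsilon> * cnorm n (\<lambda>j. w j - z j)"
      using \<epsilon> by (intro mult_right_mono) (auto simp: e_def field_simps)
    finally show "cnorm m (\<lambda>a. F w a - F z a - (\<Sum>j<n. A a j * (w j - z j)))
          \<le> \<epsilon> * cnorm n (\<lambda>j. w j - z j)" .
  qed
qed

lemma frechet_deriv_exists:
  assumes "\<And>a. a < m \<Longrightarrow> scalar_diff n U (\<lambda>z. F z a) z"
  shows "\<exists>A. frechet_deriv n m U F z A"
proof -
  obtain A where "\<And>a. a < m \<Longrightarrow> scalar_deriv n U (\<lambda>z. F z a) z (A a)"
    using assms unfolding scalar_diff_def by metis
  then show ?thesis
    using frechet_deriv_if_scalar_deriv by blast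
qed

lemma scalar_diff_const: "scalar_diff n U (\<lambda>z. c) z"
  unfolding scalar_diff_def scalar_deriv_def
  by (rule exI[of _ "\<lambda>_. 0"]) (auto intro!: exI[of _ 1])

lemma scalar_diff_coord: "i < n \<Longrightarrow> scalar_diff n U (\<lambda>z. z i) z"
  unfolding scalar_diff_def scalar_deriv_def
  by (rule exI[of _ "\<lambda>j. if j = i then 1 else 0"])
    (auto intro!: exI[of _ 1] simp: if_distrib[of "\<lambda>x. x * _"] cong: if_cong)

lemma scalar_diff_add:
  assumes "scalar_diff n U f z" "scalar_diff n U g z"
  shows "scalar_diff n U (\<lambda>z. f z + g z) z"
proof -
  obtain A B where A: "scalar_deriv n U f z A" and B: "scalar_deriv n U g z B"
    using assms unfolding scalar_diff_def by blast
  have "scalar_deriv n U (\<lambda>z. f z + g z) z (\<lambda>j. A j + B j)"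
    unfolding scalar_deriv_def
  proof (intro allI impI)
    fix \<epsilon> :: real assume "\<epsilon> > 0"
    then have e: "\<epsilon> / 2 > 0" by simp
    obtain \<delta> where \<delta>: "\<delta> > 0" "\<And>w. w \<in> U \<Longrightarrow> cnorm n (\<lambda>j. w j - z j) < \<delta> \<Longrightarrow>
      cmod (f w - f z - (\<Sum>j<n. A j * (w j - z j))) \<le> \<epsilon> / 2 * cnorm n (\<lambda>j. w j - z j)"
      using scalar_derivD[OF A e] by blast
    obtain \<delta>' where \<delta>': "\<delta>' > 0" "\<And>w. w \<in> U \<Longrightarrow> cnorm n (\<lambda>j. w j - z j) < \<delta>' \<Longrightarrow>
      cmod (g w - g z - (\<Sum>j<n. B j * (w j - z j))) \<le> \<epsilon> / 2 * cnorm n (\<lambda>j. w j - z j)"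
      using scalar_derivD[OF B e] by blast
    show "\<exists>\<delta>>0. \<forall>w\<in>U. cnorm n (\<lambda>j. w j - z j) < \<delta> \<longrightarrow>
      cmod (f w + g w - (f z + g z) - (\<Sum>j<n. (A j + B j) * (w j - z j)))
        \<le> \<epsilon> * cnorm n (\<lambda>j. w j - z j)"
    proof (intro exI[of _ "min \<delta> \<delta>'"] conjI ballI impI)
      fix w assume w: "w \<in> U" "cnorm n (\<lambda>j. w j - z j) < min \<delta> \<delta>'"
      have "f w + g w - (f z + g z) - (\<Sum>j<n. (A j + B j) * (w j - z j))
         = (f w - f z - (\<Sum>j<n. A j * (w j - z j))) + (g w - g z - (\<Sum>j<n. B j * (w j - z j)))"
        by (simp add: distrib_right sum.distrib)
      then have "cmod (f w + g w - (f z + g z) - (\<Sum>j<n. (A j + B j) * (w j - z j)))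
         \<le> cmod (f w - f z - (\<Sum>j<n. A j * (w j - z j))) + cmod (g w - g z - (\<Sum>j<n. B j * (w j - z j)))"
        by (simp only: norm_triangle_ineq)
      also have "\<dots> \<le> \<epsilon> / 2 * cnorm n (\<lambda>j. w j - z j) + \<epsilon> / 2 * cnorm n (\<lambda>j. w j - z j)"
        using \<delta>(2) \<delta>'(2) w by (intro add_mono) auto
      finally show "cmod (f w + g w - (f z + g z) - (\<Sum>j<n. (A j + B j) * (w j - z j)))
        \<le> \<epsilon> * cnorm n (\<lambda>j. w j - z j)" by simp
    qed (use \<delta> \<delta>' in simp)
  qed
  then show ?thesis unfolding scalar_diff_def by blast
qed

text \<open>The source of the nonlinear rules: squares, reciprocals and \<open>csqrt\<close> are all
  one-variable outer functions. The error splits into the remainder of h and h' times the remainder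
  of f, each allotted half of \<epsilon>.\<close>

lemma scalar_diff_compose:
  assumes "scalar_diff n U f z" and h: "(h has_field_derivative h') (at (f z))"
  shows "scalar_diff n U (\<lambda>z. h (f z)) z"
proof -
  obtain A where A: "scalar_deriv n U f z A"
    using assms unfolding scalar_diff_def by blast
  \<comment> \<open>A Lipschitz constant of f at z: K - 1 bounds the linear part, and the extra 1
    absorbs the remainder because \<open>e2\<close> is at most 1.\<close>
  define K where "K = (\<Sum>j<n. cmod (A j)) + 1"
  have K: "K \<ge> 1" by (simp add: K_def sum_nonneg)
  have lin: "cmod (\<Sum>j<n. A j * (w j - z j)) \<le> (K - 1) * cnorm n (\<lambda>j. w j - z j)" for w
  proof -
    have "cmod (\<Sum>j<n. A j * (w j - z j)) \<le> (\<Sum>j<n. cmod (A j) * cmod (w j - z j))"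
      by (rule order_trans[OF norm_sum]) (simp add: norm_mult)
    also have "\<dots> \<le> (\<Sum>j<n. cmod (A j) * cnorm n (\<lambda>j. w j - z j))"
      using cmod_le_cnorm[of _ n "\<lambda>j. w j - z j"] by (intro sum_mono mult_left_mono) auto
    finally show ?thesis by (simp add: K_def sum_distrib_right)
  qed
  have "scalar_deriv n U (\<lambda>z. h (f z)) z (\<lambda>j. h' * A j)"
    unfolding scalar_deriv_def
  proof (intro allI impI)
    fix \<epsilon> :: real assume \<epsilon>: "\<epsilon> > 0"
    define e where "e = \<epsilon> / (2 * K)"
    have e: "e > 0" using \<epsilon> K by (simp add: e_def)
    obtain \<eta> where \<eta>: "\<eta> > 0" "\<And>y. cmod (y - f z) < \<eta> \<Longrightarrow>
        cmod (h y - h (f z) - h' * (y - f z)) \<le> e * cmod (y - f z)"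
      using h e unfolding has_field_derivative_def has_derivative_at_alt by blast
    define e2 where "e2 = min 1 (\<epsilon> / (2 * (cmod h' + 1)))"
    have e2: "e2 > 0" "e2 \<le> 1" using \<epsilon> by (auto simp: e2_def add_nonneg_pos)
    have "cmod h' * e2 \<le> cmod h' * (\<epsilon> / (2 * (cmod h' + 1)))"
      by (intro mult_left_mono) (auto simp: e2_def)
    also have "\<dots> \<le> \<epsilon> / 2"
      using \<epsilon> by (simp add: field_simps add_pos_nonneg)
    finally have he2: "cmod h' * e2 \<le> \<epsilon> / 2" .
    obtain \<delta> where \<delta>: "\<delta> > 0" "\<And>w. w \<in> U \<Longrightarrow> cnorm n (\<lambda>j. w j - z j) < \<delta> \<Longrightarrow>
      cmod (f w - f z - (\<Sum>j<n. A j * (w j - z j))) \<le> e2 * cnorm n (\<lambda>j. w j - z j)"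
      using scalar_derivD[OF A e2(1)] by blast
    show "\<exists>\<delta>>0. \<forall>w\<in>U. cnorm n (\<lambda>j. w j - z j) < \<delta> \<longrightarrow>
      cmod (h (f w) - h (f z) - (\<Sum>j<n. h' * A j * (w j - z j))) \<le> \<epsilon> * cnorm n (\<lambda>j. w j - z j)"
    proof (intro exI[of _ "min \<delta> (\<eta> / K)"] conjI ballI impI)
      fix w assume w: "w \<in> U" "cnorm n (\<lambda>j. w j - z j) < min \<delta> (\<eta> / K)"
      define r where "r = cnorm n (\<lambda>j. w j - z j)"
      define L where "L = (\<Sum>j<n. A j * (w j - z j))"
      have r: "0 \<le> r" by (simp add: r_def)
      have fL: "cmod (f w - f z - L) \<le> e2 * r"
        using \<delta>(2) w by (simp add: r_def L_def)
      have "cmod (f w - f z) \<le> cmod (f w - f z - L) + cmod L"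
        using norm_triangle_sub[of "f w - f z" L] by simp
      also have "\<dots> \<le> 1 * r + (K - 1) * r"
        using fL lin[of w] mult_right_mono[OF e2(2) r] by (auto simp: L_def r_def)
      finally have fK: "cmod (f w - f z) \<le> K * r" by (simp add: algebra_simps)
      also have "\<dots> < \<eta>"
        using w K by (simp add: r_def field_simps)
      finally have "cmod (h (f w) - h (f z) - h' * (f w - f z)) \<le> e * cmod (f w - f z)"
        by (rule \<eta>(2))
      also have "\<dots> \<le> e * (K * r)"
        using fK e by simp
      finally have 1: "cmod (h (f w) - h (f z) - h' * (f w - f z)) \<le> \<epsilon> / 2 * r"
        using K by (simp add: e_def)
      have "cmod (h' * (f w - f z - L)) \<le> cmod h' * (e2 * r)"
        unfolding norm_mult by (intro mult_left_mono fL) simp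
      also have "\<dots> \<le> \<epsilon> / 2 * r"
        using mult_right_mono[OF he2 r] by (simp add: mult.assoc)
      finally have 2: "cmod (h' * (f w - f z - L)) \<le> \<epsilon> / 2 * r" .
      have "h (f w) - h (f z) - (\<Sum>j<n. h' * A j * (w j - z j))
        = (h (f w) - h (f z) - h' * (f w - f z)) + h' * (f w - f z - L)"
        by (simp add: L_def sum_distrib_left algebra_simps)
      then have "cmod (h (f w) - h (f z) - (\<Sum>j<n. h' * A j * (w j - z j))) \<le> \<epsilon> / 2 * r + \<epsilon> / 2 * r"
        using 1 2 norm_triangle_le by (metis add_mono)
      then show "cmod (h (f w) - h (f z) - (\<Sum>j<n. h' * A j * (w j - z j)))
          \<le> \<epsilon> * cnorm n (\<lambda>j. w j - z j)"
        by (simp add: r_def)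
    qed (use \<delta> \<eta> K in auto)
  qed
  then show ?thesis unfolding scalar_diff_def by blast
qed

lemma scalar_diff_cmult: "scalar_diff n U f z \<Longrightarrow> scalar_diff n U (\<lambda>z. c * f z) z"
  by (rule scalar_diff_compose[where h = "\<lambda>x. c * x" and h' = c])
    (auto intro!: derivative_eq_intros)

lemma scalar_diff_power2: "scalar_diff n U f z \<Longrightarrow> scalar_diff n U (\<lambda>z. (f z)\<^sup>2) z"
  by (rule scalar_diff_compose[where h = "\<lambda>x. x\<^sup>2" and h' = "2 * f z"])
    (auto intro!: derivative_eq_intros)

lemma scalar_diff_minus:
  "scalar_diff n U f z \<Longrightarrow> scalar_diff n U g z \<Longrightarrow> scalar_diff n U (\<lambda>z. f z - g z) z"
  using scalar_diff_add[of n U f z "\<lambda>z. (-1) * g z"] scalar_diff_cmult[of n U g z "-1"] by simp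

text \<open>Polarisation, 4 f g = (f + g)^2 - (f - g)^2, reduces products to squares.\<close>

lemma scalar_diff_mult:
  assumes "scalar_diff n U f z" "scalar_diff n U g z"
  shows "scalar_diff n U (\<lambda>z. f z * g z) z"
proof -
  have "scalar_diff n U (\<lambda>z. (1/4) * ((f z + g z)\<^sup>2 - (f z - g z)\<^sup>2)) z"
    by (intro scalar_diff_cmult scalar_diff_minus scalar_diff_power2 scalar_diff_add assms)
  then show ?thesis
    by (simp add: power2_eq_square algebra_simps)
qed

lemma scalar_diff_sum:
  "(\<And>i. i \<in> I \<Longrightarrow> scalar_diff n U (f i) z) \<Longrightarrow> scalar_diff n U (\<lambda>z. \<Sum>i\<in>I. f i z) z"
  by (induction I rule: infinite_finite_induct) (auto intro: scalar_diff_const scalar_diff_add)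

section \<open>The Bergman metrics\<close>

text \<open>The parameter is \<open>c = 0\<close> for the ball and \<open>c = 1\<close> for the type IV domain.\<close>

definition gen_norm :: "real \<Rightarrow> nat \<Rightarrow> (nat \<Rightarrow> complex) \<Rightarrow> real" where
  "gen_norm c m Z = 1 - zzbar m Z + c * (cmod (zzt m Z))\<^sup>2 / 4"

text \<open>The holomorphic partial derivative of \<open>gen_norm\<close> in the coordinate
  a.\<close>

definition gen_grad :: "real \<Rightarrow> nat \<Rightarrow> (nat \<Rightarrow> complex) \<Rightarrow> nat \<Rightarrow> complex" where
  "gen_grad c m Z a = - cnj (Z a) + of_real c / 2 * Z a * cnj (zzt m Z)"

text \<open>The second derivative of \<open>gen_norm\<close> in the real directions u and v. Its
  terms come from the norm, from the second-order part of \<open>zzt\<close>, and from the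
  first-order parts of \<open>zzt\<close> and its conjugate.\<close>

definition gen_hess :: "real \<Rightarrow> nat \<Rightarrow> (nat \<Rightarrow> complex) \<Rightarrow> (nat \<Rightarrow> complex) \<Rightarrow> (nat \<Rightarrow> complex) \<Rightarrow> real" where
  "gen_hess c m Z u v = - 2 * Re (\<Sum>a<m. v a * cnj (u a)) + c * Re ((\<Sum>a<m. u a * v a) * cnj (zzt m Z))
     + 2 * c * Re ((\<Sum>a<m. Z a * v a) * cnj (\<Sum>a<m. Z a * u a))"

text \<open>Split into real and imaginary parts, the restriction to a real line is a real polynomial
  in t, which the derivative rules can handle.\<close>

lemma gen_norm_has_derivative:
  "((\<lambda>t. gen_norm c m (\<lambda>i. Z i + of_real t * v i)) has_real_derivative
     2 * Re (\<Sum>a<m. gen_grad c m Z a * v a)) (at 0)"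
proof -
  define q p r B where "q = zzt m Z" and "p = (\<Sum>a<m. Z a * v a)" and "r = zzt m v"
    and "B = Re (\<Sum>a<m. v a * cnj (Z a))"
  have eq: "gen_norm c m (\<lambda>i. Z i + of_real t * v i) = 1 - (zzbar m Z + 2 * t * B + t\<^sup>2 * zzbar m v)
      + c * ((Re q + 2 * t * Re p + t\<^sup>2 * Re r)\<^sup>2 + (Im q + 2 * t * Im p + t\<^sup>2 * Im r)\<^sup>2) / 4" for t
    unfolding gen_norm_def zzbar_line zzt_line cmod_power2
    by (simp add: q_def p_def r_def B_def)
  have S: "(\<Sum>a<m. gen_grad c m Z a * v a) = - (\<Sum>a<m. v a * cnj (Z a)) + of_real c / 2 * p * cnj q"
    by (simp add: gen_grad_def p_def q_def algebra_simps sum.distrib sum_subtractf sum_distrib_left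
        flip: sum_divide_distrib)
  have "2 * Re (\<Sum>a<m. gen_grad c m Z a * v a) = - 2 * B + c * (Re p * Re q + Im p * Im q)"
    unfolding B_def S by (simp add: algebra_simps del: Re_sum)
  then show ?thesis
    unfolding eq by (auto intro!: derivative_eq_intros)
qed

lemma gen_grad_has_derivative:
  "((\<lambda>s. 2 * Re (\<Sum>a<m. gen_grad c m (\<lambda>i. Z i + of_real s * u i) a * v a)) has_real_derivative
     gen_hess c m Z u v) (at 0)"
proof -
  define q p p' r where "q = zzt m Z" and "p = (\<Sum>a<m. Z a * v a)" and "p' = (\<Sum>a<m. Z a * u a)"
    and "r = zzt m u"
  define w B where "w = (\<Sum>a<m. u a * v a)" and "B = Re (\<Sum>a<m. v a * cnj (Z a))"
  define B' where "B' = Re (\<Sum>a<m. v a * cnj (u a))"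
  have eq: "2 * Re (\<Sum>a<m. gen_grad c m (\<lambda>i. Z i + of_real s * u i) a * v a) =
      - 2 * (B + s * B') + c * ((Re p + s * Re w) * (Re q + 2 * s * Re p' + s\<^sup>2 * Re r)
        + (Im p + s * Im w) * (Im q + 2 * s * Im p' + s\<^sup>2 * Im r))" for s
  proof -
    have "(\<Sum>a<m. gen_grad c m (\<lambda>i. Z i + of_real s * u i) a * v a)
        = - (\<Sum>a<m. v a * cnj (Z a)) - of_real s * (\<Sum>a<m. v a * cnj (u a))
          + of_real c / 2 * (p + of_real s * w) * cnj (q + 2 * of_real s * p' + (of_real s)\<^sup>2 * r)"
    proof -
      have "(\<Sum>a<m. (- cnj (Z a + of_real s * u a) + of_real c / 2 * (Z a + of_real s * u a) * Q) * v a)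
        = - (\<Sum>a<m. v a * cnj (Z a)) - of_real s * (\<Sum>a<m. v a * cnj (u a))
          + of_real c / 2 * (p + of_real s * w) * Q" for Q
        by (simp add: p_def w_def algebra_simps sum.distrib sum_subtractf
          sum_distrib_left sum_negf flip: sum_divide_distrib)
      from this[of "cnj (q + 2 * of_real s * p' + (of_real s)\<^sup>2 * r)"] show ?thesis
        unfolding gen_grad_def zzt_line by (simp add: q_def p'_def r_def)
    qed
    then show ?thesis
      by (simp only: B_def B'_def) (simp add: algebra_simps add_divide_distrib power2_eq_square del: Re_sum)
  qed
  have H: "gen_hess c m Z u v
      = - 2 * B' + c * (Re w * Re q + Im w * Im q) + 2 * c * (Re p * Re p' + Im p * Im p')"
    unfolding gen_hess_def B'_def w_def q_def p_def p'_def by (simp del: Re_sum Im_sum cnj_sum)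
  show ?thesis
    unfolding eq H by (auto intro!: derivative_eq_intros simp: algebra_simps)
qed

text \<open>The formula (ln N)'' = N''/N - N'N'/N^2 in two directions. The inner derivative has its
  closed form only where \<open>gen_norm\<close> is positive, hence the passage through a
  neighbourhood of s = 0.\<close>

lemma dd_ln_gen_norm:
  assumes pos: "gen_norm c m z > 0"
  shows "dd (\<lambda>W. ln (gen_norm c m W powr (- p))) z u v =
    - p * (gen_hess c m z u v / gen_norm c m z
      - (2 * Re (\<Sum>a<m. gen_grad c m z a * v a)) * (2 * Re (\<Sum>a<m. gen_grad c m z a * u a))
          / (gen_norm c m z)\<^sup>2)"
proof -
  define Zs where "Zs s = (\<lambda>i. z i + of_real s * u i)" for s :: real
  have Zs0: "Zs 0 = z" by (simp add: Zs_def)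
  have N: "((\<lambda>s. gen_norm c m (Zs s)) has_real_derivative 2 * Re (\<Sum>a<m. gen_grad c m z a * u a)) (at 0)"
    unfolding Zs_def by (rule gen_norm_has_derivative)
  have G: "((\<lambda>s. 2 * Re (\<Sum>a<m. gen_grad c m (Zs s) a * v a)) has_real_derivative
     gen_hess c m z u v) (at 0)"
    unfolding Zs_def by (rule gen_grad_has_derivative)
  have "\<forall>\<^sub>F s in nhds 0. gen_norm c m (Zs s) > 0"
    using order_tendstoD(1)[OF DERIV_isCont[OF N, unfolded continuous_at], of 0] pos
    by (simp add: eventually_nhds_conv_at Zs0)
  then have ev: "\<forall>\<^sub>F s in nhds 0. deriv (\<lambda>t. ln (gen_norm c m (\<lambda>i. z i + of_real s * u i + of_real t * v i) powr (- p))) 0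
      = - p * (2 * Re (\<Sum>a<m. gen_grad c m (Zs s) a * v a) / gen_norm c m (Zs s))"
  proof eventually_elim
    case (elim s)
    have "((\<lambda>t. - p * ln (gen_norm c m (\<lambda>i. Zs s i + of_real t * v i))) has_real_derivative
        - p * (2 * Re (\<Sum>a<m. gen_grad c m (Zs s) a * v a) / gen_norm c m (Zs s))) (at 0)"
      using elim
      by (auto intro!: derivative_eq_intros gen_norm_has_derivative simp: field_simps)
    then show ?case
      by (intro DERIV_imp_deriv) (simp add: Zs_def ln_powr)
  qed
  have "((\<lambda>s. - p * (2 * Re (\<Sum>a<m. gen_grad c m (Zs s) a * v a) / gen_norm c m (Zs s)))
      has_real_derivative - p * (gen_hess c m z u v / gen_norm c m z
      - (2 * Re (\<Sum>a<m. gen_grad c m z a * v a)) * (2 * Re (\<Sum>a<m. gen_grad c m z a * u a))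
          / (gen_norm c m z)\<^sup>2)) (at 0)"
    using DERIV_cmult[OF DERIV_divide[OF G N], of "- p"] pos
    by (simp add: Zs0 power2_eq_square diff_divide_distrib)
  then show ?thesis
    unfolding dd_def deriv_cong_ev[OF ev refl] by (rule DERIV_imp_deriv)
qed

lemma sum_ii_evec [simp]:
  "j < m \<Longrightarrow> (\<Sum>a<m. f a * (\<i> * evec j a)) = f j * \<i>"
  using sum_evec[of j m "\<lambda>a. f a * \<i>"] by (simp add: mult.assoc)

text \<open>The Hessian terms with \<open>zzt m z\<close> cancel in the Wirtinger combination: they
  change sign when both directions are multiplied by i, and they agree in the two mixed Hessians.
  What remains is the mixed complex Hessian.\<close>

lemma wirt_ln_gen_norm:
  assumes pos: "gen_norm c m z > 0" and j: "j < m" and l: "l < m"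
  shows "wirt (\<lambda>W. ln (gen_norm c m W powr (- p))) z j l =
    - of_real p * ((- (if j = l then 1 else 0) + of_real c * z j * cnj (z l)) / of_real (gen_norm c m z)
      - gen_grad c m z j * cnj (gen_grad c m z l) / (of_real (gen_norm c m z))\<^sup>2)"
proof -
  define x y q where "x = gen_grad c m z j" and "y = gen_grad c m z l" and "q = zzt m z"
  define N where "N = gen_norm c m z"
  define \<kappa> :: real where "\<kappa> = (if j = l then 1 else 0)"
  define X where "X = z l * cnj (z j)"
  have N: "N \<noteq> 0" using pos by (simp add: N_def)
  have s1: "(\<Sum>a<m. evec l a * cnj (evec j a)) = of_real \<kappa>"
    and s2: "(\<Sum>a<m. evec j a * evec l a) = of_real \<kappa>"
    using j l by (auto simp: evec_def \<kappa>_def if_distrib[of "\<lambda>x. _ * x"] if_distrib[of "\<lambda>x. x * _"]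
        if_distrib[of cnj] cong: if_cong)
  have i1: "(\<Sum>a<m. (\<i> * evec l a) * cnj (\<i> * evec j a)) = of_real \<kappa>"
    "(\<Sum>a<m. (\<i> * evec l a) * cnj (evec j a)) = \<i> * of_real \<kappa>"
    "(\<Sum>a<m. evec l a * cnj (\<i> * evec j a)) = - \<i> * of_real \<kappa>"
    "(\<Sum>a<m. (\<i> * evec j a) * (\<i> * evec l a)) = - of_real \<kappa>"
    "(\<Sum>a<m. evec j a * (\<i> * evec l a)) = \<i> * of_real \<kappa>"
    "(\<Sum>a<m. (\<i> * evec j a) * evec l a) = \<i> * of_real \<kappa>"
    using j l by (auto simp: evec_def \<kappa>_def if_distrib[of "\<lambda>x. _ * x"] if_distrib[of "\<lambda>x. x * _"]
        if_distrib[of cnj] cong: if_cong)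
  have h: "gen_hess c m z (evec j) (evec l) = - 2 * \<kappa> + c * \<kappa> * Re q + 2 * c * Re X"
    "gen_hess c m z (\<lambda>i. \<i> * evec j i) (\<lambda>i. \<i> * evec l i) = - 2 * \<kappa> - c * \<kappa> * Re q + 2 * c * Re X"
    "gen_hess c m z (evec j) (\<lambda>i. \<i> * evec l i) = c * \<kappa> * Im q - 2 * c * Im X"
    "gen_hess c m z (\<lambda>i. \<i> * evec j i) (evec l) = c * \<kappa> * Im q + 2 * c * Im X"
    unfolding gen_hess_def s1 s2 i1 sum_evec[OF j] sum_evec[OF l] sum_ii_evec[OF j] sum_ii_evec[OF l]
    by (simp_all add: X_def q_def algebra_simps)
  have "wirt (\<lambda>W. ln (gen_norm c m W powr (- p))) z j l =
    - of_real p * ((- of_real \<kappa> + of_real c * cnj X) / of_real N - x * cnj y / (of_real N)\<^sup>2)"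
    unfolding wirt_def dd_ln_gen_norm[OF pos] h sum_evec[OF j] sum_evec[OF l] sum_ii_evec[OF j]
      sum_ii_evec[OF l] N_def[symmetric] x_def[symmetric] y_def[symmetric]
    using N by (simp add: complex_eq_iff power2_eq_square Re_divide_of_real Im_divide_of_real field_simps
        flip: of_real_mult)
  then show ?thesis
    by (simp add: \<kappa>_def X_def x_def y_def N_def mult_ac)
qed

lemma g_DIV_eq:
  assumes "Z \<in> DIV m" "a < m" "b < m"
  shows "g_DIV m Z a b =
    - of_nat m * ((- (if a = b then 1 else 0) + Z a * cnj (Z b)) / of_real (gen_norm 1 m Z)
      - gen_grad 1 m Z a * cnj (gen_grad 1 m Z b) / (of_real (gen_norm 1 m Z))\<^sup>2)"
proof -
  have "K_DIV m = (\<lambda>W. gen_norm 1 m W powr (- real m))"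
    by (simp add: fun_eq_iff K_DIV_def gen_norm_def)
  moreover have "gen_norm 1 m Z > 0"
    using assms by (simp add: DIV_def gen_norm_def)
  ultimately show ?thesis
    using wirt_ln_gen_norm[of 1 m Z a b "real m"] assms by (simp add: g_DIV_def)
qed

lemma g_ball_eq:
  assumes "z \<in> cball_n n" "j < n" "l < n"
  shows "g_ball n z j l =
    - of_nat (n + 1) * (- (if j = l then 1 else 0) / of_real (gen_norm 0 n z)
      - cnj (z j) * z l / (of_real (gen_norm 0 n z))\<^sup>2)"
proof -
  have "K_ball n = (\<lambda>W. gen_norm 0 n W powr (- real (n + 1)))"
    by (simp add: fun_eq_iff K_ball_def gen_norm_def zzbar_def)
  moreover have "gen_norm 0 n z > 0"
    using assms by (simp add: cball_n_def gen_norm_def zzbar_def)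
  ultimately show ?thesis
    using wirt_ln_gen_norm[of 0 n z j l "real (n + 1)"] assms by (simp add: g_ball_def gen_grad_def)
qed

lemma eventually_line_in_ball:
  assumes "z \<in> cball_n n" "u \<in> cvec n"
  shows "\<forall>\<^sub>F t in at 0. (\<lambda>i. z i + t * u i) \<in> cball_n n"
proof -
  have "((\<lambda>t. \<Sum>j<n. (cmod (z j + t * u j))\<^sup>2) \<longlongrightarrow> (\<Sum>j<n. (cmod (z j + 0 * u j))\<^sup>2)) (at 0)"
    by (intro tendsto_intros)
  then have "\<forall>\<^sub>F t in at 0. (\<Sum>j<n. (cmod (z j + t * u j))\<^sup>2) < 1"
    by (rule order_tendstoD) (use assms in \<open>simp add: cball_n_def\<close>)
  then show ?thesis
    by eventually_elim (use assms in \<open>simp add: cball_n_def cvec_def\<close>)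
qed

lemma evec_cvec: "j < n \<Longrightarrow> evec j \<in> cvec n"
  by (simp add: evec_def cvec_def)

lemma partial_along_coordinate:
  assumes "curve_deriv n m (cball_n n) F z A" "z \<in> cball_n n" "j < n" "a < m"
  shows "((\<lambda>t. F (\<lambda>i. z i + t * evec j i) a) has_field_derivative A a j) (at 0)"
proof -
  have "((\<lambda>t. F (\<lambda>i. z i + t * evec j i) a) has_field_derivative (\<Sum>i<n. A a i * evec j i)) (at 0)"
    by (rule curve_derivD[where \<gamma> = "\<lambda>t i. z i + t * evec j i", OF assms(1)])
      (use assms eventually_line_in_ball[OF assms(2) evec_cvec[OF assms(3)]] in
        \<open>auto intro!: derivative_eq_intros\<close>)
  then show ?thesis
    using assms(3) by simp
qed

text \<open>On the diagonal the identity says that the two defining functions agree, so the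
  logarithms of the kernels have ratio m / (n + 1), the isometry constant. Off the diagonal z and w
  vary independently, so one-variable holomorphic derivatives replace a chain rule for
  \<open>wirt\<close>.\<close>

lemma holo_isometry_if_polarised_identity:
  assumes holo: "holo_map n m (cball_n n) (DIV m) F" and m: "m > 0"
    and pol: "\<And>z w. z \<in> cball_n n \<Longrightarrow> w \<in> cball_n n \<Longrightarrow>
      (\<Sum>a<m. F z a * cnj (F w a)) - zzt m (F z) * cnj (zzt m (F w)) / 4 = (\<Sum>j<n. z j * cnj (w j))"
  shows "holo_isometry n m F"
  unfolding holo_isometry_def
proof (intro conjI holo exI[of _ "real m / real (n + 1)"] ballI allI impI)
  show "0 < real m / real (n + 1)" using m by simp
next
  fix z j l assume z: "z \<in> cball_n n" and j: "j < n" and l: "l < n"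
  obtain A where "frechet_deriv n m (cball_n n) F z A"
    using holo z unfolding holo_map_frechet by blast
  then have A: "curve_deriv n m (cball_n n) F z A"
    by (rule curve_deriv_if_frechet_deriv)
  define P where "P a = A a j" for a
  define Q where "Q a = A a l" for a
  define Z where "Z = F z"
  have dA: "((\<lambda>t. F (\<lambda>i. z i + t * evec k i) a) has_field_derivative A a k) (at 0)"
    if "a < m" "k < n" for a k
    using partial_along_coordinate[OF A z that(2,1)] .
  have cP: "cpartial F a j z = P a" and cQ: "cpartial F a l z = Q a" if "a < m" for a
    unfolding cpartial_def P_def Q_def using DERIV_imp_deriv[OF dA] that j l by blast+
  \<comment> \<open>The derivative in z along coordinate k. At w = z it pulls
    \<open>gen_grad\<close> back to its counterpart on the ball; w stays general because a second
    differentiation follows.\<close>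
  have 1: "(\<Sum>a<m. A a k * cnj (F w a)) - (\<Sum>a<m. Z a * A a k) * cnj (zzt m (F w)) / 2 = cnj (w k)"
    if w: "w \<in> cball_n n" and k: "k < n" for w k
  proof -
    let ?\<gamma> = "\<lambda>t i. z i + t * evec k i"
    have D1: "((\<lambda>t. (\<Sum>a<m. F (?\<gamma> t) a * cnj (F w a)) - (\<Sum>a<m. (F (?\<gamma> t) a)\<^sup>2) * cnj (zzt m (F w)) / 4)
        has_field_derivative (\<Sum>a<m. A a k * cnj (F w a)) - (\<Sum>a<m. 2 * (A a k * F z a)) * cnj (zzt m (F w)) / 4) (at 0)"
      using k by (auto intro!: derivative_eq_intros dA)
    have D2: "((\<lambda>t. \<Sum>i<n. ?\<gamma> t i * cnj (w i)) has_field_derivative cnj (w k)) (at 0)"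
      using sum_evec[OF k, of "\<lambda>i. cnj (w i)"]
      by (auto intro!: derivative_eq_intros simp: mult.commute)
    have ev: "\<forall>\<^sub>F t in nhds 0. (\<Sum>a<m. F (?\<gamma> t) a * cnj (F w a)) - (\<Sum>a<m. (F (?\<gamma> t) a)\<^sup>2) * cnj (zzt m (F w)) / 4
        = (\<Sum>i<n. ?\<gamma> t i * cnj (w i))"
    proof -
      have "\<forall>\<^sub>F t in nhds 0. ?\<gamma> t \<in> cball_n n"
        using eventually_line_in_ball[OF z evec_cvec[OF k]] z by (simp add: eventually_nhds_conv_at)
      then show ?thesis
        by eventually_elim (use pol w in \<open>simp add: zzt_def\<close>)
    qed
    have "(\<Sum>a<m. A a k * cnj (F w a)) - (\<Sum>a<m. 2 * (A a k * F z a)) * cnj (zzt m (F w)) / 4 = cnj (w k)"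
      using DERIV_unique[OF D1 iffD2[OF DERIV_cong_ev[OF refl ev refl] D2]] .
    then show ?thesis
      by (simp add: Z_def mult.commute flip: sum_distrib_left)
  qed
  \<comment> \<open>The conjugate of the identity just obtained is holomorphic in w and can be
    differentiated along coordinate l at w = z.\<close>
  have 2: "(\<Sum>a<m. P a * cnj (Q a)) - (\<Sum>a<m. Z a * P a) * cnj (\<Sum>a<m. Z a * Q a) = (if j = l then 1 else 0)"
  proof -
    let ?\<gamma> = "\<lambda>t i. z i + t * evec l i"
    let ?c = "cnj (\<Sum>a<m. Z a * P a)"
    have D1: "((\<lambda>t. (\<Sum>a<m. cnj (P a) * F (?\<gamma> t) a) - ?c * (\<Sum>a<m. (F (?\<gamma> t) a)\<^sup>2) / 2)
        has_field_derivative (\<Sum>a<m. cnj (P a) * Q a) - ?c * (\<Sum>a<m. 2 * (Q a * F z a)) / 2) (at 0)"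
      using l by (auto intro!: derivative_eq_intros dA simp: Q_def mult.commute)
    have D2: "((\<lambda>t. ?\<gamma> t j) has_field_derivative (if j = l then 1 else 0)) (at 0)"
      by (auto intro!: derivative_eq_intros simp: evec_def)
    have ev: "\<forall>\<^sub>F t in nhds 0. (\<Sum>a<m. cnj (P a) * F (?\<gamma> t) a) - ?c * (\<Sum>a<m. (F (?\<gamma> t) a)\<^sup>2) / 2 = ?\<gamma> t j"
    proof -
      have "\<forall>\<^sub>F t in nhds 0. ?\<gamma> t \<in> cball_n n"
        using eventually_line_in_ball[OF z evec_cvec[OF l]] z by (simp add: eventually_nhds_conv_at)
      then show ?thesis
      proof eventually_elim
        case (elim t)
        from arg_cong[OF 1[OF elim j], of cnj] show ?case
          by (simp add: zzt_def P_def)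
      qed
    qed
    have "(\<Sum>a<m. cnj (P a) * Q a) - ?c * (\<Sum>a<m. 2 * (Q a * F z a)) / 2 = (if j = l then 1 else 0)"
      using DERIV_unique[OF D1 iffD2[OF DERIV_cong_ev[OF refl ev refl] D2]] .
    from arg_cong[OF this, of cnj] show ?thesis
      by (simp add: Z_def if_distrib[of cnj] mult.commute flip: sum_distrib_left)
  qed
  define N where "N = complex_of_real (gen_norm 0 n z)"
  have ZD: "Z \<in> DIV m" using holo z by (auto simp: holo_map_def Z_def)
  have "complex_of_real (gen_norm 1 m Z) = N"
    using pol[OF z z]
    by (simp add: N_def gen_norm_def zzbar_complex Z_def complex_norm_square algebra_simps flip: of_real_power)
  note gD = g_DIV_eq[OF ZD, unfolded this]
  have grad: "(\<Sum>a<m. A a k * gen_grad 1 m Z a) = - cnj (z k)" if "k < n" for k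
    using 1[OF z that] by (simp add: gen_grad_def Z_def algebra_simps sum.distrib sum_subtractf sum_distrib_left
        flip: sum_divide_distrib)
  have gradP: "(\<Sum>a<m. P a * gen_grad 1 m Z a) = - cnj (z j)"
    using grad[OF j] by (simp add: P_def)
  have gradQ: "(\<Sum>b<m. cnj (gen_grad 1 m Z b) * cnj (Q b)) = - z l"
    using arg_cong[OF grad[OF l], of cnj] by (simp add: Q_def mult.commute)
  \<comment> \<open>Up to sign, the left side of \<open>2\<close> is the pullback of the Hessian
    part of the metric, so that part becomes the one of the ball.\<close>
  have hess: "(\<Sum>a<m. \<Sum>b<m. P a * (- (if a = b then 1 else 0) + Z a * cnj (Z b)) * cnj (Q b)) = - (if j = l then 1 else 0)"
  proof -
    have "(\<Sum>a<m. \<Sum>b<m. P a * (- (if a = b then 1 else 0) + Z a * cnj (Z b)) * cnj (Q b))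
      = (\<Sum>a<m. \<Sum>b<m. (if a = b then - (P a * cnj (Q b)) else 0)) + (\<Sum>a<m. \<Sum>b<m. (Z a * P a) * (cnj (Z b) * cnj (Q b)))"
      unfolding sum.distrib[symmetric] by (intro sum.cong refl) (simp add: algebra_simps)
    also have "\<dots> = - (\<Sum>a<m. P a * cnj (Q a)) + (\<Sum>a<m. Z a * P a) * cnj (\<Sum>a<m. Z a * Q a)"
      by (simp add: sum_product sum_negf)
    also have "\<dots> = - (if j = l then 1 else 0)"
      unfolding 2[symmetric] by simp
    finally show ?thesis .
  qed
  have "(\<Sum>a<m. \<Sum>b<m. cpartial F a j z * g_DIV m (F z) a b * cnj (cpartial F b l z))
    = (\<Sum>a<m. \<Sum>b<m. - of_nat m * (P a * (- (if a = b then 1 else 0) + Z a * cnj (Z b)) * cnj (Q b) / N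
        - (P a * gen_grad 1 m Z a) * (cnj (gen_grad 1 m Z b) * cnj (Q b)) / N\<^sup>2))"
    by (intro sum.cong refl) (simp add: cP cQ gD flip: Z_def, simp add: algebra_simps diff_divide_distrib add_divide_distrib)
  also have "\<dots> = - of_nat m * ((\<Sum>a<m. \<Sum>b<m. P a * (- (if a = b then 1 else 0) + Z a * cnj (Z b)) * cnj (Q b)) / N
      - (\<Sum>a<m. P a * gen_grad 1 m Z a) * (\<Sum>b<m. cnj (gen_grad 1 m Z b) * cnj (Q b)) / N\<^sup>2)"
    unfolding sum_product
    by (simp only: sum_divide_distrib sum_subtractf[symmetric] sum_distrib_left)
  also have "\<dots> = - of_nat m * (- (if j = l then 1 else 0) / N - cnj (z j) * z l / N\<^sup>2)"
    unfolding hess gradP gradQ by simp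
  also have "\<dots> = complex_of_real (real m / real (n + 1)) * g_ball n z j l"
  proof -
    have "complex_of_real (real m / real (n + 1)) * of_nat (n + 1) = of_nat m"
      using of_nat_neq_0[of n, where ?'a = complex] by (simp add: of_real_divide)
    then show ?thesis
      unfolding g_ball_eq[OF z j l] N_def
      by (simp only: mult_minus_left mult_minus_right mult.assoc[symmetric])
  qed
  finally show "(\<Sum>a<m. \<Sum>b<m. cpartial F a j z * g_DIV m (F z) a b * cnj (cpartial F b l z))
          = complex_of_real (real m / real (n + 1)) * g_ball n z j l" .
qed

section \<open>Cartan's uniqueness theorem for the type IV domain\<close>

lemma cnorm_triangle: "cnorm m (\<lambda>i. x i + y i) \<le> cnorm m x + cnorm m y"
proof -
  have "L2_set (\<lambda>j. cmod (x j + y j)) {..<m} \<le> L2_set (\<lambda>j. cmod (x j) + cmod (y j)) {..<m}"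
    by (rule L2_set_mono) (auto simp: norm_triangle_ineq)
  also have "\<dots> \<le> L2_set (\<lambda>j. cmod (x j)) {..<m} + L2_set (\<lambda>j. cmod (y j)) {..<m}"
    by (rule L2_set_triangle_ineq)
  finally show ?thesis
    by (simp add: cnorm_def L2_set_def)
qed

lemma cnorm_scale: "cnorm m (\<lambda>i. c * x i) = cmod c * cnorm m x"
  by (simp add: cnorm_def norm_mult power_mult_distrib real_sqrt_mult flip: sum_distrib_left)

lemma zzbar_cnorm: "zzbar m Z = (cnorm m Z)\<^sup>2"
  by (simp add: zzbar_def cnorm_def sum_nonneg)

lemma zzbar_nonneg [simp]: "0 \<le> zzbar m Z"
  by (simp add: zzbar_def sum_nonneg)

lemma zzbar_scale: "zzbar m (\<lambda>i. c * Z i) = (cmod c)\<^sup>2 * zzbar m Z"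
  by (simp add: zzbar_def norm_mult power_mult_distrib sum_distrib_left)

lemma zzt_scale: "zzt m (\<lambda>i. c * Z i) = c\<^sup>2 * zzt m Z"
  by (simp add: zzt_def power_mult_distrib sum_distrib_left)

lemma cmod_zzt_le: "cmod (zzt m Z) \<le> zzbar m Z"
  unfolding zzt_def zzbar_def by (rule order_trans[OF norm_sum]) (simp add: norm_power)

section \<open>Scaling, bounds and complex line slices of the domain\<close>

definition closed_DIV :: "nat \<Rightarrow> (nat \<Rightarrow> complex) set" where
  "closed_DIV m = {Z \<in> cvec m. zzbar m Z \<le> 2 \<and> 1 - zzbar m Z + (cmod (zzt m Z))\<^sup>2 / 4 \<ge> 0}"

lemma DIV_subset_closed_DIV: "DIV m \<subseteq> closed_DIV m"
  by (auto simp: DIV_def closed_DIV_def)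

text \<open>Put r = |c|^2, a = |Z|^2 and b = |ZZ^t|^2 / 4, so that b \<ge> a - 1. Then 1 - r a + r^2
  b is at least 1 - r a + r^2 (a - 1) = (1 - r)(1 + r - r a), which is positive because r a \<le> 2
  r < 1 + r.\<close>

lemma scale_closed_DIV:
  assumes "Z \<in> closed_DIV m" "cmod c < 1"
  shows "(\<lambda>i. c * Z i) \<in> DIV m"
proof -
  define a b r where "a = zzbar m Z" and "b = (cmod (zzt m Z))\<^sup>2 / 4" and "r = (cmod c)\<^sup>2"
  have r: "0 \<le> r" "r < 1"
    using assms(2) by (auto simp: r_def abs_square_less_1)
  have ab: "a \<le> 2" "0 \<le> a" "a - 1 \<le> b"
    using assms(1) by (auto simp: closed_DIV_def a_def b_def)
  have ra: "r * a \<le> r * 2" using r ab by (intro mult_left_mono) auto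
  then have "0 < (1 - r) * (1 + r - r * a)"
    using r by (intro mult_pos_pos) auto
  also have "\<dots> = 1 - r * a + r\<^sup>2 * (a - 1)"
    by (simp add: power2_eq_square algebra_simps)
  also have "\<dots> \<le> 1 - r * a + r\<^sup>2 * b"
    using ab by (simp add: mult_left_mono)
  finally have "1 - r * a + r\<^sup>2 * b > 0" .
  moreover have "r * a < 2" using ra r by simp
  moreover have "(\<lambda>i. c * Z i) \<in> cvec m"
    using assms(1) by (simp add: closed_DIV_def cvec_def)
  ultimately show ?thesis
    by (simp add: DIV_def zzbar_scale zzt_scale norm_mult norm_power a_def b_def r_def
        power_mult_distrib flip: power_mult)
qed

lemma scale_DIV:
  assumes "Z \<in> DIV m" "cmod c \<le> 1"
  shows "(\<lambda>i. c * Z i) \<in> DIV m"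
proof (cases "cmod c < 1")
  case True
  then show ?thesis
    using assms scale_closed_DIV DIV_subset_closed_DIV by blast
next
  case False
  then have "cmod c = 1" using assms(2) by simp
  then show ?thesis
    using assms(1) by (simp add: DIV_def zzbar_scale zzt_scale norm_mult norm_power cvec_def)
qed

lemma zero_DIV [simp]: "(\<lambda>_. 0) \<in> DIV m"
  by (simp add: DIV_def cvec_def zzbar_def zzt_def)

lemma DIV_cvec: "Z \<in> DIV m \<Longrightarrow> Z \<in> cvec m"
  by (simp add: DIV_def)

text \<open>Here 3/2 is just a rational number above the square root of 2.\<close>

lemma cmod_DIV_less:
  assumes "Z \<in> DIV m" "a < m"
  shows "cmod (Z a) < 3 / 2"
proof -
  have "(cmod (Z a))\<^sup>2 \<le> zzbar m Z"
    unfolding zzbar_def using assms(2) by (intro member_le_sum) auto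
  also have "\<dots> < (3 / 2)\<^sup>2"
    using assms(1) by (simp add: DIV_def power2_eq_square)
  finally show ?thesis
    by (rule power_less_imp_less_base) simp
qed

lemma small_in_DIV:
  assumes "Z \<in> cvec m" "cnorm m Z < 1"
  shows "Z \<in> DIV m"
proof -
  have "zzbar m Z < 1"
    using assms(2) by (simp add: zzbar_cnorm abs_square_less_1)
  then show ?thesis
    using assms(1) by (simp add: DIV_def add_pos_nonneg)
qed

text \<open>A slice by a complex line through 0, as a set of parameters. For Z in the domain it is
  open, star-shaped and contains the closed unit disc, so the one-variable identity theorem carries
  information from near 0, or from the unit circle, to parameter 1, that is, to Z.\<close>

definition disc_slice :: "nat \<Rightarrow> (nat \<Rightarrow> complex) \<Rightarrow> complex set" where
  "disc_slice m Z = {\<zeta>. (\<lambda>i. \<zeta> * Z i) \<in> DIV m}"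

lemma open_disc_slice:
  assumes "Z \<in> cvec m" shows "open (disc_slice m Z)"
proof -
  have "disc_slice m Z = {\<zeta>. (cmod \<zeta>)\<^sup>2 * zzbar m Z < 2} \<inter>
      {\<zeta>. 0 < 1 - (cmod \<zeta>)\<^sup>2 * zzbar m Z + (cmod (\<zeta>\<^sup>2 * zzt m Z))\<^sup>2 / 4}"
    using assms by (auto simp: disc_slice_def DIV_def zzbar_scale zzt_scale cvec_def)
  then show ?thesis
    by (auto intro!: open_Int open_Collect_less continuous_intros)
qed

lemma connected_disc_slice: "connected (disc_slice m Z)"
proof (rule starlike_imp_connected)
  have "closed_segment 0 x \<subseteq> disc_slice m Z" if "x \<in> disc_slice m Z" for x
  proof
    fix y assume "y \<in> closed_segment 0 x"
    then obtain u where u: "0 \<le> u" "u \<le> 1" "y = of_real u * x"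
      by (auto simp: closed_segment_def scaleR_conv_of_real)
    have "(\<lambda>i. of_real u * (x * Z i)) \<in> DIV m"
      using scale_DIV[of "\<lambda>i. x * Z i" m "of_real u"] that u by (simp add: disc_slice_def)
    then show "y \<in> disc_slice m Z"
      using u by (simp add: disc_slice_def mult.assoc)
  qed
  then show "starlike (disc_slice m Z)"
    unfolding starlike_def by (intro bexI[of _ 0]) (auto simp: disc_slice_def)
qed

lemma cball_subset_disc_slice: "Z \<in> DIV m \<Longrightarrow> cball 0 1 \<subseteq> disc_slice m Z"
  by (auto simp: disc_slice_def intro: scale_DIV)

lemma Schwarz_scaled:
  assumes "f holomorphic_on ball 0 1" "f 0 = 0" "\<And>z. cmod z < 1 \<Longrightarrow> cmod (f z) < M" "cmod \<xi> < 1"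
  shows "cmod (f \<xi>) \<le> M * cmod \<xi>"
proof -
  have M: "M > 0" using assms(3)[of 0] assms(2) by simp
  have "cmod (f \<xi> / of_real M) \<le> cmod \<xi>"
    using assms M by (intro Schwarz_Lemma(1)) (auto intro!: holomorphic_intros simp: norm_divide)
  then show ?thesis
    using M by (simp add: norm_divide field_simps)
qed

text \<open>The Schwarz lemma applied twice: once to f, which bounds the quotient h(z) = f(z) / z by
  M, and once to h, which vanishes at 0 because the derivative of f does. The factor 2 restores the
  strict bound that the second application requires.\<close>

lemma Schwarz_order_two:
  assumes "f holomorphic_on ball 0 1" "f 0 = 0" "deriv f 0 = 0"
    "\<And>z. cmod z < 1 \<Longrightarrow> cmod (f z) < M" "cmod \<xi> < 1"
  shows "cmod (f \<xi>) \<le> 2 * M * (cmod \<xi>)\<^sup>2"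
proof -
  define h where "h = (\<lambda>z. if z = 0 then deriv f 0 else (f z - f 0) / (z - 0))"
  have M: "M > 0" using assms(4)[of 0] assms(2) by simp
  have "h holomorphic_on ball 0 1"
    unfolding h_def by (rule pole_lemma_open[OF assms(1)]) simp
  moreover have "cmod (h z) < 2 * M" if "cmod z < 1" for z
  proof (cases "z = 0")
    case False
    have "cmod (f z) \<le> M * cmod z"
      by (rule Schwarz_scaled) (use assms that in auto)
    then have "cmod (h z) \<le> M"
      using False assms(2) by (simp add: h_def norm_divide field_simps)
    then show ?thesis using M by simp
  qed (use M assms in \<open>simp add: h_def\<close>)
  ultimately have "cmod (h \<xi>) \<le> 2 * M * cmod \<xi>"
    using assms(3,5) by (intro Schwarz_scaled) (auto simp: h_def)
  moreover have "f \<xi> = \<xi> * h \<xi>"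
    using assms(2,3) by (simp add: h_def)
  ultimately show ?thesis
    using mult_left_mono[of "cmod (h \<xi>)" "2 * M * cmod \<xi>" "cmod \<xi>"]
    by (simp add: norm_mult power2_eq_square mult_ac)
qed

section \<open>Cartan's theorem by iteration of self-maps tangent to the identity\<close>

lemma curve_deriv_cong:
  assumes "curve_deriv n m U F z A" "\<And>a j. a < m \<Longrightarrow> j < n \<Longrightarrow> A a j = B a j"
  shows "curve_deriv n m U F z B"
proof -
  have "(\<Sum>j<n. A a j * d j) = (\<Sum>j<n. B a j * d j)" if "a < m" for a d
    using assms(2) that by simp
  then show ?thesis
    using assms(1) unfolding curve_deriv_def by simp
qed

lemma curve_deriv_scale:
  "curve_deriv m m U (\<lambda>z i. c * z i) z (\<lambda>a j. if a = j then c else 0)"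
  unfolding curve_deriv_def
  by (auto simp: if_distrib[of "\<lambda>x. x * _"] intro!: derivative_eq_intros cong: if_cong)

lemma curve_holo_scale: "curve_holo m m U (\<lambda>z i. c * z i)"
  unfolding curve_holo_def using curve_deriv_scale by blast

text \<open>This class is closed under composition, so all iterates of a member obey the same a
  priori bounds; that uniformity takes the place of comparing Taylor coefficients of
  iterates.\<close>

definition tangent_to_id :: "nat \<Rightarrow> ((nat \<Rightarrow> complex) \<Rightarrow> (nat \<Rightarrow> complex)) \<Rightarrow> bool" where
  "tangent_to_id m g \<longleftrightarrow> g ` DIV m \<subseteq> DIV m \<and> g (\<lambda>_. 0) = (\<lambda>_. 0) \<and> curve_holo m m (DIV m) g \<and>
     curve_deriv m m (DIV m) g (\<lambda>_. 0) (\<lambda>a j. if a = j then 1 else 0)"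

lemma tangent_to_id_id: "tangent_to_id m (\<lambda>z. z)"
  using curve_deriv_scale[of m "DIV m" 1 "\<lambda>_. 0"] curve_holo_scale[of m "DIV m" 1]
  by (simp add: tangent_to_id_def)

lemma tangent_to_id_compose:
  assumes f: "tangent_to_id m f" and g: "tangent_to_id m g"
  shows "tangent_to_id m (\<lambda>z. g (f z))"
proof -
  have "curve_deriv m m (DIV m) (\<lambda>z. g (f z)) (\<lambda>_. 0)
      (\<lambda>a j. \<Sum>b<m. (if a = b then 1 else 0) * (if b = j then 1 else 0))"
    by (rule curve_deriv_compose[where V = "DIV m"]) (use f g in \<open>auto simp: tangent_to_id_def\<close>)
  then have "curve_deriv m m (DIV m) (\<lambda>z. g (f z)) (\<lambda>_. 0) (\<lambda>a j. if a = j then 1 else 0)"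
    by (rule curve_deriv_cong) (simp add: if_distrib[of "\<lambda>x. x * _"] cong: if_cong)
  moreover have "curve_holo m m (DIV m) (\<lambda>z. g (f z))"
    by (rule curve_holo_compose[where V = "DIV m"]) (use f g in \<open>auto simp: tangent_to_id_def\<close>)
  ultimately show ?thesis
    using f g by (auto simp: tangent_to_id_def)
qed

lemma tangent_to_id_funpow:
  assumes "tangent_to_id m g" shows "tangent_to_id m (g ^^ j)"
proof (induction j)
  case 0
  then show ?case using tangent_to_id_id by (simp add: id_def)
next
  case (Suc j)
  from tangent_to_id_compose[OF Suc assms] show ?case by (simp add: o_def)
qed

text \<open>On the disc of multiples of V = W / (2 R), where R is the norm of W, the displacement is
  bounded by 3/2 + 1/2 = 2 and vanishes to second order at 0. At parameter 2 R this gives 2 * 2 * (2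
  R)^2 = 16 R^2.\<close>

lemma tangent_to_id_quadratic:
  assumes g: "tangent_to_id m g" and W: "W \<in> cvec m" "cnorm m W < 1 / 2" and a: "a < m"
  shows "cmod (g W a - W a) \<le> 16 * (cnorm m W)\<^sup>2"
proof (cases "cnorm m W = 0")
  case True
  have "W i = 0" for i
  proof (cases "i < m")
    case True
    then show ?thesis using cmod_le_cnorm[of i m W] \<open>cnorm m W = 0\<close> by simp
  qed (use W in \<open>simp add: cvec_def\<close>)
  then have "W = (\<lambda>_. 0)" by auto
  then show ?thesis using g by (simp add: tangent_to_id_def)
next
  case False
  define R where "R = cnorm m W"
  have R: "R > 0" "R < 1 / 2" using False W by (simp_all add: R_def order_less_le)
  define V where "V = (\<lambda>i. of_real (1 / (2 * R)) * W i)"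
  have VC: "V \<in> cvec m" using W by (simp add: V_def cvec_def)
  have V: "cnorm m V = 1 / 2"
    unfolding V_def cnorm_scale using R by (simp add: norm_divide norm_mult R_def[symmetric])
  define \<gamma> where "\<gamma> \<zeta> = (\<lambda>i. \<zeta> * V i)" for \<zeta>
  have \<gamma>: "\<gamma> \<zeta> \<in> DIV m" if "cmod \<zeta> < 1" for \<zeta>
    unfolding \<gamma>_def by (rule small_in_DIV) (use that VC in \<open>simp_all add: cvec_def cnorm_scale V\<close>)
  define f where "f \<zeta> = g (\<gamma> \<zeta>) a - \<gamma> \<zeta> a" for \<zeta>
  have hol: "f holomorphic_on ball 0 1"
    unfolding f_def
  proof (intro holomorphic_intros)
    show "(\<lambda>\<zeta>. g (\<gamma> \<zeta>) a) holomorphic_on ball 0 1"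
      by (rule curve_holo_slice[where U = "DIV m" and n = m and m = m])
        (use g \<gamma> a in \<open>auto simp: tangent_to_id_def \<gamma>_def intro!: holomorphic_intros\<close>)
    show "(\<lambda>\<zeta>. \<gamma> \<zeta> a) holomorphic_on ball 0 1"
      unfolding \<gamma>_def by (intro holomorphic_intros)
  qed
  have f0: "f 0 = 0"
    using g by (simp add: f_def \<gamma>_def tangent_to_id_def)
  have ev: "\<forall>\<^sub>F t in at 0. \<gamma> t \<in> DIV m"
    using eventually_at_in_open'[of "ball 0 1" "0::complex"] by (rule eventually_mono) (auto intro: \<gamma>)
  have d: "((\<lambda>\<zeta>. \<gamma> \<zeta> i) has_field_derivative V i) (at 0)" for i
    unfolding \<gamma>_def by (auto intro!: derivative_eq_intros)
  have "((\<lambda>\<zeta>. g (\<gamma> \<zeta>) a) has_field_derivative (\<Sum>j<m. (if a = j then 1 else 0) * V j)) (at 0)"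
    by (rule curve_derivD[where U = "DIV m"])
      (use g ev d a in \<open>auto simp: tangent_to_id_def \<gamma>_def[of 0]\<close>)
  then have "((\<lambda>\<zeta>. g (\<gamma> \<zeta>) a) has_field_derivative V a) (at 0)"
    using a by (simp add: if_distrib[of "\<lambda>x. x * _"] cong: if_cong)
  from DERIV_diff[OF this d[of a]] have f': "deriv f 0 = 0"
    unfolding f_def by (intro DERIV_imp_deriv) simp
  have bound: "cmod (f \<zeta>) < 2" if "cmod \<zeta> < 1" for \<zeta>
  proof -
    have "cmod (g (\<gamma> \<zeta>) a) < 3 / 2"
      using g \<gamma>[OF that] a by (intro cmod_DIV_less) (auto simp: tangent_to_id_def)
    moreover have "cmod (\<gamma> \<zeta> a) \<le> 1 / 2"
      using cmod_le_cnorm[OF a, of "\<gamma> \<zeta>"] that V by (simp add: \<gamma>_def cnorm_scale)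
    ultimately show ?thesis
      unfolding f_def using norm_triangle_ineq4[of "g (\<gamma> \<zeta>) a" "\<gamma> \<zeta> a"] by simp
  qed
  have "cmod (f (of_real (2 * R))) \<le> 2 * 2 * (cmod (of_real (2 * R)))\<^sup>2"
    by (rule Schwarz_order_two[OF hol f0 f' bound]) (use R in auto)
  moreover have "\<gamma> (of_real (2 * R)) = W"
    using R by (simp add: \<gamma>_def V_def fun_eq_iff)
  ultimately show ?thesis
    using R by (simp add: f_def power_mult_distrib flip: R_def)
qed

text \<open>The disc through W in the direction of W', of radius r, stays in the ball of radius 2 r,
  where the quadratic bound limits the change of the displacement to 64 r^2 + 16 r^2 < 100 r^2. The
  Schwarz lemma at parameter \<delta> / r turns this into 100 r \<delta>.\<close>

lemma tangent_to_id_Lipschitz: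
  assumes g: "tangent_to_id m g" and W: "W \<in> cvec m" "W' \<in> cvec m" and r: "0 < r" "r < 1 / 4"
    "cnorm m W \<le> r" "cnorm m (\<lambda>i. W' i - W i) < r" and a: "a < m"
  shows "cmod ((g W' a - W' a) - (g W a - W a)) \<le> 100 * r * cnorm m (\<lambda>i. W' i - W i)"
proof (cases "cnorm m (\<lambda>i. W' i - W i) = 0")
  case True
  have "W' i = W i" for i
  proof (cases "i < m")
    case True
    then show ?thesis using cmod_le_cnorm[of i m "\<lambda>i. W' i - W i"] \<open>cnorm m (\<lambda>i. W' i - W i) = 0\<close> by simp
  qed (use W in \<open>simp add: cvec_def\<close>)
  then have "W' = W" by auto
  then show ?thesis using r by simp
next
  case False
  define \<delta> where "\<delta> = cnorm m (\<lambda>i. W' i - W i)"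
  have \<delta>: "\<delta> > 0" "\<delta> < r" using False r by (simp_all add: \<delta>_def order_less_le)
  define \<gamma> where "\<gamma> \<zeta> = (\<lambda>i. W i + \<zeta> * of_real (r / \<delta>) * (W' i - W i))" for \<zeta>
  have \<gamma>C: "\<gamma> \<zeta> \<in> cvec m" for \<zeta> using W by (simp add: \<gamma>_def cvec_def)
  have \<gamma>n: "cnorm m (\<gamma> \<zeta>) \<le> 2 * r" if "cmod \<zeta> < 1" for \<zeta>
  proof -
    have "cnorm m (\<gamma> \<zeta>) \<le> cnorm m W + cmod (\<zeta> * of_real (r / \<delta>)) * \<delta>"
      unfolding \<gamma>_def by (rule order_trans[OF cnorm_triangle]) (simp only: cnorm_scale \<delta>_def order_refl)
    also have "cmod (\<zeta> * of_real (r / \<delta>)) * \<delta> = cmod \<zeta> * r"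
      using \<delta> r by (simp add: norm_mult norm_divide)
    also have "\<dots> \<le> r" using that r by (simp add: mult_left_le_one_le)
    finally show ?thesis using r by simp
  qed
  have \<gamma>: "\<gamma> \<zeta> \<in> DIV m" if "cmod \<zeta> < 1" for \<zeta>
    using \<gamma>n[OF that] r \<gamma>C by (intro small_in_DIV) auto
  define f where "f \<zeta> = (g (\<gamma> \<zeta>) a - \<gamma> \<zeta> a) - (g W a - W a)" for \<zeta>
  have hol: "f holomorphic_on ball 0 1"
    unfolding f_def
  proof (intro holomorphic_intros)
    show "(\<lambda>\<zeta>. g (\<gamma> \<zeta>) a) holomorphic_on ball 0 1"
      by (rule curve_holo_slice[where U = "DIV m" and n = m and m = m])
        (use g \<gamma> a in \<open>auto simp: tangent_to_id_def \<gamma>_def intro!: holomorphic_intros\<close>)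
    show "(\<lambda>\<zeta>. \<gamma> \<zeta> a) holomorphic_on ball 0 1"
      unfolding \<gamma>_def by (intro holomorphic_intros)
  qed
  have f0: "f 0 = 0" by (simp add: f_def \<gamma>_def)
  have bound: "cmod (f \<zeta>) < 100 * r\<^sup>2" if "cmod \<zeta> < 1" for \<zeta>
  proof -
    have "cmod (g (\<gamma> \<zeta>) a - \<gamma> \<zeta> a) \<le> 16 * (cnorm m (\<gamma> \<zeta>))\<^sup>2"
      using \<gamma>n[OF that] r \<gamma>C by (intro tangent_to_id_quadratic[OF g _ _ a]) auto
    also have "\<dots> \<le> 16 * (2 * r)\<^sup>2"
      using \<gamma>n[OF that] by (intro mult_left_mono power_mono) auto
    finally have 1: "cmod (g (\<gamma> \<zeta>) a - \<gamma> \<zeta> a) \<le> 64 * r\<^sup>2" by (simp add: power_mult_distrib)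
    have "cmod (g W a - W a) \<le> 16 * (cnorm m W)\<^sup>2"
      using r W by (intro tangent_to_id_quadratic[OF g _ _ a]) auto
    also have "\<dots> \<le> 16 * r\<^sup>2"
      using r by (intro mult_left_mono power_mono) auto
    finally have "cmod (f \<zeta>) \<le> 64 * r\<^sup>2 + 16 * r\<^sup>2"
      unfolding f_def using 1 by (intro order_trans[OF norm_triangle_ineq4]) simp
    also have "\<dots> < 100 * r\<^sup>2" using r by simp
    finally show ?thesis .
  qed
  have "cmod (f (of_real (\<delta> / r))) \<le> 100 * r\<^sup>2 * cmod (of_real (\<delta> / r))"
    by (rule Schwarz_scaled[OF hol f0 bound]) (use \<delta> r in \<open>auto simp: norm_divide\<close>)
  also have "\<dots> = 100 * r * \<delta>"
    using \<delta> r by (simp add: norm_divide power2_eq_square)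
  finally have "cmod (f (of_real (\<delta> / r))) \<le> 100 * r * \<delta>" .
  moreover have "\<gamma> (of_real (\<delta> / r)) = W'"
    using \<delta> r by (simp add: \<gamma>_def fun_eq_iff)
  ultimately show ?thesis
    by (simp add: f_def \<delta>_def)
qed

text \<open>The displacement of the \<open>j\<close>-th iterate of \<open>g\<close> is nearly \<open>j\<close> times that of \<open>g\<close>, although
  both obey the same bound \<open>S\<close>; hence the bound can be halved.\<close>

lemma tangent_to_id_improve:
  assumes W: "W \<in> cvec m" and r: "0 < r" "200 * real m * r \<le> 1" "r < 1 / 4" "cnorm m W \<le> r"
    and S: "\<And>g a. tangent_to_id m g \<Longrightarrow> a < m \<Longrightarrow> cmod (g W a - W a) \<le> S"
    and g: "tangent_to_id m g" and a: "a < m"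
  shows "cmod (g W a - W a) \<le> S / 2"
proof -
  have gC: "tangent_to_id m (g ^^ i)" for i using tangent_to_id_funpow[OF g] .
  have S0: "0 \<le> S" using S[OF g a] norm_ge_zero order_trans by blast
  define u where "u V = g V a - V a" for V
  have WD: "W \<in> DIV m" using W r by (intro small_in_DIV) auto
  \<comment> \<open>The iterate moves W by at most \<open>real m * S\<close> and also by less than
    r, because 16 m r^2 < r. The second bound makes the Lipschitz estimate applicable, the first is
    inserted into it.\<close>
  have near: "cmod (u ((g ^^ i) W) - u W) \<le> 100 * r * (real m * S)" for i
  proof -
    let ?W' = "(g ^^ i) W"
    have "?W' \<in> DIV m" using gC WD by (auto simp: tangent_to_id_def)
    then have W': "?W' \<in> cvec m" by (rule DIV_cvec)
    have *: "cnorm m (\<lambda>i. ?W' i - W i) \<le> (\<Sum>a<m. cmod (?W' a - W a))"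
      by (rule cnorm_le_sum)
    also have "\<dots> \<le> (\<Sum>a<m. S)"
      using S[OF gC] by (intro sum_mono) auto
    finally have dS: "cnorm m (\<lambda>i. ?W' i - W i) \<le> real m * S" by simp
    note *
    also have "(\<Sum>a<m. cmod (?W' a - W a)) \<le> (\<Sum>a<m. 16 * r\<^sup>2)"
    proof (rule sum_mono)
      fix b assume "b \<in> {..<m}"
      then have "cmod (?W' b - W b) \<le> 16 * (cnorm m W)\<^sup>2"
        using W r by (intro tangent_to_id_quadratic[OF gC]) auto
      also have "\<dots> \<le> 16 * r\<^sup>2"
        using r by (intro mult_left_mono power_mono) auto
      finally show "cmod (?W' b - W b) \<le> 16 * r\<^sup>2" .
    qed
    also have "\<dots> = (16 * real m * r) * r" by (simp add: power2_eq_square)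
    also have "\<dots> < 1 * r"
    proof (rule mult_strict_right_mono)
      have "0 < real m * r" using a r by (auto intro!: mult_pos_pos)
      then show "16 * real m * r < 1" using r(2) by linarith
    qed (use r in simp)
    finally have "cnorm m (\<lambda>i. ?W' i - W i) < r" by simp
    from tangent_to_id_Lipschitz[OF g W W' r(1,3,4) this a]
    have "cmod (u ?W' - u W) \<le> 100 * r * cnorm m (\<lambda>i. ?W' i - W i)"
      by (simp add: u_def)
    also have "\<dots> \<le> 100 * r * (real m * S)"
      using dS r by (intro mult_left_mono) auto
    finally show ?thesis .
  qed
  \<comment> \<open>Telescoping: j times the displacement of g equals the displacement of the j-th
    iterate, at most S for every j, minus j small deviations. Letting j grow removes the
    contribution of S.\<close>
  have key: "real j * cmod (u W) \<le> S + real j * (100 * r * (real m * S))" for j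
  proof -
    have "(\<Sum>i<j. u ((g ^^ i) W)) = (g ^^ j) W a - W a"
      using sum_lessThan_telescope[of "\<lambda>i. (g ^^ i) W a" j] by (simp add: u_def)
    then have "of_nat j * u W = ((g ^^ j) W a - W a) - (\<Sum>i<j. u ((g ^^ i) W) - u W)"
      by (simp add: sum_subtractf)
    then have "real j * cmod (u W) = cmod (((g ^^ j) W a - W a) - (\<Sum>i<j. u ((g ^^ i) W) - u W))"
      by (metis norm_mult norm_of_nat)
    also have "\<dots> \<le> cmod ((g ^^ j) W a - W a) + (\<Sum>i<j. cmod (u ((g ^^ i) W) - u W))"
      by (rule order_trans[OF norm_triangle_ineq4]) (simp add: norm_sum)
    also have "\<dots> \<le> S + (\<Sum>i<j. 100 * r * (real m * S))"
      using S[OF gC a] near by (intro add_mono sum_mono) auto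
    finally show ?thesis by simp
  qed
  have "cmod (u W) \<le> 100 * r * (real m * S)"
  proof (rule ccontr)
    assume "\<not> ?thesis"
    then have "0 < cmod (u W) - 100 * r * (real m * S)" by simp
    from reals_Archimedean3[OF this] obtain j :: nat where
      "S < real j * (cmod (u W) - 100 * r * (real m * S))" by blast
    then show False using key[of j] by (simp add: algebra_simps)
  qed
  also have "\<dots> = (200 * real m * r) * S / 2" by simp
  also have "\<dots> \<le> 1 * S / 2"
    using r S0 by (intro divide_right_mono mult_right_mono) auto
  finally show ?thesis by (simp add: u_def)
qed

text \<open>The supremum of the displacements at W is finite by the quadratic bound and at most half
  of itself, hence not positive. It is taken over the whole class because iterates of g enter the
  estimate for g. The radius is chosen to make 100 m r at most 1/2.\<close>

lemma tangent_to_id_near_zero: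
  assumes g: "tangent_to_id m g" and W: "W \<in> cvec m" "cnorm m W \<le> 1 / (200 * (real m + 1))"
  shows "g W = W"
proof -
  define r where "r = 1 / (200 * (real m + 1))"
  have r: "0 < r" "200 * real m * r \<le> 1" "r < 1 / 4" "cnorm m W \<le> r"
    using W by (auto simp: r_def field_simps)
  define X where "X = {cmod (h W a - W a) | h a. tangent_to_id m h \<and> a < m}"
  have ub: "x \<le> 16 * (cnorm m W)\<^sup>2" if "x \<in> X" for x
    using that tangent_to_id_quadratic[OF _ W(1)] r by (force simp: X_def)
  then have bdd: "bdd_above X" by (rule bdd_aboveI)
  have upper: "cmod (h W a - W a) \<le> Sup X" if "tangent_to_id m h" "a < m" for h a
    using that by (intro cSup_upper[OF _ bdd]) (auto simp: X_def)
  have "g W a = W a" for a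
  proof (cases "a < m")
    case True
    have "Sup X \<le> Sup X / 2"
    proof (rule cSup_least)
      show "X \<noteq> {}" using g True by (auto simp: X_def)
      fix x assume "x \<in> X"
      then obtain h b where hb: "x = cmod (h W b - W b)" "tangent_to_id m h" "b < m"
        by (auto simp: X_def)
      show "x \<le> Sup X / 2"
        unfolding hb(1) by (rule tangent_to_id_improve[OF W(1) r]) (use upper hb in auto)
    qed
    then have "cmod (g W a - W a) \<le> 0"
      using upper[OF g True] by linarith
    then show ?thesis by simp
  next
    case False
    have "g W \<in> DIV m"
      using g small_in_DIV[OF W(1)] r by (force simp: tangent_to_id_def)
    then show ?thesis using False W(1) by (simp add: DIV_def cvec_def)
  qed
  then show ?thesis by auto
qed

text \<open>Near 0 the map is already known to be the identity; the identity theorem on the slice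
  through Z extends this to Z.\<close>

theorem Cartan_uniqueness_DIV:
  assumes g: "tangent_to_id m g" and Z: "Z \<in> DIV m"
  shows "g Z = Z"
proof
  fix a
  have gZ: "g Z \<in> DIV m" using g Z by (auto simp: tangent_to_id_def)
  show "g Z a = Z a"
  proof (cases "a < m")
    case False
    then show ?thesis using gZ Z by (simp add: DIV_def cvec_def)
  next
    case a: True
    define r where "r = 1 / (200 * (real m + 1))"
    \<comment> \<open>Parameters below \<open>e\<close> bring Z into the small ball; the minimum
      with 1 keeps them inside the closed unit disc, hence inside the slice.\<close>
    define e where "e = min 1 (r / (cnorm m Z + 1))"
    have e: "0 < e" "e \<le> 1" "e \<le> r / (cnorm m Z + 1)"
      by (auto simp: e_def r_def add_nonneg_pos intro!: divide_pos_pos mult_pos_pos)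
    let ?S = "disc_slice m Z"
    let ?f = "\<lambda>\<zeta>. g (\<lambda>i. \<zeta> * Z i) a - \<zeta> * Z a"
    have S: "open ?S" "connected ?S" "cball 0 1 \<subseteq> ?S"
      using open_disc_slice[OF DIV_cvec[OF Z]] connected_disc_slice cball_subset_disc_slice[OF Z] by auto
    have "?f 1 = 0"
    proof (rule analytic_continuation[where f = ?f and U = "ball 0 e" and S = ?S and \<xi> = 0])
      show "?f holomorphic_on ?S"
      proof (intro holomorphic_on_diff holomorphic_on_mult holomorphic_on_ident holomorphic_on_const)
        show "(\<lambda>\<zeta>. g (\<lambda>i. \<zeta> * Z i) a) holomorphic_on ?S"
          by (rule curve_holo_slice[where U = "DIV m" and n = m and m = m and \<gamma> = "\<lambda>\<zeta> i. \<zeta> * Z i"])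
            (use g a S in \<open>auto simp: tangent_to_id_def disc_slice_def intro!: holomorphic_intros\<close>)
      qed
      have "ball 0 e \<subseteq> cball (0::complex) 1" using e by auto
      with S show "ball 0 e \<subseteq> ?S" by blast
      show "0 \<in> ?S" "1 \<in> ?S" using S(3) by (auto simp: subset_iff)
      show "0 islimpt ball (0::complex) e" using e by (simp add: islimpt_ball)
      show "?f \<zeta> = 0" if "\<zeta> \<in> ball 0 e" for \<zeta>
      proof -
        have "cnorm m (\<lambda>i. \<zeta> * Z i) \<le> e * cnorm m Z"
          using that by (auto simp: cnorm_scale intro!: mult_right_mono)
        also have "\<dots> \<le> r / (cnorm m Z + 1) * cnorm m Z"
          using e by (intro mult_right_mono) auto
        also have "\<dots> \<le> r / (cnorm m Z + 1) * (cnorm m Z + 1)"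
          by (intro mult_left_mono) (auto simp: r_def)
        also have "\<dots> = r"
          using add_nonneg_pos[of "cnorm m Z" 1] by simp
        finally have "cnorm m (\<lambda>i. \<zeta> * Z i) \<le> 1 / (200 * (real m + 1))" by (simp add: r_def)
        then have "g (\<lambda>i. \<zeta> * Z i) = (\<lambda>i. \<zeta> * Z i)"
          using DIV_cvec[OF Z] by (intro tangent_to_id_near_zero[OF g]) (auto simp: cvec_def)
        then show ?thesis by simp
      qed
    qed (use S in auto)
    then show ?thesis by simp
  qed
qed

section \<open>From uniqueness to linearity of involutions\<close>

lemma eventually_line_in_DIV:
  assumes "Z \<in> DIV m" "u \<in> cvec m" shows "\<forall>\<^sub>F t in at 0. (\<lambda>i. Z i + t * u i) \<in> DIV m"
proof -
  have "((\<lambda>t. zzbar m (\<lambda>i. Z i + t * u i)) \<longlongrightarrow> zzbar m (\<lambda>i. Z i + 0 * u i)) (at 0)"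
    unfolding zzbar_def by (intro tendsto_intros)
  then have 1: "\<forall>\<^sub>F t in at 0. zzbar m (\<lambda>i. Z i + t * u i) < 2"
    by (rule order_tendstoD) (use assms in \<open>simp add: DIV_def\<close>)
  have "((\<lambda>t. 1 - zzbar m (\<lambda>i. Z i + t * u i) + (cmod (zzt m (\<lambda>i. Z i + t * u i)))\<^sup>2 / 4) \<longlongrightarrow>
      1 - zzbar m (\<lambda>i. Z i + 0 * u i) + (cmod (zzt m (\<lambda>i. Z i + 0 * u i)))\<^sup>2 / 4) (at 0)"
    unfolding zzbar_def zzt_def by (intro tendsto_intros) auto
  then have 2: "\<forall>\<^sub>F t in at 0. 0 < 1 - zzbar m (\<lambda>i. Z i + t * u i) + (cmod (zzt m (\<lambda>i. Z i + t * u i)))\<^sup>2 / 4"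
    by (rule order_tendstoD) (use assms in \<open>simp add: DIV_def\<close>)
  have "(\<lambda>i. Z i + t * u i) \<in> cvec m" for t
    using assms by (simp add: DIV_def cvec_def)
  then show ?thesis
    using eventually_conj[OF 1 2] by (simp add: DIV_def)
qed

text \<open>The matrix in \<open>curve_deriv\<close> is pinned down by testing on coordinate lines.
  Hence a composition that equals the identity gives a matrix identity: A^2 = 1 for an involution,
  and inverse matrices for a map and its inverse.\<close>

lemma curve_deriv_of_identity:
  assumes M: "curve_deriv m m (DIV m) F Z M" and Z: "Z \<in> DIV m"
    and id: "\<And>Y. Y \<in> DIV m \<Longrightarrow> F Y = Y" and a: "a < m" and j: "j < m"
  shows "M a j = (if a = j then 1 else 0)"
proof -
  let ?\<gamma> = "\<lambda>t i. Z i + t * evec j i"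
  have ev: "\<forall>\<^sub>F t in at 0. ?\<gamma> t \<in> DIV m"
    using j by (intro eventually_line_in_DIV[OF Z]) (simp add: evec_def cvec_def)
  have "((\<lambda>t. F (?\<gamma> t) a) has_field_derivative (\<Sum>i<m. M a i * evec j i)) (at 0)"
    by (rule curve_derivD[OF M]) (use ev a in \<open>auto intro!: derivative_eq_intros\<close>)
  then have D: "((\<lambda>t. F (?\<gamma> t) a) has_field_derivative M a j) (at 0)"
    using j by simp
  have "\<forall>\<^sub>F t in nhds 0. ?\<gamma> t \<in> DIV m"
    using ev Z by (simp add: eventually_nhds_conv_at)
  then have E: "\<forall>\<^sub>F t in nhds 0. F (?\<gamma> t) a = ?\<gamma> t a"
    by eventually_elim (simp add: id)
  have "((\<lambda>t. ?\<gamma> t a) has_field_derivative M a j) (at 0)"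
    using iffD1[OF DERIV_cong_ev[OF refl E refl] D] .
  moreover have "((\<lambda>t. ?\<gamma> t a) has_field_derivative evec j a) (at 0)"
    by (auto intro!: derivative_eq_intros)
  ultimately have "M a j = evec j a" by (rule DERIV_unique)
  then show ?thesis by (simp add: evec_def)
qed

text \<open>Cartan's uniqueness theorem, applied to the commutator of the involution with a rotation,
  shows that the involution commutes with all rotations.\<close>

theorem involution_fixing_zero_linear:
  assumes into: "\<tau> ` DIV m \<subseteq> DIV m" and zero: "\<tau> (\<lambda>_. 0) = (\<lambda>_. 0)"
    and holo: "curve_holo m m (DIV m) \<tau>" and inv: "\<And>Z. Z \<in> DIV m \<Longrightarrow> \<tau> (\<tau> Z) = Z"
    and A: "curve_deriv m m (DIV m) \<tau> (\<lambda>_. 0) A"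
  shows "\<And>Z a. Z \<in> DIV m \<Longrightarrow> a < m \<Longrightarrow> \<tau> Z a = (\<Sum>j<m. A a j * Z j)"
proof -
  have "curve_deriv m m (DIV m) (\<lambda>Z. \<tau> (\<tau> Z)) (\<lambda>_. 0) (\<lambda>a j. \<Sum>b<m. A a b * A b j)"
    by (rule curve_deriv_compose[OF A _ into]) (simp add: zero A)
  note sq = curve_deriv_of_identity[OF this zero_DIV inv]
  have rot: "\<tau> (\<lambda>i. c * Z i) = (\<lambda>i. c * \<tau> Z i)" if c: "cmod c = 1" and Z: "Z \<in> DIV m" for c Z
  proof -
    have cc: "cnj c * c = 1" using c by (simp add: complex_norm_square[symmetric] mult.commute)
    define \<rho> where "\<rho> = (\<lambda>(b :: complex) (Y :: nat \<Rightarrow> complex) i. b * Y i)"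
    have \<rho>: "\<rho> b ` DIV m \<subseteq> DIV m" if "cmod b = 1" for b
      using that scale_DIV[of _ m b] by (auto simp: \<rho>_def)
    have \<rho>d: "curve_deriv m m (DIV m) (\<rho> b) z (\<lambda>a j. if a = j then b else 0)" for b z
      using curve_deriv_scale[of m "DIV m" b z] by (simp add: \<rho>_def)
    have \<rho>h: "curve_holo m m (DIV m) (\<rho> b)" for b
      using curve_holo_scale[of m "DIV m" b] by (simp add: \<rho>_def)
    have \<rho>0: "\<rho> b (\<lambda>_. 0) = (\<lambda>_. 0)" for b by (simp add: \<rho>_def)
    have *: "(\<lambda>Z. \<rho> c (\<tau> Z)) ` DIV m \<subseteq> DIV m" using into \<rho>[OF c] by auto
    then have **: "(\<lambda>Z. \<tau> (\<rho> c (\<tau> Z))) ` DIV m \<subseteq> DIV m" using into by auto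
    \<comment> \<open>Since \<tau> is its own inverse, this is the commutator with the rotation by
      c. Its derivative at 0 is cnj(c) A c A = A^2 = 1.\<close>
    define g where "g Z = \<rho> (cnj c) (\<tau> (\<rho> c (\<tau> Z)))" for Z
    have "curve_holo m m (DIV m) g"
      unfolding g_def
      by (intro curve_holo_compose[OF _ \<rho>h **] curve_holo_compose[OF _ holo *]
          curve_holo_compose[OF holo \<rho>h into])
    moreover have "g ` DIV m \<subseteq> DIV m"
      using ** \<rho>[of "cnj c"] c by (auto simp: g_def)
    moreover have "g (\<lambda>_. 0) = (\<lambda>_. 0)" by (simp add: g_def zero \<rho>0)
    moreover have "curve_deriv m m (DIV m) g (\<lambda>_. 0) (\<lambda>a j. if a = j then 1 else 0)"
    proof -
      have "curve_deriv m m (DIV m) (\<lambda>Z. \<rho> c (\<tau> Z)) (\<lambda>_. 0) (\<lambda>a j. \<Sum>b<m. (if a = b then c else 0) * A b j)"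
        by (rule curve_deriv_compose[OF A _ into]) (rule \<rho>d)
      then have "curve_deriv m m (DIV m) (\<lambda>Z. \<rho> c (\<tau> Z)) (\<lambda>_. 0) (\<lambda>a j. c * A a j)"
        by (rule curve_deriv_cong) (simp add: if_distrib[of "\<lambda>x. x * _"] cong: if_cong)
      then have "curve_deriv m m (DIV m) (\<lambda>Z. \<tau> (\<rho> c (\<tau> Z))) (\<lambda>_. 0) (\<lambda>a j. \<Sum>b<m. A a b * (c * A b j))"
        by (rule curve_deriv_compose[OF _ _ *]) (simp add: zero \<rho>0 A)
      then have "curve_deriv m m (DIV m) (\<lambda>Z. \<tau> (\<rho> c (\<tau> Z))) (\<lambda>_. 0) (\<lambda>a j. if a = j then c else 0)"
        by (rule curve_deriv_cong) (simp add: mult.left_commute sq flip: sum_distrib_left)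
      then have "curve_deriv m m (DIV m) g (\<lambda>_. 0)
          (\<lambda>a j. \<Sum>b<m. (if a = b then cnj c else 0) * (if b = j then c else 0))"
        unfolding g_def by (rule curve_deriv_compose[OF _ _ **]) (rule \<rho>d)
      then show ?thesis
        by (rule curve_deriv_cong) (simp add: if_distrib[of "\<lambda>x. x * _"] cc cong: if_cong)
    qed
    ultimately have "tangent_to_id m g" by (simp add: tangent_to_id_def)
    \<comment> \<open>Evaluating the commutator at \<open>\<tau> Z\<close> instead of Z cancels the
      inner involution.\<close>
    moreover have "\<tau> Z \<in> DIV m" using into Z by blast
    ultimately have "g (\<tau> Z) = \<tau> Z" by (rule Cartan_uniqueness_DIV)
    then have e: "cnj c * \<tau> (\<lambda>i. c * Z i) i = \<tau> Z i" for i
      using inv[OF Z] by (simp add: g_def \<rho>_def fun_eq_iff)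
    show ?thesis
    proof
      fix i
      have "c * \<tau> Z i = (cnj c * c) * \<tau> (\<lambda>i. c * Z i) i"
        unfolding e[symmetric] by (simp only: mult_ac)
      then show "\<tau> (\<lambda>i. c * Z i) i = c * \<tau> Z i" by (simp add: cc)
    qed
  qed
  show "\<tau> Z a = (\<Sum>j<m. A a j * Z j)" if Z: "Z \<in> DIV m" and a: "a < m" for Z a
  proof -
    let ?S = "disc_slice m Z"
    let ?f = "\<lambda>\<zeta>. \<tau> (\<lambda>i. \<zeta> * Z i) a - \<zeta> * \<tau> Z a"
    have S: "open ?S" "connected ?S" "cball 0 1 \<subseteq> ?S"
      using open_disc_slice[OF DIV_cvec[OF Z]] connected_disc_slice cball_subset_disc_slice[OF Z] by auto
    \<comment> \<open>Homogeneity holds on the unit circle, hence on the whole slice, in particular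
      near 0, where the derivative identifies the linear map.\<close>
    have f0: "?f \<zeta> = 0" if "\<zeta> \<in> ?S" for \<zeta>
    proof (rule analytic_continuation[where f = ?f and U = "sphere 0 1" and S = ?S and \<xi> = 1])
      show "?f holomorphic_on ?S"
      proof (intro holomorphic_on_diff holomorphic_on_mult holomorphic_on_ident holomorphic_on_const)
        show "(\<lambda>\<zeta>. \<tau> (\<lambda>i. \<zeta> * Z i) a) holomorphic_on ?S"
          by (rule curve_holo_slice[where U = "DIV m" and n = m and m = m and \<gamma> = "\<lambda>\<zeta> i. \<zeta> * Z i"])
            (use holo a S in \<open>auto simp: disc_slice_def intro!: holomorphic_intros\<close>)
      qed
      show "sphere 0 1 \<subseteq> ?S" "1 \<in> ?S" using S(3) by (auto simp: subset_iff)
      show "(1::complex) islimpt sphere 0 1"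
      proof (rule connected_imp_perfect)
        show "connected (sphere (0::complex) 1)" by (rule connected_sphere) simp
        show "sphere 0 1 \<noteq> {x}" for x :: complex
        proof
          assume eq: "sphere 0 1 = {x}"
          have "(1::complex) \<in> sphere 0 1" "(-1::complex) \<in> sphere 0 1" by simp_all
          then show False unfolding eq by auto
        qed
      qed simp
      show "?f \<zeta> = 0" if "\<zeta> \<in> sphere 0 1" for \<zeta>
        using rot[of \<zeta> Z] that Z by simp
    qed (use S that in auto)
    have D: "((\<lambda>\<zeta>. \<tau> (\<lambda>i. \<zeta> * Z i) a) has_field_derivative (\<Sum>j<m. A a j * Z j)) (at 0)"
      by (rule curve_derivD[OF A])
        (use eventually_line_in_DIV[OF zero_DIV DIV_cvec[OF Z]] a in \<open>auto intro!: derivative_eq_intros\<close>)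
    have E: "\<forall>\<^sub>F \<zeta> in nhds 0. \<tau> (\<lambda>i. \<zeta> * Z i) a = \<zeta> * \<tau> Z a"
    proof -
      have "0 \<in> ?S" by (simp add: disc_slice_def)
      from eventually_nhds_in_open[OF S(1) this] show ?thesis
        by eventually_elim (use f0 in simp)
    qed
    have "((\<lambda>\<zeta>. \<zeta> * \<tau> Z a) has_field_derivative (\<Sum>j<m. A a j * Z j)) (at 0)"
      using iffD1[OF DERIV_cong_ev[OF refl E refl] D] .
    moreover have "((\<lambda>\<zeta>. \<zeta> * \<tau> Z a) has_field_derivative \<tau> Z a) (at 0)"
      by (auto intro!: derivative_eq_intros)
    ultimately show ?thesis using DERIV_unique by metis
  qed
qed

section \<open>Linear involutions of the type IV domain\<close>

definition lin :: "nat \<Rightarrow> (nat \<Rightarrow> nat \<Rightarrow> complex) \<Rightarrow> (nat \<Rightarrow> complex) \<Rightarrow> nat \<Rightarrow> complex" where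
  "lin m A Z = (\<lambda>a. if a < m then \<Sum>j<m. A a j * Z j else 0)"

lemma lin_scale: "lin m A (\<lambda>i. c * Z i) = (\<lambda>i. c * lin m A Z i)"
  by (auto simp: lin_def sum_distrib_left mult_ac)

lemma lin_add: "lin m A (\<lambda>i. Z i + W i) = (\<lambda>i. lin m A Z i + lin m A W i)"
  by (auto simp: lin_def sum.distrib algebra_simps)

lemma lin_cvec [simp]: "lin m A Z \<in> cvec m"
  by (simp add: lin_def cvec_def)

lemma lin_evec: "j < m \<Longrightarrow> lin m A (evec j) = (\<lambda>a. if a < m then A a j else 0)"
  by (auto simp: lin_def)

text \<open>Pairings of y with a combination of its conjugate and itself, prepared for k = cnj q /
  2, where this combination becomes an isotropic direction tangent to the boundary.\<close>

lemma conj_combination: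
  fixes y :: "nat \<Rightarrow> complex" and k :: complex and m :: nat
  defines "q \<equiv> zzt m y" and "a \<equiv> complex_of_real (zzbar m y)"
  shows "zzt m (\<lambda>i. cnj (y i) - k * y i) = cnj q - 2 * k * a + k\<^sup>2 * q"
    "(\<Sum>i<m. y i * (cnj (y i) - k * y i)) = a - k * q"
    "(\<Sum>i<m. (cnj (y i) - k * y i) * cnj (y i)) = cnj q - k * a"
    "complex_of_real (zzbar m (\<lambda>i. cnj (y i) - k * y i)) = a - cnj k * cnj q - k * q + k * cnj k * a"
  unfolding q_def a_def zzbar_complex zzt_def
  by (simp_all add: sum_distrib_left sum.distrib[symmetric] sum_subtractf[symmetric] power2_eq_square
      algebra_simps)

lemma real_zzt:
  assumes "\<And>i. Im (x i) = 0" shows "zzt m x = complex_of_real (zzbar m x)"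
proof -
  have "(x i)\<^sup>2 = x i * cnj (x i)" for i
    using assms[of i] by (simp add: complex_eq_iff power2_eq_square)
  then show ?thesis by (simp add: zzbar_complex zzt_def)
qed

text \<open>A complex binary form whose modulus on real pairs is \<alpha>^2 + \<beta>^2 is either p
  (\<alpha>^2 + \<beta>^2) or p (\<alpha> + i \<beta>)^2 or p (\<alpha> - i \<beta>)^2. After
  division by p, testing at (0,1), (1,1), (1,-1), (1,2) and (1,-2) suffices.\<close>

lemma quadratic_form_unimodular:
  fixes p q r :: complex
  assumes *: "\<And>\<alpha> \<beta> :: real. cmod (of_real (\<alpha>\<^sup>2) * p + of_real (2 * \<alpha> * \<beta>) * q + of_real (\<beta>\<^sup>2) * r) = \<alpha>\<^sup>2 + \<beta>\<^sup>2"
  shows "cmod p = 1" "(r = p \<and> q = 0) \<or> (r = - p \<and> (q = \<i> * p \<or> q = - \<i> * p))"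
proof -
  show p: "cmod p = 1" using *[of 1 0] by simp
  then have p0: "p \<noteq> 0" by auto
  define Q R where "Q = q / p" and "R = r / p"
  define u v x y where "u = Re Q" and "v = Im Q" and "x = Re R" and "y = Im R"
  have eq: "(\<alpha>\<^sup>2 + 2 * \<alpha> * \<beta> * u + \<beta>\<^sup>2 * x)\<^sup>2 + (2 * \<alpha> * \<beta> * v + \<beta>\<^sup>2 * y)\<^sup>2 = (\<alpha>\<^sup>2 + \<beta>\<^sup>2)\<^sup>2" for \<alpha> \<beta>
  proof -
    have "of_real (\<alpha>\<^sup>2) * p + of_real (2 * \<alpha> * \<beta>) * q + of_real (\<beta>\<^sup>2) * r
        = (of_real (\<alpha>\<^sup>2) + of_real (2 * \<alpha> * \<beta>) * Q + of_real (\<beta>\<^sup>2) * R) * p"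
      using p0 by (simp add: Q_def R_def field_simps)
    then have "\<alpha>\<^sup>2 + \<beta>\<^sup>2 = cmod (of_real (\<alpha>\<^sup>2) + of_real (2 * \<alpha> * \<beta>) * Q + of_real (\<beta>\<^sup>2) * R)"
      using *[of \<alpha> \<beta>] p by (metis mult.right_neutral norm_mult)
    then have "(\<alpha>\<^sup>2 + \<beta>\<^sup>2)\<^sup>2 = (cmod (of_real (\<alpha>\<^sup>2) + of_real (2 * \<alpha> * \<beta>) * Q + of_real (\<beta>\<^sup>2) * R))\<^sup>2"
      by simp
    then show ?thesis
      unfolding cmod_power2 by (simp add: u_def v_def x_def y_def)
  qed
  have e0: "x * x + y * y = 1" using eq[of 0 1] by (simp add: power2_eq_square)
  have e1: "(1 + 2 * u + x)\<^sup>2 + (2 * v + y)\<^sup>2 = 4" "(1 - 2 * u + x)\<^sup>2 + (y - 2 * v)\<^sup>2 = 4"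
    "(1 + 4 * u + 4 * x)\<^sup>2 + (4 * v + 4 * y)\<^sup>2 = 25" "(1 - 4 * u + 4 * x)\<^sup>2 + (4 * y - 4 * v)\<^sup>2 = 25"
    using eq[of 1 1] eq[of 1 "-1"] eq[of 1 2] eq[of 1 "-2"] by simp_all
  \<comment> \<open>Differences of tests at opposite \<beta> isolate the terms odd in \<beta>;
    comparing the two differences leaves 3 u = 0.\<close>
  have d1: "u + u * x + v * y = 0" and d2: "u + 4 * (u * x) + 4 * (v * y) = 0"
    using e1 by (simp_all add: power2_eq_square algebra_simps)
  have u: "u = 0" using d1 d2 by linarith
  with d1 have vy: "v * y = 0" by simp
  have s: "x + 2 * (v * v) = 1"
    using e1(1,2) e0 u by (simp add: power2_eq_square algebra_simps)
  have "(x = 1 \<and> y = 0 \<and> v = 0) \<or> (x = -1 \<and> y = 0 \<and> (v = 1 \<or> v = -1))"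
  proof (cases "v = 0")
    case True
    then show ?thesis using s e0 by simp
  next
    case False
    then have "y = 0" using vy by simp
    then have "x = 1 \<or> x = -1" using e0 by (simp add: square_eq_1_iff)
    moreover have "x \<noteq> 1" using False s by auto
    ultimately have "x = -1" by simp
    then have "v = 1 \<or> v = -1" using s by (simp add: square_eq_1_iff)
    then show ?thesis using \<open>x = -1\<close> \<open>y = 0\<close> by simp
  qed
  moreover have "q / p = Complex u v" "r / p = Complex x y"
    by (simp_all add: u_def v_def x_def y_def Q_def R_def)
  then have "q = Complex u v * p" "r = Complex x y * p"
    using p0 by (simp_all add: field_simps)
  ultimately show "(r = p \<and> q = 0) \<or> (r = - p \<and> (q = \<i> * p \<or> q = - \<i> * p))"
    using u by (auto simp: complex_eq_iff)
qed

section \<open>Boundary points and the bilinear Gram matrix of a linear involution\<close>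

locale linear_involution =
  fixes m :: nat and A :: "nat \<Rightarrow> nat \<Rightarrow> complex"
  assumes lin_into: "Z \<in> DIV m \<Longrightarrow> lin m A Z \<in> DIV m"
    and lin_invol_DIV: "Z \<in> DIV m \<Longrightarrow> lin m A (lin m A Z) = Z"
begin

text \<open>The domain contains a ball about 0, and \<open>lin\<close> is homogeneous.\<close>

lemma lin_invol:
  assumes "Z \<in> cvec m" shows "lin m A (lin m A Z) = Z"
proof -
  define e where "e = 1 / (2 * (cnorm m Z + 1))"
  have N: "0 \<le> cnorm m Z" by simp
  have e: "e > 0" using N by (simp add: e_def add_nonneg_pos del: cnorm_nonneg)
  have "(\<lambda>i. of_real e * Z i) \<in> DIV m"
  proof (rule small_in_DIV)
    show "(\<lambda>i. of_real e * Z i) \<in> cvec m" using assms by (simp add: cvec_def)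
    have "cnorm m (\<lambda>i. of_real e * Z i) = e * cnorm m Z"
      using e by (simp add: cnorm_scale)
    also have "\<dots> < 1" using N by (simp add: e_def field_simps del: cnorm_nonneg)
    finally show "cnorm m (\<lambda>i. of_real e * Z i) < 1" .
  qed
  from lin_invol_DIV[OF this] show ?thesis
    using e by (simp add: lin_scale fun_eq_iff)
qed

text \<open>Shrinking by a real s < 1 moves Z into the open domain; both inequalities for the image
  survive the limit s \<rightarrow> 1.\<close>

lemma lin_closed_DIV:
  assumes Z: "Z \<in> closed_DIV m" shows "lin m A Z \<in> closed_DIV m"
proof -
  define a b where "a = zzbar m (lin m A Z)" and "b = (cmod (zzt m (lin m A Z)))\<^sup>2"
  have "s\<^sup>2 * a \<le> 2 \<and> 0 \<le> 1 - s\<^sup>2 * a + s ^ 4 * b / 4" if "0 < s" "s < 1" for s :: real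
  proof -
    have "(\<lambda>i. of_real s * Z i) \<in> DIV m"
      using Z that by (intro scale_closed_DIV) auto
    then have "(\<lambda>i. of_real s * lin m A Z i) \<in> DIV m"
      using lin_into[of "\<lambda>i. of_real s * Z i"] by (simp add: lin_scale)
    then show ?thesis
      using that by (simp add: DIV_def zzbar_scale zzt_scale a_def b_def norm_mult norm_power
          power_mult_distrib flip: power_mult)
  qed
  then have ev: "\<forall>\<^sub>F s in at_left 1. s\<^sup>2 * a \<le> 2 \<and> 0 \<le> 1 - s\<^sup>2 * a + s ^ 4 * b / 4"
    using eventually_at_left_real[of 0 1] by (auto elim!: eventually_mono)
  have "((\<lambda>s. s\<^sup>2 * a) \<longlongrightarrow> 1\<^sup>2 * a) (at_left 1)"
    by (intro tendsto_intros)
  then have "1\<^sup>2 * a \<le> 2"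
    by (rule tendsto_upperbound) (use ev in \<open>auto elim: eventually_mono\<close>)
  moreover have "((\<lambda>s. 1 - s\<^sup>2 * a + s ^ 4 * b / 4) \<longlongrightarrow> 1 - 1\<^sup>2 * a + 1 ^ 4 * b / 4) (at_left 1)"
    by (intro tendsto_intros) auto
  then have "0 \<le> 1 - 1\<^sup>2 * a + 1 ^ 4 * b / 4"
    by (rule tendsto_lowerbound) (use ev in \<open>auto elim: eventually_mono\<close>)
  ultimately show ?thesis
    by (simp add: closed_DIV_def a_def b_def)
qed

text \<open>A real vector on the boundary is a complex extreme point of the closed domain, whereas
  every other boundary point lies in a complex disc \<open>y + \<eta> W\<close> contained in the boundary.\<close>

lemma real_boundary_point:
  assumes x: "x \<in> cvec m" "\<And>i. Im (x i) = 0" "zzbar m x = 2"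
  shows "zzbar m (lin m A x) = 2" "cmod (zzt m (lin m A x)) = 2"
proof -
  define y a q where "y = lin m A x" and "a = zzbar m y" and "q = zzt m y"
  have x_closed: "x \<in> closed_DIV m"
    using x real_zzt[OF x(2), of m] by (simp add: closed_DIV_def)
  then have "y \<in> closed_DIV m" unfolding y_def by (rule lin_closed_DIV)
  then have y: "y \<in> cvec m" "a \<le> 2" "1 - a + (cmod q)\<^sup>2 / 4 \<ge> 0"
    by (auto simp: closed_DIV_def a_def q_def)
  have ly: "lin m A y = x" using x by (simp add: y_def lin_invol)
  have "a = 2"
  proof (rule ccontr)
    assume "a \<noteq> 2"
    with y have a2: "a < 2" by simp
    \<comment> \<open>Were the second inequality strict, y would lie in the open domain, and so
      would its image x; but |x|^2 = 2.\<close>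
    have q4: "(cmod q)\<^sup>2 = 4 * (a - 1)"
    proof (rule ccontr)
      assume "\<not> ?thesis"
      then have "y \<in> DIV m" using y a2 by (simp add: DIV_def a_def q_def)
      from lin_into[OF this] show False using ly x by (simp add: DIV_def)
    qed
    have qq: "q * cnj q = 4 * (of_real a - 1)"
      using q4 by (simp add: complex_norm_square[symmetric])
    \<comment> \<open>W is chosen with W W^t = 0, y W^t = 1, |W| = 1 and pairing cnj q / 2 with the
      conjugate of y. Along y + \<eta> W with real \<eta>, the norm square and a quarter of |zzt|^2
      then both grow by \<eta> Re q + \<eta>^2, so the defining function stays 0.\<close>
    define k W where "k = cnj q / 2" and "W = (\<lambda>i. of_real (1 / (2 - a)) * (cnj (y i) - k * y i))"
    note cc = conj_combination[where m = m and y = y and k = k, folded q_def a_def]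
    have "zzt m (\<lambda>i. cnj (y i) - k * y i) = cnj q * (1 - of_real a + q * cnj q / 4)"
      unfolding cc by (simp add: k_def power2_eq_square algebra_simps)
    also have "\<dots> = 0" unfolding qq by (simp add: field_simps)
    finally have Wq: "zzt m W = 0" unfolding W_def zzt_scale by simp
    have "(\<Sum>i<m. y i * (cnj (y i) - k * y i)) = of_real a - q * cnj q / 2"
      unfolding cc by (simp add: k_def)
    also have "\<dots> = of_real (2 - a)" unfolding qq by (simp add: field_simps)
    finally have yW': "(\<Sum>i<m. y i * (cnj (y i) - k * y i)) = of_real (2 - a)" .
    have a2c: "complex_of_real (1 / (2 - a)) * of_real (2 - a) = 1"
      using a2 by (simp only: of_real_mult[symmetric]) simp
    have "(\<Sum>i<m. y i * W i) = of_real (1 / (2 - a)) * (\<Sum>i<m. y i * (cnj (y i) - k * y i))"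
      by (simp only: W_def sum_distrib_left mult.left_commute)
    then have yW: "(\<Sum>i<m. y i * W i) = 1"
      unfolding yW' a2c .
    have Wy': "(\<Sum>i<m. (cnj (y i) - k * y i) * cnj (y i)) = of_real (2 - a) * (cnj q / 2)"
      unfolding cc by (simp add: k_def algebra_simps)
    have "(\<Sum>i<m. W i * cnj (y i)) = of_real (1 / (2 - a)) * (\<Sum>i<m. (cnj (y i) - k * y i) * cnj (y i))"
      by (simp only: W_def sum_distrib_left mult.assoc)
    then have Wy: "(\<Sum>i<m. W i * cnj (y i)) = cnj q / 2"
      unfolding Wy' mult.assoc[symmetric] a2c by simp
    have "complex_of_real (zzbar m (\<lambda>i. cnj (y i) - k * y i)) = of_real a - q * cnj q + (q * cnj q) * of_real a / 4"
      unfolding cc by (simp add: k_def algebra_simps)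
    also have "\<dots> = of_real ((2 - a)\<^sup>2)" unfolding qq by (simp add: power2_eq_square field_simps)
    finally have "zzbar m (\<lambda>i. cnj (y i) - k * y i) = (2 - a)\<^sup>2" unfolding of_real_eq_iff .
    then have WW: "zzbar m W = 1"
      unfolding W_def zzbar_scale norm_of_real using a2 by (simp add: power_divide)
    have WC: "W \<in> cvec m" using y by (simp add: W_def cvec_def)
    define V where "V = lin m A W"
    have q2: "cmod q \<le> 2"
      using cmod_zzt_le[of m y] y by (simp add: q_def a_def)
    \<comment> \<open>The norm square grows by at most 2 |\<eta>| + \<eta>^2, hence by at most 3
      |\<eta>| since |\<eta>| \<le> 1; this is where the third comes from.\<close>
    have line: "zzbar m (\<lambda>i. x i + of_real \<eta> * V i) \<le> 2" if "\<bar>\<eta>\<bar> \<le> (2 - a) / 3" for \<eta> :: real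
    proof -
      have a0: "0 \<le> a" by (simp add: a_def)
      have "(\<lambda>i. y i + of_real \<eta> * W i) \<in> closed_DIV m"
      proof -
        have zb: "zzbar m (\<lambda>i. y i + of_real \<eta> * W i) = a + \<eta> * Re q + \<eta>\<^sup>2"
          unfolding zzbar_line Wy WW by (simp add: a_def)
        have zt: "zzt m (\<lambda>i. y i + of_real \<eta> * W i) = q + 2 * of_real \<eta>"
          unfolding zzt_line yW Wq by (simp add: q_def)
        have "\<eta> * Re q \<le> \<bar>\<eta>\<bar> * 2"
          using abs_Re_le_cmod[of q] q2 abs_le_D1[of "\<eta> * Re q" "\<bar>\<eta>\<bar> * 2"]
          by (simp add: abs_mult mult_left_mono)
        moreover have "\<eta>\<^sup>2 \<le> \<bar>\<eta>\<bar>"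
          using that a0 mult_left_le_one_le[of "\<bar>\<eta>\<bar>" "\<bar>\<eta>\<bar>"] by (simp add: power2_eq_square)
        ultimately have "a + \<eta> * Re q + \<eta>\<^sup>2 \<le> 2" using that by simp
        moreover have "(cmod (q + 2 * of_real \<eta>))\<^sup>2 = (cmod q)\<^sup>2 + 4 * \<eta> * Re q + 4 * \<eta>\<^sup>2"
          unfolding cmod_power2 by (simp add: power2_eq_square algebra_simps)
        ultimately show ?thesis
          using y(1) WC q4 unfolding closed_DIV_def mem_Collect_eq zb zt by (simp add: cvec_def field_simps)
      qed
      from lin_closed_DIV[OF this] have "(\<lambda>i. x i + of_real \<eta> * V i) \<in> closed_DIV m"
        by (simp add: lin_add lin_scale ly V_def)
      then show ?thesis by (simp add: closed_DIV_def)
    qed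
    define \<epsilon> where "\<epsilon> = (2 - a) / 3"
    have \<epsilon>: "\<epsilon> > 0" using a2 by (simp add: \<epsilon>_def)
    \<comment> \<open>Adding the bounds for \<epsilon> and -\<epsilon> cancels the linear terms: x
      already has the maximal norm, so V must vanish, although an involution cannot send the nonzero
      W to 0.\<close>
    have "zzbar m (\<lambda>i. x i + of_real \<epsilon> * V i) \<le> 2" "zzbar m (\<lambda>i. x i + of_real (- \<epsilon>) * V i) \<le> 2"
      using \<epsilon> by (intro line; simp add: \<epsilon>_def)+
    then have "\<epsilon>\<^sup>2 * zzbar m V \<le> 0"
      unfolding zzbar_line x(3) by simp
    then have "zzbar m V = 0"
      using \<epsilon> zzbar_nonneg[of m V] by (simp add: mult_le_0_iff)
    then have "cnorm m V = 0" by (simp add: zzbar_cnorm)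
    then have "V i = 0" if "i < m" for i using cmod_le_cnorm[OF that, of V] by simp
    then have "lin m A V = (\<lambda>_. 0)" by (auto simp: lin_def)
    then have "W = (\<lambda>_. 0)" using lin_invol[OF WC] by (simp add: V_def)
    then show False using WW by (simp add: zzbar_def)
  qed
  then show "zzbar m (lin m A x) = 2" by (simp add: a_def y_def)
  have "cmod q \<le> 2" using cmod_zzt_le[of m y] \<open>a = 2\<close> by (simp add: q_def a_def)
  moreover have "2\<^sup>2 \<le> (cmod q)\<^sup>2" using y \<open>a = 2\<close> by simp
  then have "2 \<le> cmod q" by (rule power2_le_imp_le) simp
  ultimately show "cmod (zzt m (lin m A x)) = 2" by (simp add: q_def y_def)
qed

lemma real_vector:
  assumes x: "x \<in> cvec m" "\<And>i. Im (x i) = 0"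
  shows "zzbar m (lin m A x) = zzbar m x" "cmod (zzt m (lin m A x)) = zzbar m x"
proof -
  have "zzbar m (lin m A x) = zzbar m x \<and> cmod (zzt m (lin m A x)) = zzbar m x"
  proof (cases "zzbar m x = 0")
    case True
    then have "cnorm m x = 0" by (simp add: zzbar_cnorm)
    then have "x i = 0" if "i < m" for i using cmod_le_cnorm[OF that, of x] by simp
    then have "lin m A x = (\<lambda>_. 0)" by (auto simp: lin_def)
    then show ?thesis using True by (simp add: zzbar_def zzt_def)
  next
    case False
    then have s: "zzbar m x > 0" by (simp add: order_less_le)
    define c where "c = sqrt (2 / zzbar m x)"
    have c: "c\<^sup>2 = 2 / zzbar m x" using s by (simp add: c_def)
    let ?x = "\<lambda>i. of_real c * x i"
    have "?x \<in> cvec m" "\<And>i. Im (?x i) = 0" "zzbar m ?x = 2"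
      using x c s by (auto simp: cvec_def zzbar_scale)
    from real_boundary_point[OF this] show ?thesis
      using c s by (simp add: lin_scale zzbar_scale zzt_scale norm_mult norm_power field_simps)
  qed
  then show "zzbar m (lin m A x) = zzbar m x" "cmod (zzt m (lin m A x)) = zzbar m x" by auto
qed

text \<open>A^t A without conjugation: the matrix of the quadratic form that sends Z to
  \<open>zzt m (lin m A Z)\<close>.\<close>

definition gram :: "nat \<Rightarrow> nat \<Rightarrow> complex" where
  "gram j k = (\<Sum>a<m. A a j * A a k)"

text \<open>On real combinations of two basis vectors the form \<open>zzt\<close> of the image has
  modulus \<alpha>^2 + \<beta>^2. The second alternative is a form of rank one, which tests on two
  basis vectors cannot exclude.\<close>

lemma gram_pair:
  assumes jk: "j < m" "k < m" "j \<noteq> k"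
  shows "cmod (gram j j) = 1"
    "(gram k k = gram j j \<and> gram j k = 0) \<or>
      (gram k k = - gram j j \<and> (gram j k = \<i> * gram j j \<or> gram j k = - \<i> * gram j j))"
proof -
  have *: "cmod (of_real (\<alpha>\<^sup>2) * gram j j + of_real (2 * \<alpha> * \<beta>) * gram j k + of_real (\<beta>\<^sup>2) * gram k k) = \<alpha>\<^sup>2 + \<beta>\<^sup>2"
    for \<alpha> \<beta> :: real
  proof -
    define x where "x = (\<lambda>i. of_real \<alpha> * evec j i + of_real \<beta> * evec k i)"
    have x: "x \<in> cvec m" "\<And>i. Im (x i) = 0"
      using jk by (auto simp: x_def cvec_def evec_def)
    have "zzt m (lin m A x) = (\<Sum>a<m. (of_real \<alpha> * A a j + of_real \<beta> * A a k)\<^sup>2)"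
      unfolding x_def lin_add lin_scale zzt_def by (simp add: lin_evec jk)
    also have "\<dots> = of_real (\<alpha>\<^sup>2) * gram j j + of_real (2 * \<alpha> * \<beta>) * gram j k + of_real (\<beta>\<^sup>2) * gram k k"
      unfolding gram_def sum_distrib_left sum.distrib[symmetric]
      by (intro sum.cong refl) (simp add: power2_eq_square algebra_simps)
    finally have zz: "zzt m (lin m A x) = \<dots>" .
    have "zzbar m x = (\<Sum>i<m. (if i = j then \<alpha>\<^sup>2 else 0) + (if i = k then \<beta>\<^sup>2 else 0))"
      unfolding zzbar_def using jk by (intro sum.cong refl) (auto simp: x_def evec_def)
    also have "\<dots> = \<alpha>\<^sup>2 + \<beta>\<^sup>2" using jk by (simp add: sum.distrib)
    finally show ?thesis using real_vector(2)[OF x] zz by simp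
  qed
  show "cmod (gram j j) = 1" using quadratic_form_unimodular(1)[OF *] .
  show "(gram k k = gram j j \<and> gram j k = 0) \<or>
      (gram k k = - gram j j \<and> (gram j k = \<i> * gram j j \<or> gram j k = - \<i> * gram j j))"
    using quadratic_form_unimodular(2)[OF *] .
qed

lemma gram_triple:
  assumes jkl: "j < m" "k < m" "l < m" "j \<noteq> k" "j \<noteq> l" "k \<noteq> l"
  shows "cmod (gram j j + gram k k + gram l l + 2 * gram j k + 2 * gram j l + 2 * gram k l) = 3"
proof -
  define x where "x = (\<lambda>i. evec j i + (evec k i + evec l i))"
  have x: "x \<in> cvec m" "\<And>i. Im (x i) = 0"
    using jkl by (auto simp: x_def cvec_def evec_def)
  have "zzt m (lin m A x) = (\<Sum>a<m. (A a j + (A a k + A a l))\<^sup>2)"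
    unfolding x_def lin_add zzt_def by (simp add: lin_evec jkl)
  also have "\<dots> = gram j j + gram k k + gram l l + 2 * gram j k + 2 * gram j l + 2 * gram k l"
    unfolding gram_def sum_distrib_left sum.distrib[symmetric]
    by (intro sum.cong refl) (simp add: power2_eq_square algebra_simps)
  finally have zz: "zzt m (lin m A x) = \<dots>" .
  have "zzbar m x = (\<Sum>i<m. (if i = j then 1 else 0) + (if i = k then 1 else 0) + (if i = l then 1 else 0))"
    unfolding zzbar_def using jkl by (intro sum.cong refl) (auto simp: x_def evec_def)
  also have "\<dots> = 3" using jkl by (simp add: sum.distrib)
  finally show ?thesis using real_vector(2)[OF x] zz by simp
qed

text \<open>If the rank-one alternative held for j and k, then with a third index l the value at the
  sum of the three basis vectors would be s p with s = \<plusminus>1 or s = \<plusminus>1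
  \<plusminus> 4i, so |s|^2 would be 1 or 17 instead of 9.\<close>

lemma gram_scalar:
  assumes m: "m \<ge> 3" and jk: "j < m" "k < m" "j \<noteq> k"
  shows "gram k k = gram j j \<and> gram j k = 0"
proof (rule ccontr)
  assume neg: "\<not> ?thesis"
  obtain l where l: "l < m" "j \<noteq> l" "k \<noteq> l"
  proof -
    have "\<not> {..<3} \<subseteq> {j, k}"
      using card_mono[of "{j, k}" "{..<3::nat}"] card_insert_le_m1[of 2 "{k}" j] by auto
    then obtain l where "l < 3" "l \<notin> {j, k}" by auto
    then show ?thesis using m by (intro that[of l]) auto
  qed
  define p where "p = gram j j"
  have p: "cmod p = 1" "p \<noteq> 0" using gram_pair(1)[OF jk] by (auto simp: p_def)
  have jk': "gram k k = - p" "gram j k = \<i> * p \<or> gram j k = - \<i> * p"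
    using gram_pair(2)[OF jk] neg by (auto simp: p_def)
  have jl: "(gram l l = p \<and> gram j l = 0) \<or> (gram l l = - p \<and> (gram j l = \<i> * p \<or> gram j l = - \<i> * p))"
    using gram_pair(2)[OF jk(1) l(1,2)] by (simp add: p_def)
  have kl: "(gram l l = - p \<and> gram k l = 0) \<or> (gram l l = p \<and> (gram k l = - (\<i> * p) \<or> gram k l = \<i> * p))"
    using gram_pair(2)[OF jk(2) l(1,3)] jk' by simp
  have tot: "cmod (gram l l + 2 * gram j k + 2 * gram j l + 2 * gram k l) = 3"
    using gram_triple[OF jk(1,2) l(1) jk(3) l(2,3)] jk' by (simp add: p_def)
  have pp: "p \<noteq> - p" using p by simp
  define tot where "tot = gram l l + 2 * gram j k + 2 * gram j l + 2 * gram k l"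
  have "tot \<in> {p, - p, p + 4 * \<i> * p, p - 4 * \<i> * p, - p + 4 * \<i> * p, - p - 4 * \<i> * p}"
    using jk'(2)
  proof
    assume a: "gram j k = \<i> * p"
    from jl show ?thesis
    proof
      assume b: "gram l l = p \<and> gram j l = 0"
      with kl pp have "gram k l = - (\<i> * p) \<or> gram k l = \<i> * p" by auto
      then show ?thesis using a b by (auto simp: tot_def)
    next
      assume b: "gram l l = - p \<and> (gram j l = \<i> * p \<or> gram j l = - \<i> * p)"
      with kl pp have "gram k l = 0" by auto
      then show ?thesis using a b by (auto simp: tot_def)
    qed
  next
    assume a: "gram j k = - \<i> * p"
    from jl show ?thesis
    proof
      assume b: "gram l l = p \<and> gram j l = 0"
      with kl pp have "gram k l = - (\<i> * p) \<or> gram k l = \<i> * p" by auto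
      then show ?thesis using a b by (auto simp: tot_def)
    next
      assume b: "gram l l = - p \<and> (gram j l = \<i> * p \<or> gram j l = - \<i> * p)"
      with kl pp have "gram k l = 0" by auto
      then show ?thesis using a b by (auto simp: tot_def)
    qed
  qed
  then have "tot \<in> (\<lambda>s. s * p) ` {1, -1, 1 + 4 * \<i>, 1 - 4 * \<i>, -1 + 4 * \<i>, -1 - 4 * \<i>}"
    by (simp add: distrib_right left_diff_distrib)
  then obtain s where s: "s \<in> {1, -1, 1 + 4 * \<i>, 1 - 4 * \<i>, -1 + 4 * \<i>, -1 - 4 * \<i>}" "tot = s * p"
    by blast
  then have "cmod s = 3"
    using tot p by (simp add: norm_mult tot_def)
  have "(cmod s)\<^sup>2 = 1 \<or> (cmod s)\<^sup>2 = 17"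
    using s(1) by (auto simp: cmod_power2)
  with \<open>cmod s = 3\<close> show False by simp
qed

lemma gram_diagonal:
  assumes m: "m \<ge> 3" and "j < m" "k < m"
  shows "gram j k = (if j = k then gram 0 0 else 0)"
proof (cases "j = k")
  case True
  show ?thesis
  proof (cases "k = 0")
    case False
    then show ?thesis using gram_scalar[of 0 k] assms True by simp
  qed (use True in simp)
next
  case False
  then show ?thesis using gram_scalar[of j k] assms by simp
qed

lemma zzt_lin:
  assumes m: "m \<ge> 3"
  shows "zzt m (lin m A Z) = gram 0 0 * zzt m Z"
proof -
  define c where "c = gram 0 0"
  have g: "gram j k = (if j = k then c else 0)" if "j < m" "k < m" for j k
    using gram_diagonal[OF m that] by (simp add: c_def)
  have "zzt m (lin m A Z) = (\<Sum>a<m. \<Sum>j<m. \<Sum>k<m. (A a j * A a k) * (Z j * Z k))"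
    unfolding zzt_def lin_def by (simp add: power2_eq_square sum_product mult_ac)
  also have "\<dots> = (\<Sum>j<m. \<Sum>k<m. \<Sum>a<m. (A a j * A a k) * (Z j * Z k))"
    by (subst sum.swap, rule sum.cong[OF refl], subst sum.swap, rule refl)
  also have "\<dots> = (\<Sum>j<m. \<Sum>k<m. gram j k * (Z j * Z k))"
    by (simp add: gram_def sum_distrib_right)
  also have "\<dots> = (\<Sum>j<m. \<Sum>k<m. if j = k then c * (Z j * Z k) else 0)"
    by (intro sum.cong refl) (auto simp: g)
  also have "\<dots> = c * zzt m Z"
    by (simp add: zzt_def sum_distrib_left power2_eq_square)
  finally show ?thesis by (simp add: c_def)
qed

lemma matrix_real:
  assumes m: "m \<ge> 3" and i: "i < m" "A i i \<noteq> 0" and aj: "a < m" "j < m"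
  shows "Im (A a j) = 0"
proof -
  have sq: "(\<Sum>b<m. A a b * A b i) = (if a = i then 1 else 0)" if "a < m" for a
  proof -
    have "(\<Sum>b<m. A a b * A b i) = lin m A (lin m A (evec i)) a"
      unfolding lin_evec[OF i(1)] using that by (simp add: lin_def)
    also have "\<dots> = evec i a"
      using i by (subst lin_invol) (auto simp: evec_def cvec_def)
    finally show ?thesis by (simp add: evec_def)
  qed
  \<comment> \<open>Entry (i,i) of A^t (A A) = (A^t A) A: the left product is A^t because A is an
    involution, the right one is \<open>gram 0 0\<close> times A.\<close>
  have "A i i = (\<Sum>a<m. A a i * (\<Sum>b<m. A a b * A b i))"
    using i by (simp add: sq if_distrib[of "\<lambda>x. _ * x"] cong: if_cong)
  also have "\<dots> = (\<Sum>b<m. \<Sum>a<m. A a i * (A a b * A b i))"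
    unfolding sum_distrib_left by (rule sum.swap)
  also have "\<dots> = (\<Sum>b<m. gram i b * A b i)"
    by (simp add: gram_def sum_distrib_right mult.assoc)
  also have "\<dots> = (\<Sum>b<m. if b = i then gram 0 0 * A b i else 0)"
    by (intro sum.cong refl) (use gram_diagonal[OF m i(1)] in auto)
  also have "\<dots> = gram 0 0 * A i i" using i by simp
  finally have "gram 0 0 = 1" using i by simp
  have e: "evec j \<in> cvec m" "\<And>i. Im (evec j i) = 0" using aj by (auto simp: evec_def cvec_def)
  have z1: "zzbar m (evec j) = 1" "zzt m (evec j) = 1"
    using aj by (simp_all add: zzbar_def zzt_def evec_def if_distrib[of cmod] if_distrib[of "\<lambda>x. x\<^sup>2"] cong: if_cong)
  have 1: "(\<Sum>a<m. (cmod (A a j))\<^sup>2) = 1"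
    using real_vector(1)[OF e] z1 aj by (simp add: lin_evec zzbar_def)
  have 2: "(\<Sum>a<m. (A a j)\<^sup>2) = 1"
    using zzt_lin[OF m, of "evec j"] z1 aj \<open>gram 0 0 = 1\<close> by (simp add: lin_evec zzt_def)
  \<comment> \<open>For any complex w, |w|^2 - Re(w^2) = 2 (Im w)^2, so the two normalisations of
    the column leave no imaginary parts.\<close>
  have "(\<Sum>a<m. 2 * (Im (A a j))\<^sup>2) = (\<Sum>a<m. (cmod (A a j))\<^sup>2) - Re (\<Sum>a<m. (A a j)\<^sup>2)"
    unfolding cmod_power2 Re_sum sum_subtractf[symmetric]
    by (intro sum.cong refl) (simp add: power2_eq_square)
  also have "\<dots> = 0" unfolding 1 2 by simp
  finally have "(\<Sum>a<m. 2 * (Im (A a j))\<^sup>2) = 0" .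
  then have "\<forall>a\<in>{..<m}. 2 * (Im (A a j))\<^sup>2 = 0"
    by (subst (asm) sum_nonneg_eq_0_iff) auto
  then show ?thesis using aj by simp
qed

end

section \<open>A criterion for minimality\<close>

lemma reflection_DIV: "Z \<in> DIV m \<Longrightarrow> Z(l := - Z l) \<in> DIV m"
proof -
  have "zzbar m (Z(l := - Z l)) = zzbar m Z" "zzt m (Z(l := - Z l)) = zzt m Z"
    by (auto simp: zzbar_def zzt_def intro!: sum.cong)
  moreover assume "Z \<in> DIV m"
  ultimately show ?thesis by (auto simp: DIV_def cvec_def)
qed

lemma curve_deriv_reflection:
  "curve_deriv m m U (\<lambda>Z. Z(l := - Z l)) Z (\<lambda>a j. if a = j then (if a = l then -1 else 1) else 0)"
  unfolding curve_deriv_def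
  by (auto simp: if_distrib[of "\<lambda>x. x * _"] intro!: derivative_eq_intros cong: if_cong)

text \<open>Points of the smaller domain already vanish at index m - 1, so the update that encodes
  (G, 0) changes nothing and both defining quantities are preserved.\<close>

lemma DIV_embed:
  assumes "Z \<in> DIV (m - 1)" "m > 0" shows "Z(m - 1 := 0) \<in> DIV m"
proof -
  obtain l where l: "m = Suc l" using assms(2) by (cases m) auto
  have Z: "Z \<in> cvec l" using assms l by (simp add: DIV_def)
  then have "Z(m - 1 := 0) = Z" by (auto simp: l cvec_def)
  moreover have "zzbar m Z = zzbar l Z" "zzt m Z = zzt l Z" "Z \<in> cvec m"
    using Z by (auto simp: l zzbar_def zzt_def cvec_def)
  ultimately show ?thesis using assms l by (simp add: DIV_def)
qed

theorem minimum_map_if_real_independent: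
  assumes m: "m \<ge> 3" and F0: "F (\<lambda>_. 0) = (\<lambda>_. 0)"
    and ind: "\<And>b :: nat \<Rightarrow> real. (\<And>z. z \<in> cball_n n \<Longrightarrow> (\<Sum>a<m. of_real (b a) * F z a) = 0) \<Longrightarrow>
      (\<And>a. a < m \<Longrightarrow> b a = 0)"
  shows "minimum_map n m F"
  unfolding minimum_map_def equiv_maps_def
proof (intro notI, elim exE conjE)
  fix G \<phi> \<psi>
  assume G: "holo_map n (m - 1) (cball_n n) (DIV (m - 1)) G" and \<psi>: "aut n (cball_n n) \<psi>"
    and \<phi>: "aut m (DIV m) \<phi>" and F: "\<forall>z\<in>cball_n n. F z = \<phi> ((G (\<psi> z))(m - 1 := 0))"
  define \<xi> where "\<xi> = inv_into (DIV m) \<phi>"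
  define \<sigma> where "\<sigma> = (\<lambda>Z :: nat \<Rightarrow> complex. Z(m - 1 := - Z (m - 1)))"
  define \<tau> where "\<tau> = (\<lambda>Z. \<phi> (\<sigma> (\<xi> Z)))"
  have bij: "bij_betw \<phi> (DIV m) (DIV m)" using \<phi> by (simp add: aut_def)
  have into: "\<phi> ` DIV m \<subseteq> DIV m" "\<xi> ` DIV m \<subseteq> DIV m"
    using bij_betw_imp_surj_on[OF bij] bij_betw_imp_surj_on[OF bij_betw_inv_into[OF bij]]
    by (simp_all add: \<xi>_def)
  have \<xi>\<phi>: "\<xi> (\<phi> Z) = Z" and \<phi>\<xi>: "\<phi> (\<xi> Z) = Z" if "Z \<in> DIV m" for Z
    using bij_betw_inv_into_left[OF bij that] bij_betw_inv_into_right[OF bij that] by (simp_all add: \<xi>_def)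
  have \<sigma>: "\<sigma> Z \<in> DIV m" if "Z \<in> DIV m" for Z unfolding \<sigma>_def using that by (rule reflection_DIV)
  have \<sigma>\<sigma>: "\<sigma> (\<sigma> Z) = Z" for Z by (auto simp: \<sigma>_def)
  have \<phi>h: "curve_holo m m (DIV m) \<phi>" and \<xi>h: "curve_holo m m (DIV m) \<xi>"
    using \<phi> curve_holo_if_holo_map by (auto simp: aut_def \<xi>_def)
  have \<sigma>d: "curve_deriv m m (DIV m) \<sigma> Z (\<lambda>a j. if a = j then (if a = m - 1 then -1 else 1) else 0)" for Z
    unfolding \<sigma>_def by (rule curve_deriv_reflection)
  then have \<sigma>h: "curve_holo m m (DIV m) \<sigma>" unfolding curve_holo_def by blast
  have \<sigma>\<xi>: "(\<lambda>Z. \<sigma> (\<xi> Z)) ` DIV m \<subseteq> DIV m" using into \<sigma> by blast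
  have \<tau>: "\<tau> ` DIV m \<subseteq> DIV m" unfolding \<tau>_def using into(1) \<sigma>\<xi> by (auto simp: image_subset_iff)
  have \<tau>h: "curve_holo m m (DIV m) \<tau>"
    unfolding \<tau>_def
    by (rule curve_holo_compose[OF _ \<phi>h \<sigma>\<xi>], rule curve_holo_compose[OF \<xi>h \<sigma>h into(2)])
  have \<tau>\<tau>: "\<tau> (\<tau> Z) = Z" if "Z \<in> DIV m" for Z
    using that into \<sigma> by (auto simp: \<tau>_def \<xi>\<phi> \<phi>\<xi> \<sigma>\<sigma> image_subset_iff)
  have \<tau>F: "\<tau> (F z) = F z" "F z \<in> DIV m" if z: "z \<in> cball_n n" for z
  proof -
    define Y where "Y = (G (\<psi> z))(m - 1 := 0)"
    have "\<psi> z \<in> cball_n n" using \<psi> z by (auto simp: aut_def bij_betw_def)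
    then have "G (\<psi> z) \<in> DIV (m - 1)" using G by (auto simp: holo_map_def)
    then have Y: "Y \<in> DIV m" unfolding Y_def using m by (intro DIV_embed) auto
    have "\<sigma> Y = Y" by (auto simp: \<sigma>_def Y_def)
    moreover have "F z = \<phi> Y" using F z by (simp add: Y_def)
    ultimately show "\<tau> (F z) = F z" "F z \<in> DIV m"
      using Y into by (auto simp: \<tau>_def \<xi>\<phi>)
  qed
  have zero: "(\<lambda>_. 0) \<in> cball_n n" by (simp add: cball_n_def cvec_def)
  have \<tau>0: "\<tau> (\<lambda>_. 0) = (\<lambda>_. 0)" using \<tau>F(1)[OF zero] F0 by simp
  define o0 P where "o0 = (\<lambda>_::nat. 0::complex)" and "P = \<xi> o0"
  have o0: "o0 \<in> DIV m" and PD: "P \<in> DIV m" using into by (auto simp: o0_def P_def)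
  have "\<sigma> P = P"
  proof -
    have "\<phi> (\<sigma> P) = \<phi> P" using \<tau>0 \<phi>\<xi>[OF o0] by (simp add: \<tau>_def P_def o0_def)
    then show ?thesis using \<xi>\<phi> \<sigma> PD by metis
  qed
  obtain B where B: "curve_deriv m m (DIV m) \<phi> P B"
    using \<phi>h PD unfolding curve_holo_def by blast
  obtain C where C: "curve_deriv m m (DIV m) \<xi> o0 C"
    using \<xi>h o0 unfolding curve_holo_def by blast
  define s :: "nat \<Rightarrow> complex" where "s b = (if b = m - 1 then -1 else 1)" for b
  \<comment> \<open>The derivative of \<tau> at 0 by the chain rule: the diagonal matrix of the
    reflection between the derivatives of \<phi> and its inverse.\<close>
  define A where "A = (\<lambda>a j. \<Sum>b<m. B a b * (s b * C b j))"
  have "curve_deriv m m (DIV m) (\<lambda>Z. \<sigma> (\<xi> Z)) o0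
      (\<lambda>a j. \<Sum>b<m. (if a = b then (if a = m - 1 then -1 else 1) else 0) * C b j)"
    by (rule curve_deriv_compose[OF C \<sigma>d into(2)])
  then have "curve_deriv m m (DIV m) (\<lambda>Z. \<sigma> (\<xi> Z)) o0 (\<lambda>a j. s a * C a j)"
    by (rule curve_deriv_cong) (simp add: s_def if_distrib[of "\<lambda>x. x * _"] cong: if_cong)
  from curve_deriv_compose[OF this _ \<sigma>\<xi>, of m \<phi> B]
  have Ad: "curve_deriv m m (DIV m) \<tau> (\<lambda>_. 0) A"
    unfolding A_def \<tau>_def using B \<open>\<sigma> P = P\<close> by (simp add: o0_def P_def)
  \<comment> \<open>The product is needed in this order: cycling the trace of B s C brings C in
    front of B.\<close>
  have CB: "(\<Sum>b<m. C a b * B b j) = (if a = j then 1 else 0)" if "a < m" "j < m" for a j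
  proof (rule curve_deriv_of_identity[OF _ PD _ that])
    have "\<phi> P = o0" using \<phi>\<xi>[OF o0] by (simp add: P_def)
    then show "curve_deriv m m (DIV m) (\<lambda>Z. \<xi> (\<phi> Z)) P (\<lambda>a j. \<Sum>b<m. C a b * B b j)"
      using C by (intro curve_deriv_compose[OF B _ into(1)]) simp
    show "\<xi> (\<phi> Y) = Y" if "Y \<in> DIV m" for Y using \<xi>\<phi>[OF that] .
  qed
  have "(\<Sum>a<m. A a a) = (\<Sum>b<m. s b * (\<Sum>a<m. C b a * B a b))"
    unfolding A_def sum_distrib_left by (subst sum.swap) (simp add: mult_ac)
  also have "\<dots> = (\<Sum>b<m. s b)" by (simp add: CB)
  also have "\<dots> = of_nat (m - 2)"
  proof -
    define l where "l = m - 2"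
    have "m = Suc (Suc l)" using m by (simp add: l_def)
    then show ?thesis by (simp add: s_def)
  qed
  finally have "(\<Sum>a<m. A a a) = of_nat (m - 2)" .
  moreover have "(of_nat (m - 2) :: complex) \<noteq> 0"
    unfolding of_nat_eq_0_iff using m by simp
  ultimately have "(\<Sum>a<m. A a a) \<noteq> 0" by (simp only: not_False_eq_True)
  then obtain i where i: "i < m" "A i i \<noteq> 0"
    by (meson lessThan_iff sum.neutral)
  have lin: "\<tau> Z a = (\<Sum>j<m. A a j * Z j)" if "Z \<in> DIV m" "a < m" for Z a
    using involution_fixing_zero_linear[OF \<tau> \<tau>0 \<tau>h \<tau>\<tau> Ad that] .
  have lin_\<tau>: "lin m A Z = \<tau> Z" if "Z \<in> DIV m" for Z
  proof
    fix a
    have "\<tau> Z \<in> cvec m" using \<tau> that by (intro DIV_cvec) blast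
    then show "lin m A Z a = \<tau> Z a" using lin[OF that] by (auto simp: lin_def cvec_def)
  qed
  interpret linear_involution m A
  proof
    show "lin m A Z \<in> DIV m" if "Z \<in> DIV m" for Z using that \<tau> lin_\<tau> by auto
    show "lin m A (lin m A Z) = Z" if "Z \<in> DIV m" for Z
      using that \<tau> lin_\<tau> \<tau>\<tau> by (metis image_subset_iff)
  qed
  have Aid: "A a j = (if j = a then 1 else 0)" if a: "a < m" and j: "j < m" for a j
  proof -
    define b where "b j = Re (A a j) - (if j = a then 1 else 0)" for j
    have bA: "of_real (b j) = A a j - (if j = a then 1 else 0)" if "j < m" for j
      using matrix_real[OF m i a that] by (simp add: b_def complex_eq_iff)
    have "(\<Sum>j<m. of_real (b j) * F z j) = 0" if z: "z \<in> cball_n n" for z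
    proof -
      have "(\<Sum>j<m. of_real (b j) * F z j) = (\<Sum>j<m. A a j * F z j) - (\<Sum>j<m. if j = a then F z j else 0)"
        unfolding sum_subtractf[symmetric] by (intro sum.cong refl) (simp add: bA algebra_simps)
      also have "\<dots> = \<tau> (F z) a - F z a" using lin[OF \<tau>F(2)[OF z] a] a by simp
      finally show ?thesis using \<tau>F(1)[OF z] by simp
    qed
    then have "b j = 0" using ind j by blast
    then show ?thesis using bA[OF j] by simp
  qed
  have \<tau>id: "\<tau> Z = Z" if Z: "Z \<in> DIV m" for Z
  proof
    fix a
    show "\<tau> Z a = Z a"
    proof (cases "a < m")
      case True
      have "(\<Sum>j<m. A a j * Z j) = (\<Sum>j<m. if j = a then Z j else 0)"
        using True by (intro sum.cong refl) (simp add: Aid)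
      then show ?thesis using lin[OF Z True] True by simp
    next
      case False
      have "\<tau> Z \<in> DIV m" using \<tau> Z by blast
      then show ?thesis using Z False by (simp add: DIV_def cvec_def)
    qed
  qed
  \<comment> \<open>A point of the domain with nonzero last coordinate, so the reflection moves it;
    the factor 1/2 puts it into the unit ball.\<close>
  define Y where "Y = (\<lambda>i. (1/2) * evec (m - 1) i)"
  have YD: "Y \<in> DIV m"
  proof (rule small_in_DIV)
    show "Y \<in> cvec m" using m by (auto simp: Y_def cvec_def evec_def)
    have "zzbar m (evec (m - 1)) = 1"
      using m by (simp add: zzbar_def evec_def if_distrib[of cmod] if_distrib[of "\<lambda>x. x\<^sup>2"] cong: if_cong)
    then show "cnorm m Y < 1" unfolding Y_def cnorm_scale by (simp add: cnorm_def zzbar_def)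
  qed
  have "\<phi> (\<sigma> Y) = \<phi> Y" using \<tau>id[of "\<phi> Y"] YD into by (auto simp: \<tau>_def \<xi>\<phi>)
  then have "\<sigma> Y = Y" using \<xi>\<phi> \<sigma> YD by metis
  then have "\<sigma> Y (m - 1) = Y (m - 1)" by simp
  then show False by (simp add: \<sigma>_def Y_def evec_def)
qed

section \<open>Maps built from rotated coordinate pairs\<close>

text \<open>The common shape of all the families: p rotated pairs, the plain coordinates with
  indices from p to r - 1 shifted by the p extra slots, and two tails. A family with a single tail
  has t1 = 0, and its target dimension then ends before that slot.\<close>

definition pair_map :: "(nat \<Rightarrow> real) \<Rightarrow> nat \<Rightarrow> nat \<Rightarrow> ((nat \<Rightarrow> complex) \<Rightarrow> complex)
    \<Rightarrow> ((nat \<Rightarrow> complex) \<Rightarrow> complex) \<Rightarrow> (nat \<Rightarrow> complex) \<Rightarrow> nat \<Rightarrow> complex" where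
  "pair_map th p r t0 t1 z q =
    (if q < 2 * p then pairblock th z q
     else if q < p + r then z (q - p)
     else if q = p + r then t0 z
     else if q = p + r + 1 then t1 z
     else 0)"

text \<open>The contribution of the pairs and the plain coordinates to F F^t: each pair gives cos^2
  - sin^2 = cos(2 th) times a square.\<close>

definition quad :: "(nat \<Rightarrow> real) \<Rightarrow> nat \<Rightarrow> nat \<Rightarrow> (nat \<Rightarrow> complex) \<Rightarrow> complex" where
  "quad th p r z = (\<Sum>j<p. complex_of_real (cos (2 * th j)) * (z j)\<^sup>2) + (\<Sum>j\<in>{p..<r}. (z j)\<^sup>2)"

lemma sum_lessThan_double:
  fixes f :: "nat \<Rightarrow> 'a :: comm_monoid_add"
  shows "(\<Sum>q<2 * p. f q) = (\<Sum>j<p. f (2 * j) + f (2 * j + 1))"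
  by (induction p) (simp_all add: add.assoc)

lemma sum_pairs:
  fixes f :: "nat \<Rightarrow> 'a :: comm_monoid_add"
  assumes "p \<le> r"
  shows "(\<Sum>q<p + r. f q) = (\<Sum>j<p. f (2 * j) + f (2 * j + 1)) + (\<Sum>j\<in>{p..<r}. f (j + p))"
proof -
  have "{..<p + r} = {..<2 * p} \<union> {p + p..<r + p}" "{..<2 * p} \<inter> {p + p..<r + p} = {}"
    using assms by auto
  then have "(\<Sum>q<p + r. f q) = (\<Sum>q<2 * p. f q) + (\<Sum>q\<in>{p + p..<r + p}. f q)"
    by (simp add: sum.union_disjoint)
  then show ?thesis
    by (simp add: sum_lessThan_double sum.shift_bounds_nat_ivl)
qed

lemma sum_atLeastLessThan_split:
  fixes f :: "nat \<Rightarrow> 'a :: comm_monoid_add"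
  assumes "p \<le> r" shows "(\<Sum>j<r. f j) = (\<Sum>j<p. f j) + (\<Sum>j\<in>{p..<r}. f j)"
proof -
  have "{..<r} = {..<p} \<union> {p..<r}" "{..<p} \<inter> {p..<r} = {}" using assms by auto
  then show ?thesis by (simp add: sum.union_disjoint)
qed

lemma half_evec_in_ball: "j < n \<Longrightarrow> (\<lambda>i. (1/2) * evec j i) \<in> cball_n n"
proof -
  assume j: "j < n"
  have "(\<Sum>i<n. (cmod ((1/2) * evec j i))\<^sup>2) = (\<Sum>i<n. if i = j then 1/4 else 0)"
    by (intro sum.cong refl) (simp add: evec_def power2_eq_square)
  then show ?thesis using j by (simp add: cball_n_def cvec_def evec_def)
qed

text \<open>The assumption \<open>polar\<close> is what the polarised identity requires of the tails
  once the pairs and plain coordinates have been summed. For r = n the tails must cancel; for r = n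
  - 1 they must supply the missing last coordinate.\<close>

locale pair_map_data =
  fixes n m p r :: nat and th :: "nat \<Rightarrow> real" and t0 t1 :: "(nat \<Rightarrow> complex) \<Rightarrow> complex"
  assumes pr: "p \<le> r" and rn: "r \<le> n"
    and m_cases: "m = p + r + 2 \<or> (m = p + r + 1 \<and> t1 = (\<lambda>_. 0))"
    and diff0: "z \<in> cball_n n \<Longrightarrow> scalar_diff n (cball_n n) t0 z"
    and diff1: "z \<in> cball_n n \<Longrightarrow> scalar_diff n (cball_n n) t1 z"
    and zero0: "t0 (\<lambda>_. 0) = 0" and zero1: "t1 (\<lambda>_. 0) = 0"
    and polar: "\<lbrakk>z \<in> cball_n n; w \<in> cball_n n\<rbrakk> \<Longrightarrow>
      (\<Sum>j<r. z j * cnj (w j)) + t0 z * cnj (t0 w) + t1 z * cnj (t1 w)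
        - (quad th p r z + (t0 z)\<^sup>2 + (t1 z)\<^sup>2) * cnj (quad th p r w + (t0 w)\<^sup>2 + (t1 w)\<^sup>2) / 4
      = (\<Sum>j<n. z j * cnj (w j))"
begin

abbreviation F :: "(nat \<Rightarrow> complex) \<Rightarrow> nat \<Rightarrow> complex" where
  "F \<equiv> pair_map th p r t0 t1"

lemma F_simps:
  "j < p \<Longrightarrow> F z (2 * j) = complex_of_real (cos (th j)) * z j"
  "j < p \<Longrightarrow> F z (2 * j + 1) = \<i> * complex_of_real (sin (th j)) * z j"
  "p \<le> j \<Longrightarrow> j < r \<Longrightarrow> F z (j + p) = z j"
  "F z (p + r) = t0 z" "F z (p + r + 1) = t1 z" "F z (Suc (p + r)) = t1 z"
  using pr by (auto simp: pair_map_def pairblock_def)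

text \<open>Both tail slots can be written even when the target has only one, provided the summand
  in the absent slot is 0; this spares a case distinction in every later sum.\<close>

lemma sum_F:
  fixes f :: "nat \<Rightarrow> complex"
  assumes "(\<And>z. t1 z = 0) \<Longrightarrow> f (p + r + 1) = 0"
  shows "(\<Sum>a<m. f a) = (\<Sum>j<p. f (2 * j) + f (2 * j + 1)) + (\<Sum>j\<in>{p..<r}. f (j + p))
      + f (p + r) + f (p + r + 1)"
  using m_cases
proof
  assume "m = p + r + 2"
  then have "m = Suc (Suc (p + r))" by simp
  then show ?thesis by (simp only: sum.lessThan_Suc sum_pairs[OF pr]) simp
next
  assume "m = p + r + 1 \<and> t1 = (\<lambda>_. 0)"
  then have "m = Suc (p + r)" "f (p + r + 1) = 0" using assms by simp_all
  then show ?thesis by (simp only: sum.lessThan_Suc sum_pairs[OF pr]) simp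
qed

lemma sum_F_cnj: "(\<Sum>a<m. F z a * cnj (F w a)) =
    (\<Sum>j<r. z j * cnj (w j)) + t0 z * cnj (t0 w) + t1 z * cnj (t1 w)"
proof -
  have "(\<Sum>a<m. F z a * cnj (F w a)) = (\<Sum>j<p. F z (2 * j) * cnj (F w (2 * j)) + F z (2 * j + 1) * cnj (F w (2 * j + 1)))
      + (\<Sum>j\<in>{p..<r}. F z (j + p) * cnj (F w (j + p))) + t0 z * cnj (t0 w) + t1 z * cnj (t1 w)"
    by (subst sum_F) (auto simp: F_simps)
  also have "(\<Sum>j<p. F z (2 * j) * cnj (F w (2 * j)) + F z (2 * j + 1) * cnj (F w (2 * j + 1)))
      = (\<Sum>j<p. z j * cnj (w j))"
  proof (intro sum.cong refl)
    fix j assume "j \<in> {..<p}"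
    then have j: "j < p" by simp
    define C S where "C = complex_of_real (cos (th j))" and "S = complex_of_real (sin (th j))"
    have "C * C + S * S = of_real ((cos (th j))\<^sup>2 + (sin (th j))\<^sup>2)"
      by (simp only: C_def S_def of_real_add of_real_mult power2_eq_square)
    then have CS: "C * C + S * S = 1" by simp
    have "F z (2 * j) * cnj (F w (2 * j)) + F z (2 * j + 1) * cnj (F w (2 * j + 1))
        = (C * C + S * S) * (z j * cnj (w j))"
      unfolding F_simps(1,2)[OF j] C_def S_def by (simp add: algebra_simps del: sin_cos_squared_add3)
    then show "F z (2 * j) * cnj (F w (2 * j)) + F z (2 * j + 1) * cnj (F w (2 * j + 1)) = z j * cnj (w j)"
      by (simp add: CS)
  qed
  also have "(\<Sum>j\<in>{p..<r}. F z (j + p) * cnj (F w (j + p))) = (\<Sum>j\<in>{p..<r}. z j * cnj (w j))"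
    by (intro sum.cong refl) (simp add: F_simps)
  finally show ?thesis by (simp add: sum_atLeastLessThan_split[OF pr])
qed

lemma zzt_F: "zzt m (F z) = quad th p r z + (t0 z)\<^sup>2 + (t1 z)\<^sup>2"
proof -
  have "zzt m (F z) = (\<Sum>j<p. (F z (2 * j))\<^sup>2 + (F z (2 * j + 1))\<^sup>2)
      + (\<Sum>j\<in>{p..<r}. (F z (j + p))\<^sup>2) + (t0 z)\<^sup>2 + (t1 z)\<^sup>2"
    unfolding zzt_def by (subst sum_F) (auto simp: F_simps)
  also have "(\<Sum>j<p. (F z (2 * j))\<^sup>2 + (F z (2 * j + 1))\<^sup>2) = (\<Sum>j<p. complex_of_real (cos (2 * th j)) * (z j)\<^sup>2)"
  proof (intro sum.cong refl)
    fix j assume "j \<in> {..<p}"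
    then have j: "j < p" by simp
    show "(F z (2 * j))\<^sup>2 + (F z (2 * j + 1))\<^sup>2 = complex_of_real (cos (2 * th j)) * (z j)\<^sup>2"
      unfolding F_simps(1,2)[OF j] cos_double by (simp add: power_mult_distrib algebra_simps)
  qed
  also have "(\<Sum>j\<in>{p..<r}. (F z (j + p))\<^sup>2) = (\<Sum>j\<in>{p..<r}. (z j)\<^sup>2)"
    by (intro sum.cong refl) (simp add: F_simps)
  finally show ?thesis by (simp add: quad_def)
qed

lemma F_polar:
  assumes "z \<in> cball_n n" "w \<in> cball_n n"
  shows "(\<Sum>a<m. F z a * cnj (F w a)) - zzt m (F z) * cnj (zzt m (F w)) / 4 = (\<Sum>j<n. z j * cnj (w j))"
  unfolding sum_F_cnj zzt_F using polar[OF assms] .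

text \<open>On the diagonal of the polarised identity the defining function at F(z) becomes 1 -
  |z|^2.\<close>

lemma F_norm:
  assumes "z \<in> cball_n n"
  shows "1 - zzbar m (F z) + (cmod (zzt m (F z)))\<^sup>2 / 4 > 0"
proof -
  have "complex_of_real (zzbar m (F z) - (cmod (zzt m (F z)))\<^sup>2 / 4) = complex_of_real (zzbar n z)"
    using F_polar[OF assms assms] by (simp add: zzbar_complex complex_norm_square flip: of_real_power)
  then have "zzbar m (F z) - (cmod (zzt m (F z)))\<^sup>2 / 4 = zzbar n z" unfolding of_real_eq_iff .
  moreover have "zzbar n z < 1" using assms by (simp add: cball_n_def zzbar_def)
  ultimately show ?thesis by linarith
qed

lemma F_frechet:
  assumes z: "z \<in> cball_n n" shows "\<exists>A. frechet_deriv n m (cball_n n) F z A"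
proof (rule frechet_deriv_exists)
  fix a
  have sd: "scalar_diff n (cball_n n) (\<lambda>z. c * z j) z" if "j < r" for c j
    using that rn by (intro scalar_diff_cmult scalar_diff_coord) auto
  consider "a < 2 * p" | "2 * p \<le> a" "a < p + r" | "a = p + r" | "a = p + r + 1" | "a > p + r + 1"
    using pr by linarith
  then show "scalar_diff n (cball_n n) (\<lambda>z. F z a) z"
  proof cases
    case 1
    then have "a div 2 < r" using pr by auto
    then show ?thesis using 1 by (cases "even a") (auto simp: pair_map_def pairblock_def intro!: sd)
  next
    case 2
    then have "a - p < r" by auto
    then show ?thesis using sd[of "a - p" 1] 2 by (simp add: pair_map_def)
  next
    case 3
    then show ?thesis using diff0[OF z] F_simps(4) by simp
  next
    case 4
    then show ?thesis using diff1[OF z] F_simps(5) by simp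
  next
    case 5
    then show ?thesis using pr by (simp add: pair_map_def scalar_diff_const)
  qed
qed

lemma F_curve_holo: "curve_holo n m (cball_n n) F"
  unfolding curve_holo_def using F_frechet curve_deriv_if_frechet_deriv by blast

lemma F_zero: "F (\<lambda>_. 0) = (\<lambda>_. 0)"
  by (auto simp: pair_map_def pairblock_def zero0 zero1)

lemma F_cvec: "F z \<in> cvec m"
  using m_cases pr by (auto simp: cvec_def pair_map_def)

text \<open>On the set where the defining function is positive, \<open>|Z|\<^sup>2 = 2\<close> is impossible, so
  \<open>|F|\<^sup>2 < 2\<close> propagates from the origin along segments.\<close>

lemma F_DIV:
  assumes z: "z \<in> cball_n n" shows "F z \<in> DIV m"
proof -
  define S where "S = {\<zeta>. (\<lambda>i. \<zeta> * z i) \<in> cball_n n}"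
  have S_eq: "S = {\<zeta>. (cmod \<zeta>)\<^sup>2 * zzbar n z < 1}"
    using z by (auto simp: S_def cball_n_def cvec_def zzbar_def norm_mult power_mult_distrib sum_distrib_left)
  have "open S" unfolding S_eq by (intro open_Collect_less continuous_intros)
  have hol: "(\<lambda>\<zeta>. F (\<lambda>i. \<zeta> * z i) a) holomorphic_on S" if "a < m" for a
    by (rule curve_holo_slice[OF F_curve_holo \<open>open S\<close> _ _ that])
      (auto simp: S_def intro!: holomorphic_intros)
  have seg: "complex_of_real t \<in> S" if "0 \<le> t" "t \<le> 1" for t
  proof -
    have "t\<^sup>2 * zzbar n z \<le> 1 * zzbar n z"
      using that by (intro mult_right_mono) (auto simp: power_le_one)
    also have "\<dots> < 1" using z by (simp add: cball_n_def zzbar_def)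
    finally show ?thesis using that by (simp add: S_eq)
  qed
  define h where "h t = zzbar m (F (\<lambda>i. complex_of_real t * z i))" for t
  have "continuous_on {0..1} (\<lambda>t. F (\<lambda>i. complex_of_real t * z i) a)" if "a < m" for a
  proof (rule continuous_on_compose2[OF holomorphic_on_imp_continuous_on[OF hol[OF that]]])
    show "complex_of_real ` {0..1} \<subseteq> S" using seg by auto
  qed (intro continuous_intros)
  then have cont: "continuous_on {0..1} h"
    unfolding h_def zzbar_def by (intro continuous_intros) auto
  have "h 1 < 2"
  proof (rule ccontr)
    assume "\<not> h 1 < 2"
    moreover have "h 0 = 0" by (simp add: h_def F_zero zzbar_def)
    ultimately obtain t where t: "0 \<le> t" "t \<le> 1" "h t = 2"
      using IVT'[of h 0 2 1] cont by auto
    let ?Z = "F (\<lambda>i. complex_of_real t * z i)"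
    have "1 - zzbar m ?Z + (cmod (zzt m ?Z))\<^sup>2 / 4 > 0"
      using F_norm seg[OF t(1,2)] by (simp add: S_def)
    \<comment> \<open>With |Z|^2 = 2 this bounds the defining function by 1 - 2 + 1 = 0, against its
      positivity.\<close>
    moreover have "(cmod (zzt m ?Z))\<^sup>2 \<le> 2\<^sup>2"
      using cmod_zzt_le[of m ?Z] t(3) by (intro power_mono) (auto simp: h_def)
    ultimately show False using t(3) by (simp add: h_def)
  qed
  then show ?thesis using F_norm[OF z] F_cvec by (simp add: DIV_def h_def)
qed

theorem F_isometry: "holo_isometry n m F"
proof (rule holo_isometry_if_polarised_identity)
  show "holo_map n m (cball_n n) (DIV m) F"
    unfolding holo_map_frechet using F_DIV F_frechet by auto
  show "m > 0" using m_cases by auto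
qed (rule F_polar)

lemma F_minimum:
  assumes m: "m \<ge> 3" and angle: "\<And>j. j < p \<Longrightarrow> th j \<in> {0<..pi/4}"
    and tail: "\<And>c \<beta>0 \<beta>1. (\<And>z. z \<in> cball_n n \<Longrightarrow>
        (\<Sum>j<r. c j * z j) + complex_of_real \<beta>0 * t0 z + complex_of_real \<beta>1 * t1 z = 0) \<Longrightarrow>
      \<beta>0 = 0 \<and> (t1 \<noteq> (\<lambda>_. 0) \<longrightarrow> \<beta>1 = 0)"
    and m_t1: "m = p + r + 2 \<Longrightarrow> t1 \<noteq> (\<lambda>_. 0)"
  shows "minimum_map n m F"
proof (rule minimum_map_if_real_independent)
  show "m \<ge> 3" "F (\<lambda>_. 0) = (\<lambda>_. 0)" using m F_zero by auto
next
  fix b :: "nat \<Rightarrow> real" and a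
  assume rel: "\<And>z. z \<in> cball_n n \<Longrightarrow> (\<Sum>a<m. of_real (b a) * F z a) = 0" and a: "a < m"
  define c where "c j = (if j < p then of_real (b (2 * j)) * of_real (cos (th j))
      + of_real (b (2 * j + 1)) * (\<i> * of_real (sin (th j))) else complex_of_real (b (j + p)))" for j
  have rel': "(\<Sum>j<r. c j * z j) + complex_of_real (b (p + r)) * t0 z + complex_of_real (b (p + r + 1)) * t1 z = 0"
    if "z \<in> cball_n n" for z
  proof -
    have "(\<Sum>a<m. of_real (b a) * F z a) =
       (\<Sum>j<p. of_real (b (2 * j)) * F z (2 * j) + of_real (b (2 * j + 1)) * F z (2 * j + 1))
      + (\<Sum>j\<in>{p..<r}. of_real (b (j + p)) * F z (j + p)) + of_real (b (p + r)) * t0 z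
      + of_real (b (p + r + 1)) * t1 z"
      by (subst sum_F) (auto simp: F_simps)
    also have "(\<Sum>j<p. of_real (b (2 * j)) * F z (2 * j) + of_real (b (2 * j + 1)) * F z (2 * j + 1)) = (\<Sum>j<p. c j * z j)"
    proof (intro sum.cong refl)
      fix j assume "j \<in> {..<p}"
      then have j: "j < p" by simp
      show "of_real (b (2 * j)) * F z (2 * j) + of_real (b (2 * j + 1)) * F z (2 * j + 1) = c j * z j"
        unfolding F_simps(1,2)[OF j] using j by (simp add: c_def algebra_simps)
    qed
    also have "(\<Sum>j\<in>{p..<r}. of_real (b (j + p)) * F z (j + p)) = (\<Sum>j\<in>{p..<r}. c j * z j)"
      by (intro sum.cong refl) (simp add: F_simps c_def)
    finally show ?thesis using rel[OF that] by (simp add: sum_atLeastLessThan_split[OF pr])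
  qed
  have b0: "b (p + r) = 0" and b1: "t1 \<noteq> (\<lambda>_. 0) \<Longrightarrow> b (p + r + 1) = 0"
    using tail[OF rel'] by auto
  have "complex_of_real (b (p + r + 1)) * t1 z = 0" for z
    using b1 by (cases "t1 = (\<lambda>_. 0)") auto
  with rel' b0 have lin: "(\<Sum>j<r. c j * z j) = 0" if "z \<in> cball_n n" for z
    using that by (metis add.right_neutral mult_zero_left of_real_0)
  \<comment> \<open>Evaluation at half a basis vector, which lies in the ball.\<close>
  have c0: "c j = 0" if j: "j < r" for j
  proof -
    have "(\<Sum>i<r. c i * ((1/2) * evec j i)) = 0"
      using lin[OF half_evec_in_ball] j rn by simp
    then have "(\<Sum>i<r. (c i * (1/2)) * evec j i) = 0" by (simp only: mult.assoc)
    then show ?thesis unfolding sum_evec[OF j] by simp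
  qed
  have pair: "b (2 * j) = 0 \<and> b (2 * j + 1) = 0" if j: "j < p" for j
  proof -
    have "0 < th j" "th j \<le> pi / 4" using angle[OF j] by auto
    then have "cos (th j) > 0" "sin (th j) > 0"
      using pi_gt_zero by (auto intro!: cos_gt_zero sin_gt_zero)
    moreover have "complex_of_real (b (2 * j) * cos (th j)) + \<i> * of_real (b (2 * j + 1) * sin (th j)) = 0"
      using c0[of j] j pr by (simp add: c_def algebra_simps)
    ultimately show ?thesis by (simp add: complex_eq_iff)
  qed
  consider "a < 2 * p" | "2 * p \<le> a" "a < p + r" | "a = p + r" | "a = p + r + 1" "m = p + r + 2"
    using a m_cases by linarith
  then show "b a = 0"
  proof cases
    case 1
    then show ?thesis using pair[of "a div 2"] by (cases "even a") auto
  next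
    case 2
    then have "a - p < r" "\<not> a - p < p" "a - p + p = a" by auto
    then show ?thesis using c0[of "a - p"] by (simp add: c_def)
  next
    case 3
    then show ?thesis using b0 by simp
  next
    case 4
    then show ?thesis using b1 m_t1 by simp
  qed
qed

end

text \<open>An even tail is separated from the linear part by replacing \<open>z\<close> with \<open>-z\<close>.\<close>

lemma even_tail_relation:
  assumes rel: "\<And>z. z \<in> cball_n n \<Longrightarrow>
        (\<Sum>j<r. c j * z j) + complex_of_real \<beta>0 * t0 z + complex_of_real \<beta>1 * t1 z = 0"
    and even: "\<And>z. t0 (\<lambda>i. - z i) = t0 z" "\<And>z. t1 (\<lambda>i. - z i) = t1 z" and z: "z \<in> cball_n n"
  shows "complex_of_real \<beta>0 * t0 z + complex_of_real \<beta>1 * t1 z = 0"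
proof -
  have "(\<lambda>i. - z i) \<in> cball_n n" using z by (simp add: cball_n_def cvec_def)
  from rel[OF this] have "- (\<Sum>j<r. c j * z j) + complex_of_real \<beta>0 * t0 z + complex_of_real \<beta>1 * t1 z = 0"
    by (simp add: even sum_negf)
  moreover have "2 * (complex_of_real \<beta>0 * t0 z + complex_of_real \<beta>1 * t1 z) =
      ((\<Sum>j<r. c j * z j) + complex_of_real \<beta>0 * t0 z + complex_of_real \<beta>1 * t1 z)
      + (- (\<Sum>j<r. c j * z j) + complex_of_real \<beta>0 * t0 z + complex_of_real \<beta>1 * t1 z)"
    by simp
  ultimately have "2 * (complex_of_real \<beta>0 * t0 z + complex_of_real \<beta>1 * t1 z) = 0"
    unfolding rel[OF z] by (simp only: add_0_left)
  then show ?thesis unfolding mult_eq_0_iff by simp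
qed

section \<open>The quadratic form of the pair and plain coordinates on the ball\<close>

lemma scalar_diff_quad:
  assumes "p \<le> r" "r \<le> n" shows "scalar_diff n U (quad th p r) z"
  unfolding quad_def[abs_def]
  by (intro scalar_diff_add scalar_diff_sum scalar_diff_cmult scalar_diff_power2 scalar_diff_coord)
    (use assms in auto)

lemma quad_zero: "quad th p r (\<lambda>_. 0) = 0"
  by (simp add: quad_def)

lemma quad_even: "quad th p r (\<lambda>i. - z i) = quad th p r z"
  by (simp add: quad_def)

text \<open>All coefficients have modulus at most 1. The bound keeps the radicands of the square
  root tails in the right half plane, where \<open>csqrt\<close> is holomorphic.\<close>

lemma cmod_quad_less_1:
  assumes pr: "p \<le> r" "r \<le> n" and z: "z \<in> cball_n n" shows "cmod (quad th p r z) < 1"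
proof -
  have "cmod (quad th p r z) \<le> (\<Sum>j<p. (cmod (z j))\<^sup>2) + (\<Sum>j\<in>{p..<r}. (cmod (z j))\<^sup>2)"
    unfolding quad_def
  proof (intro order_trans[OF norm_triangle_ineq] add_mono order_trans[OF norm_sum] sum_mono)
    fix j
    show "cmod (complex_of_real (cos (2 * th j)) * (z j)\<^sup>2) \<le> (cmod (z j))\<^sup>2"
      using abs_cos_le_one[of "2 * th j"] mult_right_mono[of "\<bar>cos (2 * th j)\<bar>" 1 "(cmod (z j))\<^sup>2"]
      by (simp add: norm_mult norm_power)
  qed (simp add: norm_power)
  also have "\<dots> = (\<Sum>j<r. (cmod (z j))\<^sup>2)"
    by (rule sum_atLeastLessThan_split[OF pr(1), symmetric])
  also have "\<dots> \<le> (\<Sum>j<n. (cmod (z j))\<^sup>2)"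
    using pr by (intro sum_mono2) auto
  also have "\<dots> < 1" using z by (simp add: cball_n_def)
  finally show ?thesis .
qed

lemma cos_double_pos: "\<theta> \<in> {0<..<pi/4} \<Longrightarrow> 0 < cos (2 * \<theta>)"
  by (intro cos_gt_zero) auto

text \<open>A plain coordinate has coefficient 1, and an angle below pi/4 has cos(2 th) > 0. With
  neither available the form would vanish identically, since cos(pi/2) = 0; this is where the
  condition on the angles enters minimality.\<close>

lemma quad_nonzero:
  assumes pr: "p \<le> r" "r \<le> n" and angle: "\<And>j. j < p \<Longrightarrow> th j \<in> {0<..pi/4}"
    and "p < r \<or> (\<exists>j<p. th j \<noteq> pi/4)"
  obtains z where "z \<in> cball_n n" "quad th p r z \<noteq> 0"
  using assms(4)
proof
  assume "p < r"
  let ?z = "\<lambda>i. (1/2) * evec p i"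
  have "(\<Sum>j\<in>{p..<r}. (?z j)\<^sup>2) = (\<Sum>j\<in>{p..<r}. if j = p then 1/4 else 0)"
    by (intro sum.cong refl) (simp add: evec_def power2_eq_square)
  also have "\<dots> = 1/4" using \<open>p < r\<close> by simp
  finally have eq: "quad th p r ?z = 1/4" by (simp add: quad_def evec_def)
  have nz: "quad th p r ?z \<noteq> 0" unfolding eq by simp
  show thesis by (rule that[OF half_evec_in_ball nz]) (use \<open>p < r\<close> pr in simp)
next
  assume "\<exists>j<p. th j \<noteq> pi/4"
  then obtain k where k: "k < p" "th k \<noteq> pi/4" by blast
  then have "0 < cos (2 * th k)" using angle[OF k(1)] by (intro cos_double_pos) auto
  let ?z = "\<lambda>i. (1/2) * evec k i"
  have "(\<Sum>j<p. complex_of_real (cos (2 * th j)) * (?z j)\<^sup>2)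
      = (\<Sum>j<p. if j = k then complex_of_real (cos (2 * th k)) / 4 else 0)"
    by (intro sum.cong refl) (simp add: evec_def power2_eq_square)
  also have "\<dots> = complex_of_real (cos (2 * th k)) / 4" using k by simp
  finally have eq: "quad th p r ?z = complex_of_real (cos (2 * th k)) / 4"
    using k by (simp add: quad_def evec_def)
  have nz: "quad th p r ?z \<noteq> 0" unfolding eq using \<open>0 < cos (2 * th k)\<close> by simp
  show thesis by (rule that[OF half_evec_in_ball nz]) (use k pr in simp)
qed

section \<open>Rational tails\<close>

text \<open>With \<open>a = FF\<^sup>t\<close> all rational tails have the form \<open>t0 = e (a + 2 w)\<close>, \<open>t1 = - i e (a - 2 w)\<close>,
  where \<open>e = 1 / (2 \<surd>2)\<close> and \<open>w\<close> is either \<open>z\<^sub>n\<close> or \<open>0\<close>.\<close>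

lemma rational_tail_identity:
  fixes a a' w w' Q Q' e :: complex
  assumes e: "e * e = 1/8" "cnj e = e" and Q: "Q = a * (1 - w)" "Q' = a' * (1 - w')"
  defines "s \<equiv> e * (a + 2 * w)" and "t \<equiv> - \<i> * e * (a - 2 * w)"
    and "s' \<equiv> e * (a' + 2 * w')" and "t' \<equiv> - \<i> * e * (a' - 2 * w')"
  shows "s * cnj s' + t * cnj t' - (Q + s\<^sup>2 + t\<^sup>2) * cnj (Q' + s'\<^sup>2 + t'\<^sup>2) / 4 = w * cnj w'"
proof -
  \<comment> \<open>The tails add x y to x (1 - y), so F F^t is indeed x; the normalisation e^2 =
    1/8 is made for this.\<close>
  have q: "x * (1 - y) + (e * (x + 2 * y))\<^sup>2 + (- \<i> * e * (x - 2 * y))\<^sup>2 = x" for x y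
  proof -
    have "(e * (x + 2 * y))\<^sup>2 + (- \<i> * e * (x - 2 * y))\<^sup>2 = (e * e) * ((x + 2 * y)\<^sup>2 - (x - 2 * y)\<^sup>2)"
      by (simp add: power2_eq_square algebra_simps)
    also have "\<dots> = x * y" unfolding e by (simp add: power2_eq_square algebra_simps)
    finally show ?thesis by (simp add: algebra_simps)
  qed
  \<comment> \<open>In the hermitian product the mixed terms cancel. Of what remains, a cnj(a') / 4
    is removed by the quadratic term of the identity and w cnj(w') survives.\<close>
  have "s * cnj s' + t * cnj t' = (e * e) * ((a + 2 * w) * cnj (a' + 2 * w') + (a - 2 * w) * cnj (a' - 2 * w'))"
    by (simp add: s_def t_def s'_def t'_def e(2) algebra_simps)
  also have "\<dots> = a * cnj a' / 4 + w * cnj w'"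
    unfolding e by (simp add: field_simps)
  finally show ?thesis
    unfolding Q s_def t_def s'_def t'_def q by simp
qed

definition tail_scale :: complex where
  "tail_scale = 1 / (2 * complex_of_real (sqrt 2))"

lemma tail_scale: "tail_scale * tail_scale = 1/8" "cnj tail_scale = tail_scale" "tail_scale \<noteq> 0"
proof -
  have "complex_of_real (sqrt 2) * complex_of_real (sqrt 2) = 2"
    by (simp flip: of_real_mult)
  then show "tail_scale * tail_scale = 1/8" by (simp add: tail_scale_def)
qed (simp_all add: tail_scale_def)

text \<open>At a suitable test point the tail relation reduces to this form; cancelling x separates
  the two coefficients into real and imaginary part.\<close>

lemma real_combination_zero:
  fixes x :: complex
  assumes "complex_of_real \<alpha> * x + \<i> * complex_of_real \<beta> * x = 0" "x \<noteq> 0"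
  shows "\<alpha> = 0" "\<beta> = 0"
proof -
  have "(complex_of_real \<alpha> + \<i> * complex_of_real \<beta>) * x = 0"
    using assms(1) by (simp add: algebra_simps)
  then have "complex_of_real \<alpha> + \<i> * complex_of_real \<beta> = 0"
    using assms(2) by simp
  then show "\<alpha> = 0" "\<beta> = 0" by (auto simp: complex_eq_iff)
qed

text \<open>The case w = 0: the tails satisfy t1 = -i t0, so their squares cancel and F F^t is the
  quadratic form itself. Taking p = n - 1 gives \<open>R_b\<close>, and p = n gives
  \<open>R_c\<close>.\<close>

lemma polynomial_tail:
  assumes p: "p \<le> n" "n \<ge> 1" and angle: "\<And>j. j < p \<Longrightarrow> th j \<in> {0<..pi/4}"
    and nz: "p < n \<or> (\<exists>j<p. th j \<noteq> pi/4)"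
  defines "t0 \<equiv> \<lambda>z. tail_scale * quad th p n z" and "t1 \<equiv> \<lambda>z. - \<i> * tail_scale * quad th p n z"
  shows "holo_isometry n (p + n + 2) (pair_map th p n t0 t1) \<and>
    minimum_map n (p + n + 2) (pair_map th p n t0 t1)"
proof -
  interpret pair_map_data n "p + n + 2" p n th t0 t1
  proof
    show "scalar_diff n (cball_n n) t0 z" "scalar_diff n (cball_n n) t1 z" for z
      unfolding t0_def t1_def using p by (intro scalar_diff_cmult scalar_diff_quad; simp)+
    show "t0 (\<lambda>_. 0) = 0" "t1 (\<lambda>_. 0) = 0" by (simp_all add: t0_def t1_def quad_zero)
    show "(\<Sum>j<n. z j * cnj (w j)) + t0 z * cnj (t0 w) + t1 z * cnj (t1 w)
        - (quad th p n z + (t0 z)\<^sup>2 + (t1 z)\<^sup>2) * cnj (quad th p n w + (t0 w)\<^sup>2 + (t1 w)\<^sup>2) / 4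
      = (\<Sum>j<n. z j * cnj (w j))" for z w
    proof -
      have 0: "t0 z = tail_scale * (quad th p n z + 2 * 0)" "t1 z = - \<i> * tail_scale * (quad th p n z - 2 * 0)" for z
        by (simp_all add: t0_def t1_def)
      have "t0 z * cnj (t0 w) + t1 z * cnj (t1 w)
        - (quad th p n z + (t0 z)\<^sup>2 + (t1 z)\<^sup>2) * cnj (quad th p n w + (t0 w)\<^sup>2 + (t1 w)\<^sup>2) / 4 = 0 * cnj 0"
        unfolding 0 by (rule rational_tail_identity[OF tail_scale(1,2)]) simp_all
      then show ?thesis by (simp only: add.assoc add_diff_eq[symmetric]) simp
    qed
  qed (use p in auto)
  obtain z0 where z0: "z0 \<in> cball_n n" "quad th p n z0 \<noteq> 0"
    using quad_nonzero[of p n n th] p angle nz by blast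
  have t1: "t1 \<noteq> (\<lambda>_. 0)" using z0(2) tail_scale(3) by (auto simp: t1_def fun_eq_iff)
  have "minimum_map n (p + n + 2) F"
  proof (rule F_minimum)
    fix c \<beta>0 \<beta>1
    assume "\<And>z. z \<in> cball_n n \<Longrightarrow>
        (\<Sum>j<n. c j * z j) + complex_of_real \<beta>0 * t0 z + complex_of_real \<beta>1 * t1 z = 0"
    then have "complex_of_real \<beta>0 * t0 z0 + complex_of_real \<beta>1 * t1 z0 = 0"
      by (rule even_tail_relation) (use z0 in \<open>simp_all add: t0_def t1_def quad_even\<close>)
    then have "complex_of_real \<beta>0 * t0 z0 + \<i> * complex_of_real (- \<beta>1) * t0 z0 = 0"
      by (simp add: t0_def t1_def algebra_simps)
    moreover have "t0 z0 \<noteq> 0" using z0(2) tail_scale(3) by (simp add: t0_def)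
    ultimately show "\<beta>0 = 0 \<and> (t1 \<noteq> (\<lambda>_. 0) \<longrightarrow> \<beta>1 = 0)"
      using real_combination_zero by (metis neg_equal_0_iff_equal)
  qed (use p angle t1 in auto)
  then show ?thesis using F_isometry by blast
qed

text \<open>The plain block consists of the single coordinate \<open>z (n - 1)\<close>, at index 2 n
  - 2.\<close>

lemma R_b_eq:
  assumes "n \<ge> 2"
  shows "R_b n th = pair_map th (n - 1) n (\<lambda>z. tail_scale * quad th (n - 1) n z)
    (\<lambda>z. - \<i> * tail_scale * quad th (n - 1) n z)"
proof (intro ext)
  fix z q
  have "{n - 1..<n} = {n - 1}" using assms by auto
  then have "quad th (n - 1) n z = (\<Sum>j<n-1. complex_of_real (cos (2 * th j)) * (z j)\<^sup>2) + (z (n - 1))\<^sup>2"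
    by (simp add: quad_def)
  moreover have "n - 1 + n = 2 * n - 1" "n - 1 + n + 1 = 2 * n" "\<And>q. q < n - 1 + n \<longleftrightarrow> q < 2 * (n - 1) \<or> q = 2 * n - 2"
    using assms by auto
  ultimately show "R_b n th z q = pair_map th (n - 1) n (\<lambda>z. tail_scale * quad th (n - 1) n z)
    (\<lambda>z. - \<i> * tail_scale * quad th (n - 1) n z) z q"
    using assms by (auto simp: R_b_def Let_def pair_map_def tail_scale_def diff_mult_distrib2)
qed

lemma R_c_eq:
  "R_c n th = pair_map th n n (\<lambda>z. tail_scale * quad th n n z) (\<lambda>z. - \<i> * tail_scale * quad th n n z)"
  by (intro ext) (auto simp: R_c_def Let_def pair_map_def tail_scale_def quad_def)

lemma R_low_eq:
  assumes "2 \<le> k" "k \<le> n"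
  shows "R_low n k th = pair_map th (k - 1) (n - 1)
    (\<lambda>z. (quad th (k - 1) (n - 1) z - 2 * (z (n - 1))\<^sup>2 + 2 * z (n - 1))
        / (2 * complex_of_real (sqrt 2) * (1 - z (n - 1))))
    (\<lambda>z. (quad th (k - 1) (n - 1) z + 2 * (z (n - 1))\<^sup>2 - 2 * z (n - 1))
        / (2 * complex_of_real (sqrt 2) * \<i> * (1 - z (n - 1))))"
proof -
  have "k - 1 + (n - 1) = n + k - 2" "k - 1 + (n - 1) + 1 = n + k - 1" using assms by auto
  then show ?thesis
    by (intro ext) (simp only: R_low_def Let_def pair_map_def quad_def)
qed

text \<open>Here r = n - 1: the last coordinate w appears only in the tails, and
  \<open>rational_tail_identity\<close> recovers its term w cnj(w') of the inner product.\<close>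

lemma R_low_isometry_minimum:
  assumes k: "2 \<le> k" "k \<le> n" and angle: "\<And>j. j < k - 1 \<Longrightarrow> th j \<in> {0<..pi/4}"
  shows "holo_isometry n (n + k) (R_low n k th) \<and> minimum_map n (n + k) (R_low n k th)"
proof -
  define p r where "p = k - 1" and "r = n - 1"
  have idx: "p \<le> r" "r \<le> n" "r < n" "1 \<le> p" "n + k = p + r + 2" "n = Suc r" using k by (auto simp: p_def r_def)
  define t0 where "t0 z = (quad th p r z - 2 * (z r)\<^sup>2 + 2 * z r)
        / (2 * complex_of_real (sqrt 2) * (1 - z r))" for z
  define t1 where "t1 z = (quad th p r z + 2 * (z r)\<^sup>2 - 2 * z r)
        / (2 * complex_of_real (sqrt 2) * \<i> * (1 - z r))" for z
  have R: "R_low n k th = pair_map th p r t0 t1"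
    unfolding R_low_eq[OF k] t0_def[abs_def] t1_def[abs_def] p_def r_def ..
  have w1: "1 - z r \<noteq> 0" if "z \<in> cball_n n" for z
  proof -
    have "(cmod (z r))\<^sup>2 \<le> (\<Sum>j<n. (cmod (z j))\<^sup>2)"
      using idx by (intro member_le_sum) auto
    also have "\<dots> < 1" using that by (simp add: cball_n_def)
    finally show ?thesis by auto
  qed
  \<comment> \<open>With a = Q / (1 - w), the numerators Q - 2 w^2 + 2 w and Q + 2 w^2 - 2 w factor
    as (a + 2 w)(1 - w) and (a - 2 w)(1 - w), and the denominator cancels.\<close>
  define a where "a z = quad th p r z / (1 - z r)" for z
  have qa: "quad th p r z = a z * (1 - z r)" if "z \<in> cball_n n" for z
    using w1[OF that] by (simp add: a_def)
  have t0: "t0 z = tail_scale * (a z + 2 * z r)" if "z \<in> cball_n n" for z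
  proof -
    have "quad th p r z - 2 * (z r)\<^sup>2 + 2 * z r = (a z + 2 * z r) * (1 - z r)"
      unfolding qa[OF that] by (simp add: power2_eq_square algebra_simps)
    then show ?thesis using w1[OF that] by (simp add: t0_def tail_scale_def)
  qed
  have t1: "t1 z = - \<i> * tail_scale * (a z - 2 * z r)" if "z \<in> cball_n n" for z
  proof -
    have num: "quad th p r z + 2 * (z r)\<^sup>2 - 2 * z r = (a z - 2 * z r) * (1 - z r)"
      unfolding qa[OF that] by (simp add: power2_eq_square algebra_simps)
    show ?thesis unfolding t1_def num using w1[OF that] by (simp add: tail_scale_def field_simps)
  qed
  have inv_diff: "scalar_diff n (cball_n n) (\<lambda>z. inverse (K * (1 - z r))) z"
    if "K \<noteq> 0" "z \<in> cball_n n" for K z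
  proof (rule scalar_diff_compose[where f = "\<lambda>z. z r" and h = "\<lambda>x. inverse (K * (1 - x))"])
    show "scalar_diff n (cball_n n) (\<lambda>z. z r) z" using idx by (intro scalar_diff_coord) simp
    show "((\<lambda>x. inverse (K * (1 - x))) has_field_derivative
        - (inverse (K * (1 - z r)) * (K * (0 - 1)) * inverse (K * (1 - z r)))) (at (z r))"
      using that w1[OF that(2)] by (auto intro!: derivative_eq_intros)
  qed
  interpret pair_map_data n "n + k" p r th t0 t1
  proof
    show "scalar_diff n (cball_n n) t0 z" "scalar_diff n (cball_n n) t1 z" if "z \<in> cball_n n" for z
      unfolding t0_def[abs_def] t1_def[abs_def] divide_inverse
      by (intro scalar_diff_mult scalar_diff_add scalar_diff_minus scalar_diff_cmult scalar_diff_power2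
          scalar_diff_quad[OF idx(1,2)] scalar_diff_coord[OF idx(3)] inv_diff[OF _ that]
          scalar_diff_const; simp)+
    show "t0 (\<lambda>_. 0) = 0" "t1 (\<lambda>_. 0) = 0" by (simp_all add: t0_def t1_def quad_zero)
    show "(\<Sum>j<r. z j * cnj (w j)) + t0 z * cnj (t0 w) + t1 z * cnj (t1 w)
        - (quad th p r z + (t0 z)\<^sup>2 + (t1 z)\<^sup>2) * cnj (quad th p r w + (t0 w)\<^sup>2 + (t1 w)\<^sup>2) / 4
      = (\<Sum>j<n. z j * cnj (w j))" if "z \<in> cball_n n" "w \<in> cball_n n" for z w
    proof -
      have "t0 z * cnj (t0 w) + t1 z * cnj (t1 w)
        - (quad th p r z + (t0 z)\<^sup>2 + (t1 z)\<^sup>2) * cnj (quad th p r w + (t0 w)\<^sup>2 + (t1 w)\<^sup>2) / 4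
        = z r * cnj (w r)"
        unfolding t0[OF that(1)] t0[OF that(2)] t1[OF that(1)] t1[OF that(2)]
        by (rule rational_tail_identity[OF tail_scale(1,2) qa[OF that(1)] qa[OF that(2)]])
      then show ?thesis unfolding idx(6) sum.lessThan_Suc by (simp only: add.assoc add_diff_eq[symmetric])
    qed
  qed (use idx(1,2,5) in auto)
  \<comment> \<open>A test point takes the place of the parity argument: on the last axis the linear
    part and the quadratic form vanish, and the tails differ exactly by the factor i.\<close>
  let ?z = "\<lambda>i. (1/2) * evec r i"
  have z: "?z \<in> cball_n n" by (rule half_evec_in_ball[OF idx(3)])
  have "quad th p r ?z = 0" using idx by (auto simp: quad_def evec_def)
  then have "a ?z = 0" by (simp add: a_def)
  moreover have "?z r = 1/2" by (simp add: evec_def)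
  ultimately have tz: "t0 ?z = tail_scale" "t1 ?z = \<i> * tail_scale"
    unfolding t0[OF z] t1[OF z] by simp_all
  have t1_nz: "t1 \<noteq> (\<lambda>_. 0)" using tz(2) tail_scale(3) by auto
  have "minimum_map n (n + k) F"
  proof (rule F_minimum)
    fix c \<beta>0 \<beta>1
    assume rel: "\<And>z. z \<in> cball_n n \<Longrightarrow>
        (\<Sum>j<r. c j * z j) + complex_of_real \<beta>0 * t0 z + complex_of_real \<beta>1 * t1 z = 0"
    have "(\<Sum>j<r. c j * ?z j) = 0" by (intro sum.neutral) (auto simp: evec_def)
    then have "complex_of_real \<beta>0 * tail_scale + \<i> * complex_of_real \<beta>1 * tail_scale = 0"
      using rel[OF z] unfolding tz by (simp add: mult_ac)
    from real_combination_zero[OF this tail_scale(3)]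
    show "\<beta>0 = 0 \<and> (t1 \<noteq> (\<lambda>_. 0) \<longrightarrow> \<beta>1 = 0)" by simp
  qed (use k angle t1_nz in \<open>auto simp: p_def\<close>)
  then show ?thesis unfolding R using F_isometry by blast
qed

section \<open>Tails with a square root\<close>

text \<open>E is a root of E^2 = 2 E - c Q with Q the quadratic form. The condition on \<kappa>0^2 -
  \<kappa>1^2 makes F F^t equal to Q + E^2 / c = 2 E / c; the one on \<kappa>0^2 + \<kappa>1^2 makes
  the hermitian product of the tails E cnj(E') / c^2. This is exactly the quadratic term of the
  identity, so the two cancel.\<close>

lemma sqrt_tail:
  fixes c \<kappa>0 \<kappa>1 :: real
  assumes p: "p \<le> n" "n \<ge> 2" and angle: "\<And>j. j < p \<Longrightarrow> th j \<in> {0<..pi/4}"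
    and nz: "p < n \<or> (\<exists>j<p. th j \<noteq> pi/4)"
    and c: "0 < c" "c \<le> 1" and \<kappa>: "\<kappa>0\<^sup>2 - \<kappa>1\<^sup>2 = 1 / c" "\<kappa>0\<^sup>2 + \<kappa>1\<^sup>2 = 1 / c\<^sup>2" "\<kappa>0 \<noteq> 0"
    and m: "(m = p + n + 2 \<and> \<kappa>1 \<noteq> 0) \<or> (m = p + n + 1 \<and> \<kappa>1 = 0)"
  defines "E \<equiv> \<lambda>z. 1 - csqrt (1 - of_real c * quad th p n z)"
  defines "t0 \<equiv> \<lambda>z. of_real \<kappa>0 * E z" and "t1 \<equiv> \<lambda>z. \<i> * of_real \<kappa>1 * E z"
  shows "holo_isometry n m (pair_map th p n t0 t1) \<and> minimum_map n m (pair_map th p n t0 t1)"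
proof -
  have E2: "(E z)\<^sup>2 = 2 * E z - of_real c * quad th p n z" for z
  proof -
    have "(csqrt (1 - of_real c * quad th p n z))\<^sup>2 = 1 - of_real c * quad th p n z" by simp
    then show ?thesis by (simp add: E_def power2_eq_square algebra_simps)
  qed
  have q: "quad th p n z + (t0 z)\<^sup>2 + (t1 z)\<^sup>2 = 2 * E z / of_real c" for z
  proof -
    have "(t0 z)\<^sup>2 + (t1 z)\<^sup>2 = of_real (\<kappa>0\<^sup>2 - \<kappa>1\<^sup>2) * (E z)\<^sup>2"
      by (simp add: t0_def t1_def power_mult_distrib algebra_simps)
    also have "\<dots> = (2 * E z - of_real c * quad th p n z) / of_real c"
      unfolding E2 \<kappa> by simp
    also have "\<dots> = 2 * E z / of_real c - quad th p n z"
      using c by (simp add: diff_divide_distrib)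
    finally show ?thesis by (simp add: add.assoc)
  qed
  have tt: "t0 z * cnj (t0 w) + t1 z * cnj (t1 w) = E z * cnj (E w) / (of_real c * of_real c)" for z w
  proof -
    have "t0 z * cnj (t0 w) + t1 z * cnj (t1 w) = of_real (\<kappa>0\<^sup>2 + \<kappa>1\<^sup>2) * (E z * cnj (E w))"
      by (simp add: t0_def t1_def power2_eq_square algebra_simps)
    then show ?thesis unfolding \<kappa> by (simp add: power2_eq_square)
  qed
  have E_diff: "scalar_diff n (cball_n n) E z" if z: "z \<in> cball_n n" for z
  proof -
    have "cmod (of_real c * quad th p n z) < 1"
      using cmod_quad_less_1[of p n n z th] p z c mult_right_mono[of c 1 "cmod (quad th p n z)"]
      by (simp add: norm_mult)
    then have "Re (1 - of_real c * quad th p n z) > 0"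
      using complex_Re_le_cmod[of "of_real c * quad th p n z"] by simp
    then have "1 - of_real c * quad th p n z \<notin> \<real>\<^sub>\<le>\<^sub>0"
      by (auto simp: complex_nonpos_Reals_iff)
    then have D: "(csqrt has_field_derivative inverse (2 * csqrt (1 - of_real c * quad th p n z)))
        (at (1 - of_real c * quad th p n z))"
      by (rule has_field_derivative_csqrt)
    have "scalar_diff n (cball_n n) (\<lambda>z. 1 - of_real c * quad th p n z) z"
      using p by (intro scalar_diff_minus scalar_diff_const scalar_diff_cmult scalar_diff_quad) auto
    from scalar_diff_compose[where h = csqrt, OF this D]
    have "scalar_diff n (cball_n n) (\<lambda>z. csqrt (1 - of_real c * quad th p n z)) z" .
    then show ?thesis
      unfolding E_def by (intro scalar_diff_minus scalar_diff_const)
  qed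
  interpret pair_map_data n m p n th t0 t1
  proof
    show "m = p + n + 2 \<or> (m = p + n + 1 \<and> t1 = (\<lambda>_. 0))"
      using m by (auto simp: t1_def)
    show "scalar_diff n (cball_n n) t0 z" "scalar_diff n (cball_n n) t1 z" if "z \<in> cball_n n" for z
      unfolding t0_def t1_def using E_diff[OF that] by (intro scalar_diff_cmult; simp)+
    show "t0 (\<lambda>_. 0) = 0" "t1 (\<lambda>_. 0) = 0" by (simp_all add: t0_def t1_def E_def quad_zero)
    show "(\<Sum>j<n. z j * cnj (w j)) + t0 z * cnj (t0 w) + t1 z * cnj (t1 w)
        - (quad th p n z + (t0 z)\<^sup>2 + (t1 z)\<^sup>2) * cnj (quad th p n w + (t0 w)\<^sup>2 + (t1 w)\<^sup>2) / 4
      = (\<Sum>j<n. z j * cnj (w j))" for z w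
      unfolding q unfolding add.assoc tt by simp
  qed (use p in auto)
  obtain z0 where z0: "z0 \<in> cball_n n" "quad th p n z0 \<noteq> 0"
    using quad_nonzero[of p n n th] p angle nz by blast
  \<comment> \<open>If E vanished at \<open>z0\<close>, its quadratic equation would force c times
    the form to vanish there.\<close>
  have Ez0: "E z0 \<noteq> 0"
    using E2[of z0] z0(2) c by auto
  have t1_nz: "t1 = (\<lambda>_. 0) \<longleftrightarrow> \<kappa>1 = 0"
    using Ez0 by (auto simp: t1_def fun_eq_iff)
  have "minimum_map n m F"
  proof (rule F_minimum)
    fix d \<beta>0 \<beta>1
    assume "\<And>z. z \<in> cball_n n \<Longrightarrow>
        (\<Sum>j<n. d j * z j) + complex_of_real \<beta>0 * t0 z + complex_of_real \<beta>1 * t1 z = 0"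
    then have "complex_of_real \<beta>0 * t0 z0 + complex_of_real \<beta>1 * t1 z0 = 0"
      by (rule even_tail_relation) (use z0 in \<open>simp_all add: t0_def t1_def E_def quad_even\<close>)
    then have "complex_of_real (\<beta>0 * \<kappa>0) * E z0 + \<i> * complex_of_real (\<beta>1 * \<kappa>1) * E z0 = 0"
      by (simp add: t0_def t1_def mult_ac)
    from real_combination_zero[OF this Ez0]
    show "\<beta>0 = 0 \<and> (t1 \<noteq> (\<lambda>_. 0) \<longrightarrow> \<beta>1 = 0)" using \<kappa>(3) t1_nz by auto
  qed (use p angle m t1_nz in auto)
  then show ?thesis using F_isometry by blast
qed

text \<open>The trivial constants are spelled out so that the right side is the instance c =
  \<kappa>0 = 1, \<kappa>1 = 0 of \<open>sqrt_tail\<close>.\<close>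

lemma I_map_eq:
  assumes "k \<ge> 1"
  shows "I_map n k th = pair_map th (k - 1) n (\<lambda>z. of_real 1 * (1 - csqrt (1 - of_real 1 * quad th (k - 1) n z)))
    (\<lambda>z. \<i> * of_real 0 * (1 - csqrt (1 - of_real 1 * quad th (k - 1) n z)))"
proof -
  have "k - 1 + n = n + k - 1" using assms by auto
  then show ?thesis
    by (intro ext) (simp add: I_map_def Let_def pair_map_def quad_def)
qed

text \<open>For k \<le> n there is a plain coordinate; for k = n + 1 there is none, and an angle
  different from pi/4 keeps the tail nonzero.\<close>

lemma I_map_isometry_minimum:
  assumes "2 \<le> n" "2 \<le> k" "k \<le> n + 1" "\<And>j. j < k - 1 \<Longrightarrow> th j \<in> {0<..pi/4}"
    "k \<le> n \<or> (\<exists>j<k - 1. th j \<noteq> pi/4)"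
  shows "holo_isometry n (n + k) (I_map n k th) \<and> minimum_map n (n + k) (I_map n k th)"
  unfolding I_map_eq[OF order_trans[OF one_le_numeral assms(2)]]
  by (rule sqrt_tail) (use assms in auto)

text \<open>With c = cos(2 \<theta>), \<kappa>0 = cos \<theta> / c and \<kappa>1 = sin \<theta> / c,
  the two conditions of \<open>sqrt_tail\<close> are the double angle formula and cos^2 + sin^2 =
  1.\<close>

lemma I_c_isometry_minimum:
  assumes n: "2 \<le> n" and th: "\<And>j. j < n \<Longrightarrow> th j \<in> {0<..pi/4}" "\<exists>j<n. th j \<noteq> pi/4"
    and \<theta>: "\<theta> \<in> {0<..<pi/4}"
  shows "holo_isometry n (n + (n + 2)) (I_c n th \<theta>) \<and> minimum_map n (n + (n + 2)) (I_c n th \<theta>)"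
proof -
  define c where "c = cos (2 * \<theta>)"
  have c: "0 < c" "c \<le> 1" using cos_double_pos[OF \<theta>] by (auto simp: c_def)
  have pos: "cos \<theta> > 0" "sin \<theta> > 0"
    using \<theta> pi_gt_zero by (auto intro!: cos_gt_zero sin_gt_zero)
  have "I_c n th \<theta> = pair_map th n n (\<lambda>z. of_real (cos \<theta> / c) * (1 - csqrt (1 - of_real c * quad th n n z)))
    (\<lambda>z. \<i> * of_real (sin \<theta> / c) * (1 - csqrt (1 - of_real c * quad th n n z)))"
    by (intro ext) (simp add: I_c_def Let_def pair_map_def quad_def c_def)
  moreover have "(cos \<theta> / c)\<^sup>2 - (sin \<theta> / c)\<^sup>2 = 1 / c"
  proof -
    have "(cos \<theta> / c)\<^sup>2 - (sin \<theta> / c)\<^sup>2 = ((cos \<theta>)\<^sup>2 - (sin \<theta>)\<^sup>2) / c\<^sup>2"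
      by (simp add: power_divide diff_divide_distrib)
    also have "\<dots> = c / c\<^sup>2" by (simp add: c_def cos_double)
    finally show ?thesis using c by (simp add: power2_eq_square)
  qed
  moreover have "(cos \<theta> / c)\<^sup>2 + (sin \<theta> / c)\<^sup>2 = 1 / c\<^sup>2"
    by (simp add: power_divide flip: add_divide_distrib)
  ultimately show ?thesis
    using sqrt_tail[of n n th c "cos \<theta> / c" "sin \<theta> / c" "n + (n + 2)"] n th c pos by auto
qed

theorem mainTheorem2:
  fixes n k :: nat and th :: "nat \<Rightarrow> real" and \<theta> :: real
  assumes "2 \<le> n" and "2 \<le> k" and "k \<le> n + 2"
  shows
   "(k \<le> n \<and> (\<forall>j<k-1. th j \<in> {0<..pi/4}) \<longrightarrow>
       holo_isometry n (n + k) (R_low n k th) \<and> minimum_map n (n + k) (R_low n k th) \<and>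
       holo_isometry n (n + k) (I_map n k th) \<and> minimum_map n (n + k) (I_map n k th))
  \<and> (k = n + 1 \<and> (\<forall>j<n-1. th j \<in> {0<..pi/4}) \<longrightarrow>
       holo_isometry n (n + k) (R_b n th) \<and> minimum_map n (n + k) (R_b n th))
  \<and> (k = n + 1 \<and> (\<forall>j<n. th j \<in> {0<..pi/4}) \<and> \<not> (\<forall>j<n. th j = pi/4) \<longrightarrow>
       holo_isometry n (n + k) (I_map n k th) \<and> minimum_map n (n + k) (I_map n k th))
  \<and> (k = n + 2 \<and> (\<forall>j<n. th j \<in> {0<..pi/4}) \<and> \<not> (\<forall>j<n. th j = pi/4) \<and> \<theta> \<in> {0<..<pi/4} \<longrightarrow>
       holo_isometry n (n + k) (R_c n th) \<and> minimum_map n (n + k) (R_c n th) \<and>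
       holo_isometry n (n + k) (I_c n th \<theta>) \<and> minimum_map n (n + k) (I_c n th \<theta>))"
proof (intro conjI impI; (elim conjE)?)
  assume k: "k \<le> n" and th: "\<forall>j<k-1. th j \<in> {0<..pi/4}"
  from R_low_isometry_minimum[OF assms(2) k, of th] I_map_isometry_minimum[OF assms(1,2), of th] k th
  show "holo_isometry n (n + k) (R_low n k th)" "minimum_map n (n + k) (R_low n k th)"
    "holo_isometry n (n + k) (I_map n k th)" "minimum_map n (n + k) (I_map n k th)"
    by auto
next
  assume k: "k = n + 1" and th: "\<forall>j<n-1. th j \<in> {0<..pi/4}"
  have "n + k = n - 1 + n + 2" using k assms by simp
  then show "holo_isometry n (n + k) (R_b n th)" "minimum_map n (n + k) (R_b n th)"
    using polynomial_tail[of "n - 1" n th] th assms R_b_eq[OF assms(1), of th] by auto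
next
  assume "k = n + 1" "\<forall>j<n. th j \<in> {0<..pi/4}" "\<not> (\<forall>j<n. th j = pi/4)"
  then show "holo_isometry n (n + k) (I_map n k th)" "minimum_map n (n + k) (I_map n k th)"
    using I_map_isometry_minimum[OF assms(1,2), of th] by auto
next
  assume *: "k = n + 2" "\<forall>j<n. th j \<in> {0<..pi/4}" "\<not> (\<forall>j<n. th j = pi/4)" "\<theta> \<in> {0<..<pi/4}"
  then have "n + k = n + n + 2" by simp
  then show "holo_isometry n (n + k) (R_c n th)" "minimum_map n (n + k) (R_c n th)"
    using polynomial_tail[of n n th] * assms R_c_eq[of n th] by auto
  show "holo_isometry n (n + k) (I_c n th \<theta>)" "minimum_map n (n + k) (I_c n th \<theta>)"
    using I_c_isometry_minimum[of n th \<theta>] * assms by auto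
qed

end
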